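(* Let $t, r$ be positive integers with $t \ge 2$, and suppose that, over the field $\mathbb{F}_q$, there are coefficients $\alpha_{i,j,\ell}, \beta_{j,k,\ell}, \gamma_{i,k,\ell} \in \mathbb{F}_q$ (for $i,j,k \in [t]$, $\ell \in [r]$) such that the following polynomial identity holds in formal variables $X_{i,j}, Y_{j,k}, Z_{i,k}$ ($i,j,k \in [t]$): $$\sum_{i=1}^t \sum_{j=1}^t \sum_{k=1}^t X_{i,j} Y_{j,k} Z_{i,k} = \sum_{\ell=1}^r \left( \sum_{i=1}^t \sum_{j=1}^t \alpha_{i,j,\ell} X_{i,j} \right)\left( \sum_{j=1}^t \sum_{k=1}^t \beta_{j,k,\ell} Y_{j,k} \right)\left( \sum_{i=1}^t \sum_{k=1}^t \gamma_{i,k,\ell} Z_{i,k} \right).$$ Fix such an identity and let $\tau = \log_t(r)$. Then for the finite field $\mathbb{F}_q$ of size $q = O(1)$ and any positive integer $n$, there is an algorithm which, given two $n \times n$ matrices over $\mathbb{F}_q$, computes their product using $O\left(n^\tau / (\log n)^{\tau/2 - 1}\right)$ bit operations.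
   Context: $\log$ denotes the base-$2$ logarithm and $[t] = \{1,\dots,t\}$. The cost measure is bit complexity: the number of operations on bits performed by a RAM algorithm (in particular, an algorithm may build and use lookup tables, where a lookup table with $b$-bit keys and values supports lookups and updates in $O(b)$ bit operations). The identity and $q$ are fixed constants; the constant in the $O(\cdot)$ may depend on them. *)

theory Defs
  imports
    Complex_Main
    "HOL-Library.Poly_Mapping"
    "HOL-Library.Log_Nat"
    "HOL-Library.Landau_Symbols"
    "Jordan_Normal_Form.Matrix"
begin

section \<open>Formal polynomials in the entries of three matrices\<close>

text \<open>
  A polynomial with coefficients in \<open>'a\<close> and formal variables in \<open>'v\<close> is a finitely supported
  map from monomials, which are finitely supported exponent vectors, to coefficients.
  The ring structure is the convolution product of \<^theory>\<open>HOL-Library.Poly_Mapping\<close>, so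
  equality is equality of coefficients and not equality of polynomial functions (over a finite
  field the two differ in general).
\<close>

type_synonym ('v, 'a) mpoly = "('v \<Rightarrow>\<^sub>0 nat) \<Rightarrow>\<^sub>0 'a"

definition mp_var :: "'v \<Rightarrow> ('v, 'a::comm_semiring_1) mpoly" where
  "mp_var v = Poly_Mapping.single (Poly_Mapping.single v 1) 1"

definition mp_const :: "'a \<Rightarrow> ('v, 'a::comm_semiring_1) mpoly" where
  "mp_const c = Poly_Mapping.single 0 c"

datatype mm_var = VarX nat nat | VarY nat nat | VarZ nat nat

section \<open>Random access machines with bit cost\<close>

text \<open>
  The machine has finitely many registers per program and an unbounded, indirectly addressed
  memory.  Registers and memory cells hold natural numbers of arbitrary size; what keeps the model
  honest is that every step is charged for the binary length of all numbers it touches, addresses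
  included.  Linear-time operations are charged the sum of the operand lengths, and multiplication
  and division the product of the operand lengths (schoolbook algorithms).  In particular a
  lookup or an update in a table with \<open>b\<close>-bit keys and values, stored from an address with
  \<open>O(b)\<close> bits on, costs \<open>O(b)\<close>.
\<close>

definition nbits :: "nat \<Rightarrow> nat" where
  "nbits x = max 1 (floorlog 2 x)"

datatype binop = PLUS | MINUS | TIMES | DIV | MOD | LESS

fun op_val :: "binop \<Rightarrow> nat \<Rightarrow> nat \<Rightarrow> nat" where
  "op_val PLUS x y = x + y"
| "op_val MINUS x y = x - y"
| "op_val TIMES x y = x * y"
| "op_val DIV x y = x div y"
| "op_val MOD x y = x mod y"
| "op_val LESS x y = (if x < y then 1 else 0)"

fun op_cost :: "binop \<Rightarrow> nat \<Rightarrow> nat \<Rightarrow> nat" where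
  "op_cost TIMES x y = nbits x * nbits y"
| "op_cost DIV x y = nbits x * nbits y"
| "op_cost MOD x y = nbits x * nbits y"
| "op_cost _ x y = nbits x + nbits y"

record ram_state =
  regs :: "nat \<Rightarrow> nat"
  mem :: "nat \<Rightarrow> nat"

datatype expr =
    Const nat
  | Reg nat
  | Load expr
  | Op binop expr expr

fun expr_val :: "expr \<Rightarrow> ram_state \<Rightarrow> nat" where
  "expr_val (Const c) s = c"
| "expr_val (Reg x) s = regs s x"
| "expr_val (Load e) s = mem s (expr_val e s)"
| "expr_val (Op f e1 e2) s = op_val f (expr_val e1 s) (expr_val e2 s)"

fun expr_cost :: "expr \<Rightarrow> ram_state \<Rightarrow> nat" where
  "expr_cost (Const c) s = nbits c"
| "expr_cost (Reg x) s = nbits x + nbits (regs s x)"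
| "expr_cost (Load e) s =
     expr_cost e s + nbits (expr_val e s) + nbits (mem s (expr_val e s))"
| "expr_cost (Op f e1 e2) s =
     expr_cost e1 s + expr_cost e2 s + op_cost f (expr_val e1 s) (expr_val e2 s)"

datatype ram_program =
    Skip
  | Assign nat expr
  | Store expr expr
  | Seq ram_program ram_program
  | If expr ram_program ram_program
  | While expr ram_program

text \<open>
  \<open>exec P s c s'\<close>: started in state \<open>s\<close>, the program \<open>P\<close> halts in state \<open>s'\<close> after \<open>c\<close> bit
  operations.  A condition counts as true if its value is nonzero.
\<close>

inductive exec :: "ram_program \<Rightarrow> ram_state \<Rightarrow> nat \<Rightarrow> ram_state \<Rightarrow> bool" where
  exec_Skip: "exec Skip s 1 s"
| exec_Assign:
    "exec (Assign x e) s
       (expr_cost e s + nbits x + nbits (expr_val e s))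
       (s\<lparr>regs := (regs s)(x := expr_val e s)\<rparr>)"
| exec_Store:
    "exec (Store e1 e2) s
       (expr_cost e1 s + expr_cost e2 s + nbits (expr_val e1 s) + nbits (expr_val e2 s))
       (s\<lparr>mem := (mem s)(expr_val e1 s := expr_val e2 s)\<rparr>)"
| exec_Seq:
    "exec P s c s' \<Longrightarrow> exec Q s' d s'' \<Longrightarrow> exec (Seq P Q) s (c + d) s''"
| exec_If_true:
    "expr_val e s \<noteq> 0 \<Longrightarrow> exec P s c s' \<Longrightarrow> exec (If e P Q) s (expr_cost e s + c) s'"
| exec_If_false:
    "expr_val e s = 0 \<Longrightarrow> exec Q s c s' \<Longrightarrow> exec (If e P Q) s (expr_cost e s + c) s'"
| exec_While_true:
    "expr_val e s \<noteq> 0 \<Longrightarrow> exec P s c s' \<Longrightarrow> exec (While e P) s' d s'' \<Longrightarrow>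
     exec (While e P) s (expr_cost e s + c + d) s''"
| exec_While_false:
    "expr_val e s = 0 \<Longrightarrow> exec (While e P) s (expr_cost e s) s"

inductive_cases exec_SkipE: "exec Skip s c s'"
inductive_cases exec_AssignE: "exec (Assign x e) s c s'"
inductive_cases exec_StoreE: "exec (Store e1 e2) s c s'"
inductive_cases exec_SeqE: "exec (Seq P Q) s c s'"
inductive_cases exec_IfE: "exec (If e P Q) s c s'"
inductive_cases exec_WhileE: "exec (While e P) s c s'"

lemma exec_deterministic:
  "exec P s c s' \<Longrightarrow> exec P s d s'' \<Longrightarrow> d = c \<and> s'' = s'"
proof (induction P s c s' arbitrary: d s'' rule: exec.induct)
  case exec_Skip
  then show ?case by (auto elim: exec_SkipE)
next
  case exec_Assign
  then show ?case by (auto elim: exec_AssignE)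
next
  case exec_Store
  then show ?case by (auto elim: exec_StoreE)
next
  case exec_Seq
  then show ?case by (blast elim: exec_SeqE)
next
  case (exec_If_true e s P c s' Q)
  from exec_If_true.prems exec_If_true.hyps(1)
  obtain c' where "exec P s c' s''" "d = expr_cost e s + c'"
    by (cases rule: exec.cases) simp_all
  with exec_If_true.IH show ?case by simp
next
  case (exec_If_false e s Q c s' P)
  from exec_If_false.prems exec_If_false.hyps(1)
  obtain c' where "exec Q s c' s''" "d = expr_cost e s + c'"
    by (cases rule: exec.cases) simp_all
  with exec_If_false.IH show ?case by simp
next
  case (exec_While_true e s P c s1 d1 s2)
  from exec_While_true.prems exec_While_true.hyps(1)
  obtain c' t d' where "exec P s c' t" "exec (While e P) t d' s''" "d = expr_cost e s + c' + d'"
    by (auto elim: exec_WhileE)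
  with exec_While_true.IH show ?case by metis
next
  case exec_While_false
  then show ?case by (auto elim: exec_WhileE)
qed

section \<open>Matrix input and output\<close>

text \<open>
  \<open>enc\<close> numbers the field elements.  Initially register 0 holds \<open>n\<close>; the cells
  \<open>0, \<dots>, n\<^sup>2 - 1\<close> hold the entries of \<open>A\<close> and the next \<open>n\<^sup>2\<close> cells those of \<open>B\<close>, row by row and
  one entry per cell; everything else is 0, so no lookup table is given in advance.
  The result is expected, in the same format, in the \<open>n\<^sup>2\<close> cells that follow those of \<open>B\<close>.
\<close>

definition mm_input :: "('a \<Rightarrow> nat) \<Rightarrow> nat \<Rightarrow> 'a mat \<Rightarrow> 'a mat \<Rightarrow> ram_state" where
  "mm_input enc n A B =
     \<lparr>regs = (\<lambda>x. if x = 0 then n else 0),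
      mem = (\<lambda>a. if a < n * n then enc (A $$ (a div n, a mod n))
                 else if a < 2 * (n * n)
                   then enc (B $$ ((a - n * n) div n, (a - n * n) mod n))
                 else 0)\<rparr>"

definition mm_output :: "('a \<Rightarrow> nat) \<Rightarrow> nat \<Rightarrow> ram_state \<Rightarrow> 'a mat \<Rightarrow> bool" where
  "mm_output enc n s C \<longleftrightarrow>
     (\<forall>i<n. \<forall>j<n. mem s (2 * (n * n) + i * n + j) = enc (C $$ (i, j)))"

end

theory Submission
  imports Defs "HOL-Real_Asymp.Real_Asymp"
begin

text \<open>
  Iterating the identity \<open>k\<close> times, on matrices cut into \<open>t^k \<times> t^k\<close> blocks, reduces a product to \<open>r^k\<close> block
  products.  The blocks have side \<open>t^h\<close> of order \<open>sqrt (log n)\<close>, so that a block fits into a word of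
  \<open>O(log n)\<close> bits, and tables indexed by pairs of words multiply blocks and form \<open>x + c y\<close> in
  \<open>O(log n)\<close> bit operations.  There are \<open>r^k = O((n / sqrt (log n))^\<tau>)\<close> block products.

  No recursion is needed.  Entries are stored in Z-order, where the digits of an index in base \<open>t^2\<close>
  describe the nested blocks; the \<open>k\<close>-th Kronecker power of a coefficient matrix is then applied in \<open>k\<close>
  stages, each replacing the leading index digit by a trailing digit of the other base.  Stage \<open>s\<close>
  handles arrays of length \<open>t^(2 (k - s)) r^s\<close>, a geometric sequence dominated by \<open>r^k\<close> since \<open>r > t^2\<close>:
  otherwise some nonzero \<open>X\<close> is annihilated by all but one of the \<open>\<alpha>\<close>-forms (pigeonhole), so that \<open>X Y Z\<close>
  would have rank one as a form in \<open>Y\<close> and \<open>Z\<close>.  As \<open>\<tau> > 2\<close>, input, output and tables cost only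
  \<open>n^2\<close> times a power of \<open>log n\<close>.
\<close>

section \<open>Programs over variables and unbounded arrays\<close>

text \<open>The target leaves one factor \<open>log n\<close> for each of the \<open>r^k\<close>
  block products: \<open>(n / sqrt (log n))^\<tau> * log n\<close> is already the claimed bound. So
  the stages and the pointwise products must run in time linear in the word length \<open>L\<close>.
  A schoolbook product of two words costs \<open>L^2\<close>, too much there but affordable
  everywhere else. Costs are therefore measured against a scale \<open>W\<close> that is
  \<open>L\<close> or \<open>L^2\<close>, and a syntactic condition admits the smaller one. The
  second obstacle is uniformity: one program must serve all \<open>n\<close>, with cost constants
  independent of \<open>n\<close>. Hence program texts and cost constants mention only the field,
  the identity and the encoding, while \<open>k\<close> and the block side \<open>t^h\<close> are
  computed at run time. Apart from small \<open>n\<close>, the largest \<open>h\<close> with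
  \<open>q^(2 t^(2 h)) \<le> n\<close> is taken, so that a table indexed by two words has
  \<open>O(n)\<close> entries, and then the least \<open>k\<close> for which
  \<open>t^(k + h)\<close> reaches \<open>n\<close>.\<close>

lemma nbits_ge_1: "1 \<le> nbits x"
  by (simp add: nbits_def)

lemma nbits_leI: "x < 2 ^ b \<Longrightarrow> 1 \<le> b \<Longrightarrow> nbits x \<le> b"
  using floorlog_leI[of x 2 b] by (simp add: nbits_def)

lemma less_two_power_nbits: "x < 2 ^ nbits x"
proof -
  have "floorlog 2 x \<le> nbits x" by (simp add: nbits_def)
  then show ?thesis by (rule floorlog_leD) simp
qed

lemma nbits_mono: "x \<le> y \<Longrightarrow> nbits x \<le> nbits y"
  by (rule nbits_leI[OF le_less_trans[OF _ less_two_power_nbits] nbits_ge_1])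

lemma nbits_mult: "nbits (x * y) \<le> nbits x + nbits y"
proof (rule nbits_leI)
  show "x * y < 2 ^ (nbits x + nbits y)"
    unfolding power_add by (intro mult_strict_mono' less_two_power_nbits) auto
qed (use nbits_ge_1[of x] in simp)

text \<open>Both powers of two are at least 2, so their sum is at most their product. The bound is
  crude, but it lets bit lengths add up for sums just as for products.\<close>

lemma nbits_add: "nbits (x + y) \<le> nbits x + nbits y"
proof (rule nbits_leI)
  have "x + y < 2 ^ nbits x + 2 ^ nbits y"
    by (intro add_strict_mono less_two_power_nbits)
  also have "\<dots> \<le> (2::nat) ^ nbits x * 2 ^ nbits y"
  proof -
    have "2 \<le> (2::nat) ^ nbits x" "2 \<le> (2::nat) ^ nbits y"
      using power_increasing[OF nbits_ge_1[of x], of "2::nat"]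
        power_increasing[OF nbits_ge_1[of y], of "2::nat"] by simp_all
    moreover have "a + b \<le> a * b" if "2 \<le> a" "2 \<le> b" for a b :: nat
    proof -
      have "a + b \<le> 2 * max a b" by simp
      also have "\<dots> \<le> min a b * max a b" using that by (intro mult_le_mono) auto
      also have "\<dots> = a * b" by (simp add: min_def max_def)
      finally show ?thesis .
    qed
    ultimately show ?thesis by blast
  qed
  finally show "x + y < 2 ^ (nbits x + nbits y)" by (simp add: power_add)
qed (use nbits_ge_1[of x] in simp)

text \<open>
  Nine unbounded arrays share the memory above \<open>Off\<close>: cell \<open>i\<close> of array \<open>j\<close> has address
  \<open>Off + 9 i + aid j\<close>.  Register 0 holds \<open>Off\<close>, and register \<open>x + 1\<close> holds variable \<open>x\<close>.
\<close>

datatype arr = RHO | KAP | POW | SH | TAB | MUL | XA | XB | XC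

fun aid :: "arr \<Rightarrow> nat" where
  "aid RHO = 0" | "aid KAP = 1" | "aid POW = 2" | "aid SH = 3" | "aid TAB = 4"
| "aid MUL = 5" | "aid XA = 6" | "aid XB = 7" | "aid XC = 8"

lemma aid_less: "aid j < 9"
  by (cases j) simp_all

lemma aid_inject: "aid i = aid j \<longleftrightarrow> i = j"
  by (cases i; cases j) simp_all

lemma slot_eq_iff: "9 * x + aid i = 9 * y + aid j \<longleftrightarrow> x = y \<and> i = j"
  using aid_less[of i] aid_less[of j] aid_inject[of i j] by (auto; presburger)

text \<open>\<open>lo\<close> stands for the cells below \<open>Off\<close>, where the input lies
  and the output is expected.\<close>

record ast =
  vr :: "nat \<Rightarrow> nat"
  ar :: "arr \<Rightarrow> nat \<Rightarrow> nat"
  lo :: "nat \<Rightarrow> nat"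

datatype aexp = Lit nat | Var nat | Cell arr aexp | Bin binop aexp aexp

fun aval :: "aexp \<Rightarrow> ast \<Rightarrow> nat" where
  "aval (Lit c) a = c"
| "aval (Var x) a = vr a x"
| "aval (Cell j e) a = ar a j (aval e a)"
| "aval (Bin f e1 e2) a = op_val f (aval e1 a) (aval e2 a)"

fun to_expr :: "aexp \<Rightarrow> expr" where
  "to_expr (Lit c) = Const c"
| "to_expr (Var x) = Reg (Suc x)"
| "to_expr (Cell j e) = Load (Op PLUS (Reg 0) (Op PLUS (Op TIMES (Const 9) (to_expr e)) (Const (aid j))))"
| "to_expr (Bin f e1 e2) = Op f (to_expr e1) (to_expr e2)"

definition rel :: "nat \<Rightarrow> ast \<Rightarrow> ram_state \<Rightarrow> bool" where
  "rel Off a s \<longleftrightarrow> regs s 0 = Off \<and> (\<forall>x. regs s (Suc x) = vr a x) \<and>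
     (\<forall>j i. mem s (Off + (9 * i + aid j)) = ar a j i) \<and> (\<forall>i<Off. mem s i = lo a i)"

abbreviation frame :: "arr \<Rightarrow> (arr \<Rightarrow> nat \<Rightarrow> nat) \<Rightarrow> ast \<Rightarrow> bool" where
  "frame X A0 a \<equiv> \<forall>j. j \<noteq> X \<longrightarrow> ar a j = A0 j"

definition bounded_state :: "nat \<Rightarrow> nat \<Rightarrow> ast \<Rightarrow> bool" where
  "bounded_state L Off a \<longleftrightarrow> Off < 2 ^ L \<and> (\<forall>x. vr a x < 2 ^ L) \<and> (\<forall>j i. ar a j i < 2 ^ L) \<and>
     (\<forall>i<Off. lo a i < 2 ^ L)"

lemma expr_val_to_expr: "rel Off a s \<Longrightarrow> expr_val (to_expr e) s = aval e a"
  by (induction e) (simp_all add: rel_def)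

text \<open>
  In a state whose entries have at most \<open>L\<close> bits, an expression \<open>e\<close> has at most \<open>bits_coeff e * L\<close>
  bits, and at most \<open>bits_const e\<close> if \<open>bounded_exp e\<close>.  Evaluating it costs at most \<open>cost_coeff e * W\<close>
  for \<open>W = L^2\<close>, and for \<open>W = L\<close> if \<open>linear_exp e\<close>: every product then has a factor of constant size.
\<close>

fun bits_coeff :: "aexp \<Rightarrow> nat" where
  "bits_coeff (Lit c) = nbits c"
| "bits_coeff (Var x) = 1"
| "bits_coeff (Cell j e) = 1"
| "bits_coeff (Bin PLUS e1 e2) = bits_coeff e1 + bits_coeff e2"
| "bits_coeff (Bin MINUS e1 e2) = bits_coeff e1"
| "bits_coeff (Bin TIMES e1 e2) = bits_coeff e1 + bits_coeff e2"
| "bits_coeff (Bin DIV e1 e2) = bits_coeff e1"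
| "bits_coeff (Bin MOD e1 e2) = bits_coeff e1"
| "bits_coeff (Bin LESS e1 e2) = 1"

fun bounded_exp :: "aexp \<Rightarrow> bool" where
  "bounded_exp (Lit c) = True"
| "bounded_exp (Var x) = False"
| "bounded_exp (Cell j e) = False"
| "bounded_exp (Bin PLUS e1 e2) = (bounded_exp e1 \<and> bounded_exp e2)"
| "bounded_exp (Bin MINUS e1 e2) = bounded_exp e1"
| "bounded_exp (Bin TIMES e1 e2) = (bounded_exp e1 \<and> bounded_exp e2)"
| "bounded_exp (Bin DIV e1 e2) = bounded_exp e1"
| "bounded_exp (Bin MOD e1 e2) = (bounded_exp e1 \<or> (\<exists>c>0. e2 = Lit c))"
| "bounded_exp (Bin LESS e1 e2) = True"

fun bits_const :: "aexp \<Rightarrow> nat" where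
  "bits_const (Lit c) = nbits c"
| "bits_const (Var x) = 0"
| "bits_const (Cell j e) = 0"
| "bits_const (Bin PLUS e1 e2) = bits_const e1 + bits_const e2"
| "bits_const (Bin MINUS e1 e2) = bits_const e1"
| "bits_const (Bin TIMES e1 e2) = bits_const e1 + bits_const e2"
| "bits_const (Bin DIV e1 e2) = bits_const e1"
| "bits_const (Bin MOD e1 e2) = bits_const e1 + bits_const e2"
| "bits_const (Bin LESS e1 e2) = 1"

fun linear_exp :: "aexp \<Rightarrow> bool" where
  "linear_exp (Lit c) = True"
| "linear_exp (Var x) = True"
| "linear_exp (Cell j e) = linear_exp e"
| "linear_exp (Bin f e1 e2) = (linear_exp e1 \<and> linear_exp e2 \<and> (f \<in> {TIMES, DIV, MOD} \<longrightarrow> bounded_exp e1 \<or> bounded_exp e2))"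

fun cost_coeff :: "aexp \<Rightarrow> nat" where
  "cost_coeff (Lit c) = nbits c"
| "cost_coeff (Var x) = nbits (Suc x) + 1"
| "cost_coeff (Cell j e) = cost_coeff e + 10 * bits_coeff e + 60"
| "cost_coeff (Bin f e1 e2) = cost_coeff e1 + cost_coeff e2 + (bits_coeff e1 + bits_coeff e2) + (bits_coeff e1 + bits_const e1) * (bits_coeff e2 + bits_const e2)"

lemma nbits_aval_le:
  assumes "bounded_state L Off a" "1 \<le> L"
  shows "nbits (aval e a) \<le> bits_coeff e * L"
proof (induction e)
  case (Lit c)
  then show ?case using assms by simp
next
  case (Var x)
  then show ?case using assms by (simp add: bounded_state_def nbits_leI)
next
  case (Cell j e)
  then show ?case using assms by (simp add: bounded_state_def nbits_leI)
next
  case (Bin f e1 e2)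
  show ?case
  proof (cases f)
    case PLUS
    then show ?thesis using Bin nbits_add[of "aval e1 a" "aval e2 a"] by (simp add: algebra_simps)
  next
    case MINUS
    then show ?thesis using Bin nbits_mono[of "aval e1 a - aval e2 a" "aval e1 a"] by simp
  next
    case TIMES
    then show ?thesis using Bin nbits_mult[of "aval e1 a" "aval e2 a"] by (simp add: algebra_simps)
  next
    case DIV
    then show ?thesis using Bin nbits_mono[of "aval e1 a div aval e2 a" "aval e1 a"] by simp
  next
    case MOD
    then show ?thesis using Bin nbits_mono[of "aval e1 a mod aval e2 a" "aval e1 a"] by simp
  next
    case LESS
    have "nbits (aval (Bin f e1 e2) a) \<le> 1" using LESS by (intro nbits_leI) auto
    then show ?thesis using assms LESS by simp
  qed
qed

lemma nbits_aval_bounded: "bounded_exp e \<Longrightarrow> nbits (aval e a) \<le> bits_const e"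
proof (induction e)
  case (Bin f e1 e2)
  show ?case
  proof (cases f)
    case PLUS
    then show ?thesis using Bin nbits_add[of "aval e1 a" "aval e2 a"] by simp
  next
    case MINUS
    then show ?thesis using Bin nbits_mono[of "aval e1 a - aval e2 a" "aval e1 a"] by simp
  next
    case TIMES
    then show ?thesis using Bin nbits_mult[of "aval e1 a" "aval e2 a"] by simp
  next
    case DIV
    then show ?thesis using Bin nbits_mono[of "aval e1 a div aval e2 a" "aval e1 a"] by simp
  next
    case MOD
    then consider "bounded_exp e1" | c where "c > 0" "e2 = Lit c" using Bin by auto
    then show ?thesis
    proof cases
      case 1
      then show ?thesis using MOD Bin nbits_mono[of "aval e1 a mod aval e2 a" "aval e1 a"] by simp
    next
      case 2
      then have "nbits (aval e1 a mod c) \<le> nbits c" by (intro nbits_mono) (simp add: less_imp_le)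
      then show ?thesis using MOD 2 by simp
    qed
  next
    case LESS
    then show ?thesis by (simp add: nbits_leI)
  qed
qed simp_all

text \<open>If \<open>W\<close> is at least \<open>L^2\<close>, both lengths may be of order
  \<open>L\<close>; if \<open>W\<close> is only \<open>L\<close>, one of them must be bounded by a
  constant. Adding \<open>s1\<close> and \<open>s2\<close> to the coefficients gives one constant
  that covers all three cases.\<close>

lemma nbits_prod_le:
  assumes "x \<le> k1 * L" "y \<le> k2 * L" "L \<le> W"
    and "L * L \<le> W \<or> x \<le> s1 \<or> y \<le> s2"
  shows "x * y \<le> (k1 + s1) * (k2 + s2) * (W::nat)"
  using assms(4)
proof (elim disjE)
  assume "L * L \<le> W"
  have "x * y \<le> (k1 * L) * (k2 * L)" using assms by (intro mult_le_mono)
  also have "\<dots> = (k1 * k2) * (L * L)" by (simp add: algebra_simps)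
  also have "\<dots> \<le> ((k1 + s1) * (k2 + s2)) * W" by (intro mult_le_mono \<open>L * L \<le> W\<close>) auto
  finally show ?thesis .
next
  assume "x \<le> s1"
  then have "x * y \<le> s1 * (k2 * L)" using assms by (intro mult_le_mono)
  also have "\<dots> = (s1 * k2) * L" by simp
  also have "\<dots> \<le> ((k1 + s1) * (k2 + s2)) * W" by (intro mult_le_mono assms) auto
  finally show ?thesis .
next
  assume "y \<le> s2"
  then have "x * y \<le> (k1 * L) * s2" using assms by (intro mult_le_mono)
  also have "\<dots> = (k1 * s2) * L" by simp
  also have "\<dots> \<le> ((k1 + s1) * (k2 + s2)) * W" by (intro mult_le_mono assms) auto
  finally show ?thesis .
qed

lemma expr_cost_to_expr:
  assumes "rel Off a s" "bounded_state L Off a" "1 \<le> L" "L \<le> W" "L * L \<le> W \<or> linear_exp e"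
  shows "expr_cost (to_expr e) s \<le> cost_coeff e * W"
  using assms(5)
proof (induction e)
  case (Lit c)
  then show ?case using assms by simp
next
  case (Var x)
  have "nbits (vr a x) \<le> L" using assms by (auto simp: bounded_state_def intro: nbits_leI)
  moreover have "nbits (Suc x) \<le> nbits (Suc x) * W" using assms by simp
  moreover have "expr_cost (to_expr (Var x)) s = nbits (Suc x) + nbits (vr a x)"
    using assms(1) by (simp add: rel_def)
  ultimately show ?case using assms(4) unfolding cost_coeff.simps distrib_right by linarith
next
  case (Cell j e)
  let ?v = "aval e a"
  have v: "nbits ?v \<le> bits_coeff e * L" by (rule nbits_aval_le[OF assms(2,3)])
  also have "\<dots> \<le> bits_coeff e * W" using assms by simp
  finally have v': "nbits ?v \<le> bits_coeff e * W" .
  have n9: "nbits 9 \<le> 4" "nbits (aid j) \<le> 4" "nbits 0 \<le> 1"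
    using aid_less[of j] by (auto intro: nbits_leI)
  have m: "nbits (9 * ?v) \<le> 4 + nbits ?v" using nbits_mult[of 9 ?v] n9 by linarith
  have m2: "nbits (9 * ?v + aid j) \<le> 8 + nbits ?v"
    using nbits_add[of "9 * ?v" "aid j"] m n9 by linarith
  have o: "nbits Off \<le> W" using assms nbits_leI[of Off L] by (simp add: bounded_state_def)
  have m3: "nbits (Off + (9 * ?v + aid j)) \<le> W + 8 + nbits ?v"
    using nbits_add[of Off "9 * ?v + aid j"] m2 o by linarith
  have l: "nbits (ar a j ?v) \<le> W" using assms nbits_leI[of "ar a j ?v" L] by (simp add: bounded_state_def)
  have t: "nbits 9 * nbits ?v \<le> 4 * nbits ?v" using n9 by simp
  have ev: "expr_val (to_expr e) s = ?v" using assms(1) by (rule expr_val_to_expr)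
  have r0: "regs s 0 = Off" "mem s (Off + (9 * ?v + aid j)) = ar a j ?v"
    using assms(1) by (simp_all add: rel_def)
  have IH: "expr_cost (to_expr e) s \<le> cost_coeff e * W" using Cell by simp
  have "expr_cost (to_expr (Cell j e)) s = 
    nbits 0 + nbits Off + (nbits 9 + expr_cost (to_expr e) s + nbits 9 * nbits ?v + nbits (aid j)
      + (nbits (9 * ?v) + nbits (aid j))) + (nbits Off + nbits (9 * ?v + aid j))
     + nbits (Off + (9 * ?v + aid j)) + nbits (ar a j ?v)"
    using ev r0 by simp
  also have "\<dots> \<le> expr_cost (to_expr e) s + 7 * nbits ?v + 4 * W + 45"
    using n9 m m2 m3 o l t by linarith
  \<comment> \<open>As \<open>W\<close> is at least 1, \<open>45 + 4 * W \<le> 60 * W\<close>; the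
    coefficients 10 and 60 are rounded up.\<close>
  also have "\<dots> \<le> cost_coeff e * W + 10 * (bits_coeff e * W) + 60 * W"
    using IH v' assms(3,4) by linarith
  finally show ?case by (simp add: algebra_simps)
next
  case (Bin f e1 e2)
  let ?x = "aval e1 a" and ?y = "aval e2 a"
  have b: "nbits ?x \<le> bits_coeff e1 * L" "nbits ?y \<le> bits_coeff e2 * L"
    by (rule nbits_aval_le[OF assms(2,3)])+
  have bW: "nbits ?x \<le> bits_coeff e1 * W" "nbits ?y \<le> bits_coeff e2 * W"
    using b assms(4) by (meson le_trans mult_le_mono2)+
  have IH: "expr_cost (to_expr e1) s \<le> cost_coeff e1 * W" "expr_cost (to_expr e2) s \<le> cost_coeff e2 * W"
    using Bin by auto
  have ev: "expr_val (to_expr e1) s = ?x" "expr_val (to_expr e2) s = ?y"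
    using assms(1) by (rule expr_val_to_expr)+
  have "op_cost f ?x ?y \<le> (bits_coeff e1 + bits_coeff e2) * W + (bits_coeff e1 + bits_const e1) * (bits_coeff e2 + bits_const e2) * W"
  proof (cases "f \<in> {TIMES, DIV, MOD}")
    case True
    then have "L * L \<le> W \<or> nbits ?x \<le> bits_const e1 \<or> nbits ?y \<le> bits_const e2"
      using Bin.prems nbits_aval_bounded by auto
    then have "nbits ?x * nbits ?y \<le> (bits_coeff e1 + bits_const e1) * (bits_coeff e2 + bits_const e2) * W"
      by (intro nbits_prod_le[OF b assms(4)])
    moreover have "op_cost f ?x ?y = nbits ?x * nbits ?y" using True by auto
    ultimately show ?thesis by linarith
  next
    case False
    then have "op_cost f ?x ?y = nbits ?x + nbits ?y" by (cases f) auto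
    also have "\<dots> \<le> (bits_coeff e1 + bits_coeff e2) * W" using bW by (simp add: algebra_simps)
    finally show ?thesis by linarith
  qed
  then show ?case using IH ev by (simp add: algebra_simps)
qed

text \<open>Loops are absent, so that a constant read off the syntax bounds the cost;
  \<open>Cnd\<close> will be charged for both branches. \<open>Get\<close> and \<open>Out\<close>
  give access to the cells below \<open>Off\<close>.\<close>

datatype com =
    Sk
  | Mov nat aexp
  | Put arr aexp aexp
  | Get nat aexp
  | Out aexp aexp
  | Sq com com
  | Cnd aexp com com

fun to_prog :: "com \<Rightarrow> ram_program" where
  "to_prog Sk = Skip"
| "to_prog (Mov x e) = Assign (Suc x) (to_expr e)"
| "to_prog (Put j e1 e2) =
     Store (Op PLUS (Reg 0) (Op PLUS (Op TIMES (Const 9) (to_expr e1)) (Const (aid j)))) (to_expr e2)"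
| "to_prog (Get x e) = Assign (Suc x) (Load (to_expr e))"
| "to_prog (Out e1 e2) = Store (to_expr e1) (to_expr e2)"
| "to_prog (Sq c1 c2) = Seq (to_prog c1) (to_prog c2)"
| "to_prog (Cnd e c1 c2) = If (to_expr e) (to_prog c1) (to_prog c2)"

text \<open>The side conditions keep \<open>bounded_state\<close> invariant and confine
  \<open>Get\<close> and \<open>Out\<close> to the area below \<open>Off\<close>. What
  \<open>Get\<close> reads there is bounded already by \<open>bounded_state\<close>.\<close>

fun wp :: "nat \<Rightarrow> nat \<Rightarrow> com \<Rightarrow> (ast \<Rightarrow> bool) \<Rightarrow> ast \<Rightarrow> bool" where
  "wp L Off Sk Q a = Q a"
| "wp L Off (Mov x e) Q a = (aval e a < 2 ^ L \<and> Q (a\<lparr>vr := (vr a)(x := aval e a)\<rparr>))"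
| "wp L Off (Put j e1 e2) Q a =
     (aval e2 a < 2 ^ L \<and> Q (a\<lparr>ar := (ar a)(j := (ar a j)(aval e1 a := aval e2 a))\<rparr>))"
| "wp L Off (Get x e) Q a = (aval e a < Off \<and> Q (a\<lparr>vr := (vr a)(x := lo a (aval e a))\<rparr>))"
| "wp L Off (Out e1 e2) Q a =
     (aval e1 a < Off \<and> aval e2 a < 2 ^ L \<and> Q (a\<lparr>lo := (lo a)(aval e1 a := aval e2 a)\<rparr>))"
| "wp L Off (Sq c1 c2) Q a = wp L Off c1 (wp L Off c2 Q) a"
| "wp L Off (Cnd e c1 c2) Q a =
     ((aval e a \<noteq> 0 \<longrightarrow> wp L Off c1 Q a) \<and> (aval e a = 0 \<longrightarrow> wp L Off c2 Q a))"

fun com_coeff :: "com \<Rightarrow> nat" where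
  "com_coeff Sk = 1"
| "com_coeff (Mov x e) = cost_coeff e + nbits (Suc x) + bits_coeff e"
| "com_coeff (Put j e1 e2) = cost_coeff e1 + 10 * bits_coeff e1 + 60 + cost_coeff e2 + bits_coeff e2"
| "com_coeff (Get x e) = cost_coeff e + bits_coeff e + nbits (Suc x) + 2"
| "com_coeff (Out e1 e2) = cost_coeff e1 + cost_coeff e2 + bits_coeff e1 + bits_coeff e2"
| "com_coeff (Sq c1 c2) = com_coeff c1 + com_coeff c2"
| "com_coeff (Cnd e c1 c2) = cost_coeff e + com_coeff c1 + com_coeff c2"

fun linear_com :: "com \<Rightarrow> bool" where
  "linear_com Sk = True"
| "linear_com (Mov x e) = linear_exp e"
| "linear_com (Put j e1 e2) = (linear_exp e1 \<and> linear_exp e2)"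
| "linear_com (Get x e) = linear_exp e"
| "linear_com (Out e1 e2) = (linear_exp e1 \<and> linear_exp e2)"
| "linear_com (Sq c1 c2) = (linear_com c1 \<and> linear_com c2)"
| "linear_com (Cnd e c1 c2) = (linear_exp e \<and> linear_com c1 \<and> linear_com c2)"

section \<open>Hoare triples with cost bounds\<close>

text \<open>Total correctness: the program must halt, at cost at most \<open>T\<close>. The
  assertions see only the abstract state.\<close>

definition triple :: "nat \<Rightarrow> nat \<Rightarrow> (ast \<Rightarrow> bool) \<Rightarrow> ram_program \<Rightarrow> (ast \<Rightarrow> bool) \<Rightarrow> nat \<Rightarrow> bool" where
  "triple Off L P c Q T \<longleftrightarrow> (\<forall>a s. rel Off a s \<and> bounded_state L Off a \<and> P a \<longrightarrow>
     (\<exists>T' a' s'. exec c s T' s' \<and> T' \<le> T \<and> rel Off a' s' \<and> bounded_state L Off a' \<and> Q a'))"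

lemma rel_vr: "rel Off a s \<Longrightarrow> rel Off (a\<lparr>vr := (vr a)(x := v)\<rparr>) (s\<lparr>regs := (regs s)(Suc x := v)\<rparr>)"
  by (simp add: rel_def)

lemma rel_ar: "rel Off a s \<Longrightarrow> rel Off (a\<lparr>ar := (ar a)(j := (ar a j)(i := v))\<rparr>)
    (s\<lparr>mem := (mem s)(Off + (9 * i + aid j) := v)\<rparr>)"
  by (auto simp: rel_def slot_eq_iff)

lemma rel_lo: "rel Off a s \<Longrightarrow> i < Off \<Longrightarrow> rel Off (a\<lparr>lo := (lo a)(i := v)\<rparr>)
    (s\<lparr>mem := (mem s)(i := v)\<rparr>)"
  by (auto simp: rel_def)

lemma triple_com_aux:
  assumes "1 \<le> L" "L \<le> W"
  shows "rel Off a s \<Longrightarrow> bounded_state L Off a \<Longrightarrow> wp L Off c Q a \<Longrightarrow> L * L \<le> W \<or> linear_com c \<Longrightarrow>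
    \<exists>T' a' s'. exec (to_prog c) s T' s' \<and> T' \<le> com_coeff c * W \<and> rel Off a' s' \<and> bounded_state L Off a' \<and> Q a'"
proof (induction c arbitrary: a s Q)
  case Sk
  then show ?case using exec_Skip[of s] assms by fastforce
next
  case (Mov x e)
  let ?v = "aval e a"
  have ev: "expr_val (to_expr e) s = ?v" using Mov by (intro expr_val_to_expr)
  have c: "expr_cost (to_expr e) s \<le> cost_coeff e * W" using Mov assms by (intro expr_cost_to_expr[of Off a]) auto
  have b: "nbits ?v \<le> bits_coeff e * W"
    using nbits_aval_le[OF Mov(2) assms(1), of e] assms(2) by (meson le_trans mult_le_mono2)
  have x: "nbits (Suc x) \<le> nbits (Suc x) * W" using assms by simp
  have "expr_cost (to_expr e) s + nbits (Suc x) + nbits (expr_val (to_expr e) s) \<le> com_coeff (Mov x e) * W"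
    unfolding ev com_coeff.simps distrib_right using b c x by linarith
  moreover have "bounded_state L Off (a\<lparr>vr := (vr a)(x := ?v)\<rparr>)" using Mov by (simp add: bounded_state_def)
  ultimately show ?case
    using exec_Assign[of "Suc x" "to_expr e" s] rel_vr[OF Mov(1), of x ?v] Mov(3) unfolding ev
    by (auto intro!: exI)
next
  case (Put j e1 e2)
  let ?i = "aval e1 a" and ?v = "aval e2 a"
  let ?ad = "Op PLUS (Reg 0) (Op PLUS (Op TIMES (Const 9) (to_expr e1)) (Const (aid j)))"
  have ev: "expr_val (to_expr e1) s = ?i" "expr_val (to_expr e2) s = ?v" using Put by (auto intro!: expr_val_to_expr)
  \<comment> \<open>Loading a cell already pays for forming its address and for the bits of that
    address, so the bound for \<open>Cell\<close> covers the address part of a store.\<close>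
  have "expr_cost (to_expr (Cell j e1)) s \<le> cost_coeff (Cell j e1) * W"
    using Put assms by (intro expr_cost_to_expr[of Off a]) auto
  then have c: "expr_cost ?ad s + nbits (expr_val ?ad s) \<le> (cost_coeff e1 + 10 * bits_coeff e1 + 60) * W"
    by simp
  have c2: "expr_cost (to_expr e2) s \<le> cost_coeff e2 * W" using Put assms by (intro expr_cost_to_expr[of Off a]) auto
  have b: "nbits ?v \<le> bits_coeff e2 * W"
    using nbits_aval_le[OF Put(2) assms(1), of e2] assms(2) by (meson le_trans mult_le_mono2)
  have "expr_cost ?ad s + expr_cost (to_expr e2) s + nbits (expr_val ?ad s) + nbits (expr_val (to_expr e2) s)
     \<le> (cost_coeff e1 + 10 * bits_coeff e1 + 60) * W + cost_coeff e2 * W + bits_coeff e2 * W"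
    using c c2 b unfolding ev by linarith
  also have "\<dots> = com_coeff (Put j e1 e2) * W" by (simp add: algebra_simps)
  finally have "expr_cost ?ad s + expr_cost (to_expr e2) s + nbits (expr_val ?ad s)
    + nbits (expr_val (to_expr e2) s) \<le> com_coeff (Put j e1 e2) * W" .
  moreover have "bounded_state L Off (a\<lparr>ar := (ar a)(j := (ar a j)(?i := ?v))\<rparr>)" using Put by (simp add: bounded_state_def)
  moreover have "expr_val ?ad s = Off + (9 * ?i + aid j)" using Put(1) ev by (simp add: rel_def)
  moreover have "exec (to_prog (Put j e1 e2)) s (expr_cost ?ad s + expr_cost (to_expr e2) s
     + nbits (expr_val ?ad s) + nbits (expr_val (to_expr e2) s))
     (s\<lparr>mem := (mem s)(expr_val ?ad s := expr_val (to_expr e2) s)\<rparr>)"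
    unfolding to_prog.simps by (rule exec_Store)
  moreover have "Q (a\<lparr>ar := (ar a)(j := (ar a j)(?i := ?v))\<rparr>)" using Put(3) by simp
  ultimately show ?case
    using rel_ar[OF Put(1), of j ?i ?v] unfolding ev(2) by metis
next
  case (Get x e)
  let ?i = "aval e a"
  have ev: "expr_val (to_expr e) s = ?i" using Get by (intro expr_val_to_expr)
  have m: "mem s ?i = lo a ?i" using Get by (simp add: rel_def)
  have c: "expr_cost (to_expr e) s \<le> cost_coeff e * W" using Get assms by (intro expr_cost_to_expr[of Off a]) auto
  have b: "nbits ?i \<le> bits_coeff e * W"
    using nbits_aval_le[OF Get(2) assms(1), of e] assms(2) by (meson le_trans mult_le_mono2)
  have l: "nbits (lo a ?i) \<le> W"
    using Get assms nbits_leI[of "lo a ?i" L] by (auto simp: bounded_state_def)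
  have x: "nbits (Suc x) \<le> nbits (Suc x) * W" using assms by simp
  have "expr_cost (Load (to_expr e)) s + nbits (Suc x) + nbits (expr_val (Load (to_expr e)) s)
     \<le> cost_coeff e * W + bits_coeff e * W + W + nbits (Suc x) * W + W"
    unfolding expr_cost.simps expr_val.simps ev m using b c l x by linarith
  also have "\<dots> = com_coeff (Get x e) * W" by (simp add: algebra_simps)
  finally have "expr_cost (Load (to_expr e)) s + nbits (Suc x) + nbits (expr_val (Load (to_expr e)) s)
     \<le> com_coeff (Get x e) * W" .
  moreover have "bounded_state L Off (a\<lparr>vr := (vr a)(x := lo a ?i)\<rparr>)" using Get by (simp add: bounded_state_def)
  moreover have "expr_val (Load (to_expr e)) s = lo a ?i" using ev m by simp
  moreover have "exec (to_prog (Get x e)) s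
     (expr_cost (Load (to_expr e)) s + nbits (Suc x) + nbits (expr_val (Load (to_expr e)) s))
     (s\<lparr>regs := (regs s)(Suc x := expr_val (Load (to_expr e)) s)\<rparr>)"
    unfolding to_prog.simps by (rule exec_Assign)
  moreover have "Q (a\<lparr>vr := (vr a)(x := lo a ?i)\<rparr>)" using Get(3) by simp
  ultimately show ?case
    using rel_vr[OF Get(1), of x "lo a ?i"] by metis
next
  case (Out e1 e2)
  let ?i = "aval e1 a" and ?v = "aval e2 a"
  have ev: "expr_val (to_expr e1) s = ?i" "expr_val (to_expr e2) s = ?v" using Out by (auto intro!: expr_val_to_expr)
  have c1: "expr_cost (to_expr e1) s \<le> cost_coeff e1 * W" using Out assms by (intro expr_cost_to_expr[of Off a]) auto
  have c2: "expr_cost (to_expr e2) s \<le> cost_coeff e2 * W" using Out assms by (intro expr_cost_to_expr[of Off a]) auto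
  have b: "nbits ?i \<le> bits_coeff e1 * W" "nbits ?v \<le> bits_coeff e2 * W"
    using nbits_aval_le[OF Out(2) assms(1)] assms(2) by (meson le_trans mult_le_mono2)+
  have "expr_cost (to_expr e1) s + expr_cost (to_expr e2) s + nbits ?i + nbits ?v \<le> com_coeff (Out e1 e2) * W"
    using c1 c2 b by (simp add: algebra_simps)
  moreover have "bounded_state L Off (a\<lparr>lo := (lo a)(?i := ?v)\<rparr>)" using Out by (simp add: bounded_state_def)
  moreover have "exec (to_prog (Out e1 e2)) s (expr_cost (to_expr e1) s + expr_cost (to_expr e2) s
     + nbits ?i + nbits ?v) (s\<lparr>mem := (mem s)(?i := ?v)\<rparr>)"
    using exec_Store[of "to_expr e1" "to_expr e2" s] unfolding ev by simp
  moreover have "Q (a\<lparr>lo := (lo a)(?i := ?v)\<rparr>)" "?i < Off" using Out(3) by simp_all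
  ultimately show ?case
    using rel_lo[OF Out(1), of ?i ?v] by metis
next
  case (Sq c1 c2)
  obtain T1 a1 s1 where 1: "exec (to_prog c1) s T1 s1" "T1 \<le> com_coeff c1 * W" "rel Off a1 s1" "bounded_state L Off a1"
    "wp L Off c2 Q a1" using Sq.IH(1)[of a s "wp L Off c2 Q"] Sq.prems by auto
  obtain T2 a2 s2 where 2: "exec (to_prog c2) s1 T2 s2" "T2 \<le> com_coeff c2 * W" "rel Off a2 s2" "bounded_state L Off a2"
    "Q a2" using Sq.IH(2)[of a1 s1 Q] Sq.prems 1 by auto
  have "exec (to_prog (Sq c1 c2)) s (T1 + T2) s2" using 1 2 by (auto intro: exec_Seq)
  moreover have "T1 + T2 \<le> com_coeff (Sq c1 c2) * W" using 1 2 by (simp add: algebra_simps)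
  ultimately show ?case using 2 by blast
next
  case (Cnd e c1 c2)
  have ev: "expr_val (to_expr e) s = aval e a" using Cnd by (intro expr_val_to_expr)
  have c: "expr_cost (to_expr e) s \<le> cost_coeff e * W" using Cnd.prems assms by (intro expr_cost_to_expr[of Off a]) auto
  show ?case
  proof (cases "aval e a = 0")
    case True
    then obtain T1 a1 s1 where 1: "exec (to_prog c2) s T1 s1" "T1 \<le> com_coeff c2 * W" "rel Off a1 s1"
      "bounded_state L Off a1" "Q a1" using Cnd.IH(2)[of a s Q] Cnd.prems by auto
    have "exec (to_prog (Cnd e c1 c2)) s (expr_cost (to_expr e) s + T1) s1"
      using 1 True ev by (auto intro: exec_If_false)
    moreover have "expr_cost (to_expr e) s + T1 \<le> com_coeff (Cnd e c1 c2) * W"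
      using 1 c by (simp add: algebra_simps)
    ultimately show ?thesis using 1 by blast
  next
    case False
    then obtain T1 a1 s1 where 1: "exec (to_prog c1) s T1 s1" "T1 \<le> com_coeff c1 * W" "rel Off a1 s1"
      "bounded_state L Off a1" "Q a1" using Cnd.IH(1)[of a s Q] Cnd.prems by auto
    have "exec (to_prog (Cnd e c1 c2)) s (expr_cost (to_expr e) s + T1) s1"
      using 1 False ev by (auto intro: exec_If_true)
    moreover have "expr_cost (to_expr e) s + T1 \<le> com_coeff (Cnd e c1 c2) * W"
      using 1 c by (simp add: algebra_simps)
    ultimately show ?thesis using 1 by blast
  qed
qed

lemma triple_com:
  assumes "\<And>a. P a \<Longrightarrow> bounded_state L Off a \<Longrightarrow> wp L Off c Q a"
    and "1 \<le> L" "L \<le> W" "L * L \<le> W \<or> linear_com c"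
  shows "triple Off L P (to_prog c) Q (com_coeff c * W)"
  unfolding triple_def using triple_com_aux[OF assms(2,3) _ _ assms(1) assms(4)] by blast

lemma triple_Seq:
  assumes "triple Off L P c1 R T1" "triple Off L R c2 Q T2"
  shows "triple Off L P (Seq c1 c2) Q (T1 + T2)"
  unfolding triple_def
proof (intro allI impI, elim conjE)
  fix a s assume "rel Off a s" "bounded_state L Off a" "P a"
  then obtain T1' a1 s1 where 1: "exec c1 s T1' s1" "T1' \<le> T1" "rel Off a1 s1" "bounded_state L Off a1" "R a1"
    using assms(1) unfolding triple_def by blast
  then obtain T2' a2 s2 where "exec c2 s1 T2' s2" "T2' \<le> T2" "rel Off a2 s2" "bounded_state L Off a2" "Q a2"
    using assms(2) unfolding triple_def by blast
  then show "\<exists>T' a' s'. exec (Seq c1 c2) s T' s' \<and> T' \<le> T1 + T2 \<and> rel Off a' s' \<and> bounded_state L Off a' \<and> Q a'"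
    using 1 exec_Seq add_mono by meson
qed

lemma triple_conseq:
  assumes "triple Off L P c Q T" "\<And>a. P' a \<Longrightarrow> P a" "\<And>a. Q a \<Longrightarrow> Q' a" "T \<le> T'"
  shows "triple Off L P' c Q' T'"
  unfolding triple_def using assms unfolding triple_def by (meson le_trans)

text \<open>Lets assertions refer to values that are fixed only at run time, such as start positions
  and parameters.\<close>

lemma triple_ex:
  assumes "\<And>x. triple Off L (P x) c Q T"
  shows "triple Off L (\<lambda>a. \<exists>x. P x a) c Q T"
  using assms unfolding triple_def by blast

definition For :: "nat \<Rightarrow> nat \<Rightarrow> ram_program \<Rightarrow> ram_program" where
  "For x y c = Seq (to_prog (Mov x (Lit 0)))
     (While (to_expr (Bin LESS (Var x) (Var y))) (Seq c (to_prog (Mov x (Bin PLUS (Var x) (Lit 1))))))"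

definition kfor :: "nat \<Rightarrow> nat \<Rightarrow> nat" where
  "kfor x y = com_coeff (Mov x (Lit 0)) + cost_coeff (Bin LESS (Var x) (Var y)) + com_coeff (Mov x (Bin PLUS (Var x) (Lit 1)))"

text \<open>The loop itself advances the counter, so the invariant must be insensitive to variable
  \<open>x\<close>; this is \<open>indep\<close>. There are \<open>m + 1\<close> tests for
  \<open>m\<close> runs of the body.\<close>

lemma triple_For:
  assumes body: "\<And>i. i < m \<Longrightarrow> triple Off L (\<lambda>a. I i a \<and> vr a x = i \<and> vr a y = m) c
                   (\<lambda>a. I (Suc i) a \<and> vr a x = i \<and> vr a y = m) (C i)"
    and indep: "\<And>i a v. I i a \<Longrightarrow> I i (a\<lparr>vr := (vr a)(x := v)\<rparr>)"
    and pre: "\<And>a. P a \<Longrightarrow> I 0 a \<and> vr a y = m"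
    and post: "\<And>a. I m a \<Longrightarrow> vr a y = m \<Longrightarrow> Q a"
    and xy: "x \<noteq> y" and L: "1 \<le> L"
  shows "triple Off L P (For x y c) Q ((m + 1) * (kfor x y * L) + (\<Sum>i<m. C i))"
proof -
  let ?b = "to_expr (Bin LESS (Var x) (Var y))" and ?inc = "Mov x (Bin PLUS (Var x) (Lit 1))"
  let ?K = "cost_coeff (Bin LESS (Var x) (Var y)) + com_coeff ?inc"
  have loop: "\<exists>T' a' s'. exec (While ?b (Seq c (to_prog ?inc))) s T' s' \<and>
      T' \<le> (m - i + 1) * (?K * L) + (\<Sum>j=i..<m. C j) \<and> rel Off a' s' \<and> bounded_state L Off a' \<and> Q a'"
    if "rel Off a s" "bounded_state L Off a" "I i a" "vr a x = i" "vr a y = m" "i \<le> m" for a s i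
    using that
  proof (induction "m - i" arbitrary: i a s)
    case 0
    then have "i = m" by simp
    have c: "expr_cost ?b s \<le> cost_coeff (Bin LESS (Var x) (Var y)) * L"
      by (rule expr_cost_to_expr[OF 0(2,3) L order_refl]) simp
    have "expr_val ?b s = 0" using expr_val_to_expr[OF 0(2), of "Bin LESS (Var x) (Var y)"] 0 by simp
    then have "exec (While ?b (Seq c (to_prog ?inc))) s (expr_cost ?b s) s"
      by (rule exec_While_false)
    moreover have "expr_cost ?b s \<le> (m - i + 1) * (?K * L) + (\<Sum>j=i..<m. C j)"
      using c \<open>i = m\<close> by (simp add: algebra_simps)
    ultimately show ?case using 0 post \<open>i = m\<close> by blast
  next
    case (Suc d)
    then have im: "i < m" by simp
    have c: "expr_cost ?b s \<le> cost_coeff (Bin LESS (Var x) (Var y)) * L"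
      by (rule expr_cost_to_expr[OF Suc.prems(1,2) L order_refl]) simp
    have b: "expr_val ?b s \<noteq> 0" using expr_val_to_expr[OF Suc.prems(1), of "Bin LESS (Var x) (Var y)"] Suc.prems im by simp
    obtain T1 a1 s1 where 1: "exec c s T1 s1" "T1 \<le> C i" "rel Off a1 s1" "bounded_state L Off a1"
      "I (Suc i) a1" "vr a1 x = i" "vr a1 y = m"
      using body[OF im] Suc.prems unfolding triple_def by blast
    \<comment> \<open>\<open>m\<close> is the value of a variable in a bounded state, so the
      incremented counter, at most \<open>m\<close>, fits as well.\<close>
    have mL: "m < 2 ^ L" using 1(4,7) unfolding bounded_state_def by metis
    have "wp L Off ?inc (\<lambda>a. I (Suc i) a \<and> vr a x = Suc i \<and> vr a y = m) a1"
      using 1 indep im xy mL by simp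
    then obtain T2 a2 s2 where 2: "exec (to_prog ?inc) s1 T2 s2" "T2 \<le> com_coeff ?inc * L" "rel Off a2 s2"
      "bounded_state L Off a2" "I (Suc i) a2" "vr a2 x = Suc i" "vr a2 y = m"
      using triple_com_aux[OF L order_refl 1(3,4), of ?inc "\<lambda>a. I (Suc i) a \<and> vr a x = Suc i \<and> vr a y = m"]
      by auto
    obtain T3 a3 s3 where 3: "exec (While ?b (Seq c (to_prog ?inc))) s2 T3 s3"
      "T3 \<le> (m - Suc i + 1) * (?K * L) + (\<Sum>j=Suc i..<m. C j)"
      "rel Off a3 s3" "bounded_state L Off a3" "Q a3"
      using Suc.hyps(1)[OF _ 2(3,4,5,6,7)] Suc.hyps(2) im by (metis Suc_leI diff_Suc_1' Suc_diff_Suc)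
    have "exec (While ?b (Seq c (to_prog ?inc))) s (expr_cost ?b s + (T1 + T2) + T3) s3"
      by (rule exec_While_true[OF b exec_Seq[OF 1(1) 2(1)] 3(1)])
    moreover have "expr_cost ?b s + (T1 + T2) + T3 \<le> (m - i + 1) * (?K * L) + (\<Sum>j=i..<m. C j)"
    proof -
      have "(\<Sum>j=i..<m. C j) = C i + (\<Sum>j=Suc i..<m. C j)"
        using im by (simp add: sum.atLeast_Suc_lessThan)
      moreover have "m - i + 1 = Suc (m - Suc i + 1)" using im by simp
      ultimately show ?thesis using c 1(2) 2(2) 3(2) by (simp add: algebra_simps)
    qed
    ultimately show ?case using 3 by blast
  qed
  show ?thesis
    unfolding triple_def
  proof (intro allI impI, elim conjE)
    fix a s assume as: "rel Off a s" "bounded_state L Off a" "P a"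
    have "wp L Off (Mov x (Lit 0)) (\<lambda>a. I 0 a \<and> vr a x = 0 \<and> vr a y = m) a"
      using pre[OF as(3)] indep xy by simp
    then obtain T1 a1 s1 where 1: "exec (to_prog (Mov x (Lit 0))) s T1 s1" "T1 \<le> com_coeff (Mov x (Lit 0)) * L"
      "rel Off a1 s1" "bounded_state L Off a1" "I 0 a1" "vr a1 x = 0" "vr a1 y = m"
      using triple_com_aux[OF L order_refl as(1,2), of "Mov x (Lit 0)" "\<lambda>a. I 0 a \<and> vr a x = 0 \<and> vr a y = m"]
      by auto
    obtain T2 a2 s2 where 2: "exec (While ?b (Seq c (to_prog ?inc))) s1 T2 s2"
      "T2 \<le> (m - 0 + 1) * (?K * L) + (\<Sum>j=0..<m. C j)" "rel Off a2 s2" "bounded_state L Off a2" "Q a2"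
      using loop[of a1 s1 0] 1 by blast
    have "T1 + T2 \<le> (m + 1) * (kfor x y * L) + (\<Sum>i<m. C i)"
    proof -
      have "T1 + T2 \<le> com_coeff (Mov x (Lit 0)) * L + ((m + 1) * (?K * L) + (\<Sum>i<m. C i))"
        using 1(2) 2(2) unfolding atLeast0LessThan minus_nat.diff_0 by (rule add_mono)
      also have "\<dots> \<le> (m + 1) * (com_coeff (Mov x (Lit 0)) * L) + (m + 1) * (?K * L) + (\<Sum>i<m. C i)"
        by simp
      also have "\<dots> = (m + 1) * (kfor x y * L) + (\<Sum>i<m. C i)"
        unfolding kfor_def by (simp only: algebra_simps)
      finally show ?thesis .
    qed
    moreover have "exec (For x y c) s (T1 + T2) s2"
      unfolding For_def by (rule exec_Seq[OF 1(1) 2(1)])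
    ultimately show "\<exists>T' a' s'. exec (For x y c) s T' s' \<and>
        T' \<le> (m + 1) * (kfor x y * L) + (\<Sum>i<m. C i) \<and> rel Off a' s' \<and> bounded_state L Off a' \<and> Q a'"
      using 2 by blast
  qed
qed

lemma triple_For_com:
  assumes body: "\<And>i a. i < m \<Longrightarrow> I i a \<Longrightarrow> vr a x = i \<Longrightarrow> vr a y = m \<Longrightarrow> bounded_state L Off a \<Longrightarrow>
       wp L Off c (\<lambda>a. I (Suc i) a \<and> vr a x = i \<and> vr a y = m) a"
    and indep: "\<And>i a v. I i a \<Longrightarrow> I i (a\<lparr>vr := (vr a)(x := v)\<rparr>)"
    and pre: "\<And>a. P a \<Longrightarrow> I 0 a \<and> vr a y = m"
    and post: "\<And>a. I m a \<Longrightarrow> vr a y = m \<Longrightarrow> Q a"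
    and xy: "x \<noteq> y" and W: "1 \<le> L" "L \<le> W" "L * L \<le> W \<or> linear_com c"
  shows "triple Off L P (For x y (to_prog c)) Q ((m + 1) * ((kfor x y + com_coeff c) * W))"
proof -
  have "triple Off L P (For x y (to_prog c)) Q ((m + 1) * (kfor x y * L) + (\<Sum>i<m. com_coeff c * W))"
  proof (rule triple_For)
    show "triple Off L (\<lambda>a. I i a \<and> vr a x = i \<and> vr a y = m) (to_prog c)
            (\<lambda>a. I (Suc i) a \<and> vr a x = i \<and> vr a y = m) (com_coeff c * W)" if "i < m" for i
      using that W body by (intro triple_com) auto
  qed (use assms in auto)
  moreover have "(m + 1) * (kfor x y * L) + (\<Sum>i<m. com_coeff c * W) \<le> (m + 1) * ((kfor x y + com_coeff c) * W)"
  proof -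
    have "(m + 1) * (kfor x y * L) \<le> (m + 1) * (kfor x y * W)" using W by (intro mult_le_mono) auto
    then show ?thesis by (simp add: algebra_simps)
  qed
  ultimately show ?thesis using triple_conseq by blast
qed

section \<open>Coefficients of the identity and Z-order\<close>

lemma mp_const_mult_var: "mp_const c * mp_var v = Poly_Mapping.single (Poly_Mapping.single v 1) c"
  by (simp add: mp_const_def mp_var_def mult_single)

text \<open>A monomial with one variable of each kind determines its three factors, since the
  constructors differ.\<close>

lemma single_var_eq_iff:
  "Poly_Mapping.single (VarX i j) (1::nat) + Poly_Mapping.single (VarY k l) 1 + Poly_Mapping.single (VarZ m n) 1
   = Poly_Mapping.single (VarX i' j') 1 + Poly_Mapping.single (VarY k' l') 1 + Poly_Mapping.single (VarZ m' n') 1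
   \<longleftrightarrow> i = i' \<and> j = j' \<and> k = k' \<and> l = l' \<and> m = m' \<and> n = n'" (is "?L = ?R \<longleftrightarrow> _")
proof
  assume eq: "?L = ?R"
  have "Poly_Mapping.lookup ?L (VarX i j) = Poly_Mapping.lookup ?R (VarX i j)"
    "Poly_Mapping.lookup ?L (VarY k l) = Poly_Mapping.lookup ?R (VarY k l)"
    "Poly_Mapping.lookup ?L (VarZ m n) = Poly_Mapping.lookup ?R (VarZ m n)" by (simp_all only: eq)
  then show "i = i' \<and> j = j' \<and> k = k' \<and> l = l' \<and> m = m' \<and> n = n'"
    by (simp add: Poly_Mapping.lookup_add Poly_Mapping.lookup_single when_def split: if_splits)
qed simp

lemma triple_sum:
  fixes f g h :: "'i \<Rightarrow> 'a::comm_semiring_0"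
  shows "sum f P * sum g P * sum h P = (\<Sum>x\<in>P. \<Sum>y\<in>P. \<Sum>z\<in>P. f x * g y * h z)"
proof -
  have "sum f P * sum g P * sum h P = (\<Sum>x\<in>P. \<Sum>y\<in>P. f x * g y) * sum h P"
    by (simp add: sum_product)
  also have "\<dots> = (\<Sum>x\<in>P. \<Sum>y\<in>P. f x * g y * sum h P)"
    by (simp only: sum_distrib_right)
  finally show ?thesis by (simp only: sum_distrib_left)
qed

lemma sum_triple_delta:
  fixes f :: "'i \<Rightarrow> 'j \<Rightarrow> 'k \<Rightarrow> 'a::comm_monoid_add"
  assumes "finite P" "finite Q" "finite R" "p \<in> P" "q \<in> Q" "r \<in> R"
  shows "(\<Sum>x\<in>P. \<Sum>y\<in>Q. \<Sum>z\<in>R. if x = p \<and> y = q \<and> z = r then f x y z else 0) = f p q r"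
proof -
  have "(\<Sum>x\<in>P. \<Sum>y\<in>Q. \<Sum>z\<in>R. if x = p \<and> y = q \<and> z = r then f x y z else 0)
    = (\<Sum>x\<in>P. if x = p then (\<Sum>y\<in>Q. if y = q then (\<Sum>z\<in>R. if z = r then f x y z else 0) else 0) else 0)"
    by (intro sum.cong refl) (auto intro!: sum.cong)
  then show ?thesis using assms by simp
qed

lemma lookup_triple_product:
  fixes f g h :: "'i \<Rightarrow> ('v \<Rightarrow>\<^sub>0 nat)" and a b c :: "'i \<Rightarrow> 'a::comm_ring_1"
  assumes "finite P" "p1 \<in> P" "p2 \<in> P" "p3 \<in> P"
    and inj: "\<And>x y z. f x + g y + h z = f p1 + g p2 + h p3 \<longleftrightarrow> x = p1 \<and> y = p2 \<and> z = p3"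
  shows "Poly_Mapping.lookup ((\<Sum>p\<in>P. Poly_Mapping.single (f p) (a p)) * (\<Sum>p\<in>P. Poly_Mapping.single (g p) (b p)) *
       (\<Sum>p\<in>P. Poly_Mapping.single (h p) (c p))) (f p1 + g p2 + h p3) = a p1 * b p2 * c p3"
proof -
  have "Poly_Mapping.lookup ((\<Sum>p\<in>P. Poly_Mapping.single (f p) (a p)) * (\<Sum>p\<in>P. Poly_Mapping.single (g p) (b p)) *
       (\<Sum>p\<in>P. Poly_Mapping.single (h p) (c p))) (f p1 + g p2 + h p3)
     = (\<Sum>x\<in>P. \<Sum>y\<in>P. \<Sum>z\<in>P. if x = p1 \<and> y = p2 \<and> z = p3 then a x * b y * c z else 0)"
    unfolding triple_sum by (simp add: mult_single Poly_Mapping.lookup_sum Poly_Mapping.lookup_single inj when_def)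
  also have "\<dots> = a p1 * b p2 * c p3" using assms by (intro sum_triple_delta)
  finally show ?thesis .
qed

text \<open>Comparison of the coefficients at the product of \<open>VarX i j\<close>,
  \<open>VarY j' k\<close> and \<open>VarZ i' k'\<close>. On the left this monomial occurs only if
  the index pairs fit together; on the right each product of three linear forms contributes one
  term.\<close>

lemma coeff_identity:
  fixes \<alpha> \<beta> \<gamma> :: "nat \<Rightarrow> nat \<Rightarrow> nat \<Rightarrow> 'a::comm_ring_1"
  assumes identity:
      "(\<Sum>i=1..t. \<Sum>j=1..t. \<Sum>k=1..t.
          mp_var (VarX i j) * mp_var (VarY j k) * mp_var (VarZ i k))
       = (\<Sum>l=1..r.
           (\<Sum>i=1..t. \<Sum>j=1..t. mp_const (\<alpha> i j l) * mp_var (VarX i j)) *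
           (\<Sum>j=1..t. \<Sum>k=1..t. mp_const (\<beta> j k l) * mp_var (VarY j k)) *
           (\<Sum>i=1..t. \<Sum>k=1..t. mp_const (\<gamma> i k l) * mp_var (VarZ i k)))"
    and ran: "i \<in> {1..t}" "j \<in> {1..t}" "j' \<in> {1..t}" "k \<in> {1..t}" "i' \<in> {1..t}" "k' \<in> {1..t}"
  shows "(\<Sum>l=1..r. \<alpha> i j l * \<beta> j' k l * \<gamma> i' k' l) = (if i = i' \<and> j = j' \<and> k = k' then 1 else 0)"
proof -
  let ?m = "Poly_Mapping.single (VarX i j) (1::nat) + Poly_Mapping.single (VarY j' k) 1
     + Poly_Mapping.single (VarZ i' k') 1"
  let ?P = "{1..t} \<times> {1..t}"
  have lhs: "Poly_Mapping.lookup (\<Sum>i=1..t. \<Sum>j=1..t. \<Sum>k=1..t.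
          mp_var (VarX i j) * mp_var (VarY j k) * mp_var (VarZ i k) :: (mm_var, 'a) mpoly) ?m
      = (\<Sum>x=1..t. \<Sum>y=1..t. \<Sum>z=1..t. if x = i \<and> y = j \<and> y = j' \<and> z = k \<and> x = i' \<and> z = k' then 1 else 0)"
    by (simp add: mp_var_def mult_single Poly_Mapping.lookup_sum Poly_Mapping.lookup_single single_var_eq_iff[unfolded One_nat_def] when_def)
  also have "\<dots> = (\<Sum>x=1..t. \<Sum>y=1..t. \<Sum>z=1..t. if x = i \<and> y = j \<and> z = k then
      (if i = i' \<and> j = j' \<and> k = k' then 1 else 0) else 0)"
    by (intro sum.cong refl) auto
  also have "\<dots> = (if i = i' \<and> j = j' \<and> k = k' then 1 else 0)"
    using ran by (intro sum_triple_delta) auto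
  finally have lhs': "Poly_Mapping.lookup (\<Sum>i=1..t. \<Sum>j=1..t. \<Sum>k=1..t.
          mp_var (VarX i j) * mp_var (VarY j k) * mp_var (VarZ i k) :: (mm_var, 'a) mpoly) ?m
      = (if i = i' \<and> j = j' \<and> k = k' then 1 else 0)" .
  have "Poly_Mapping.lookup ((\<Sum>i=1..t. \<Sum>j=1..t. mp_const (\<alpha> i j l) * mp_var (VarX i j)) *
           (\<Sum>j=1..t. \<Sum>k=1..t. mp_const (\<beta> j k l) * mp_var (VarY j k)) *
           (\<Sum>i=1..t. \<Sum>k=1..t. mp_const (\<gamma> i k l) * mp_var (VarZ i k))) ?m
     = \<alpha> i j l * \<beta> j' k l * \<gamma> i' k' l" for l
  proof -
    have "Poly_Mapping.lookup ((\<Sum>p\<in>?P. Poly_Mapping.single (Poly_Mapping.single (VarX (fst p) (snd p)) (1::nat)) (\<alpha> (fst p) (snd p) l)) *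
        (\<Sum>p\<in>?P. Poly_Mapping.single (Poly_Mapping.single (VarY (fst p) (snd p)) (1::nat)) (\<beta> (fst p) (snd p) l)) *
        (\<Sum>p\<in>?P. Poly_Mapping.single (Poly_Mapping.single (VarZ (fst p) (snd p)) (1::nat)) (\<gamma> (fst p) (snd p) l)))
       (Poly_Mapping.single (VarX (fst (i, j)) (snd (i, j))) 1
        + Poly_Mapping.single (VarY (fst (j', k)) (snd (j', k))) 1
        + Poly_Mapping.single (VarZ (fst (i', k')) (snd (i', k'))) 1)
      = \<alpha> (fst (i, j)) (snd (i, j)) l * \<beta> (fst (j', k)) (snd (j', k)) l * \<gamma> (fst (i', k')) (snd (i', k')) l"
      by (rule lookup_triple_product[where f = "\<lambda>p. Poly_Mapping.single (VarX (fst p) (snd p)) (1::nat)"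
            and g = "\<lambda>p. Poly_Mapping.single (VarY (fst p) (snd p)) (1::nat)"
            and h = "\<lambda>p. Poly_Mapping.single (VarZ (fst p) (snd p)) (1::nat)"
            and a = "\<lambda>p. \<alpha> (fst p) (snd p) l" and b = "\<lambda>p. \<beta> (fst p) (snd p) l"
            and c = "\<lambda>p. \<gamma> (fst p) (snd p) l"])
         (use ran in \<open>auto simp: single_var_eq_iff[unfolded One_nat_def] prod_eq_iff\<close>)
    then show ?thesis
      by (simp add: mp_const_mult_var sum.cartesian_product split_def)
  qed
  then have "Poly_Mapping.lookup (\<Sum>l=1..r.
           (\<Sum>i=1..t. \<Sum>j=1..t. mp_const (\<alpha> i j l) * mp_var (VarX i j)) *
           (\<Sum>j=1..t. \<Sum>k=1..t. mp_const (\<beta> j k l) * mp_var (VarY j k)) *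
           (\<Sum>i=1..t. \<Sum>k=1..t. mp_const (\<gamma> i k l) * mp_var (VarZ i k))) ?m
     = (\<Sum>l=1..r. \<alpha> i j l * \<beta> j' k l * \<gamma> i' k' l)"
    by (simp only: Poly_Mapping.lookup_sum)
  then show ?thesis using lhs' unfolding identity by simp
qed

section \<open>Digits, Kronecker powers and Z-order\<close>

text \<open>\<open>u * b + v\<close> is read as \<open>u\<close> with the base-\<open>b\<close>
  digit \<open>v\<close> appended; composite indices are decoded this way throughout.\<close>

lemma div_append: "v < b \<Longrightarrow> (u * b + v) div b = u"
  and mod_append: "v < b \<Longrightarrow> (u * b + v) mod b = v" for u v b :: nat
  by simp_all

lemma append_eq_iff:
  fixes u v :: nat
  assumes "u < b" "v < b"
  shows "x * b + u = y * b + v \<longleftrightarrow> x = y \<and> u = v"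
  using div_append[of u b x] div_append[of v b y] mod_append[of u b x] mod_append[of v b y] assms
  by metis

lemma append_less:
  fixes u v a b :: nat
  assumes "u < a" "v < b"
  shows "u * b + v < a * b"
proof -
  have "u * b + v < (u + 1) * b" using assms by simp
  also have "\<dots> \<le> a * b" using assms by (intro mult_le_mono) auto
  finally show ?thesis .
qed

lemma sum_nested_digits:
  fixes F :: "nat \<Rightarrow> 'b::comm_monoid_add"
  shows "(\<Sum>x<a * b. F x) = (\<Sum>u<a. \<Sum>v<b. F (u * b + v))"
proof -
  have "(\<Sum>x<a * b. F x) = (\<Sum>u<a. sum F {u * b..<u * b + b})" by (simp add: sum.nat_group)
  also have "\<dots> = (\<Sum>u<a. \<Sum>v<b. F (u * b + v))"
  proof (rule sum.cong)
    fix u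
    show "sum F {u * b..<u * b + b} = (\<Sum>v<b. F (u * b + v))"
      by (intro sum.reindex_bij_witness[of _ "\<lambda>v. u * b + v" "\<lambda>x. x - u * b"]) auto
  qed simp
  finally show ?thesis .
qed

text \<open>Entries of the \<open>k\<close>-th Kronecker power of \<open>M\<close>.\<close>

fun tpow :: "(nat \<Rightarrow> nat \<Rightarrow> 'a::comm_ring_1) \<Rightarrow> nat \<Rightarrow> nat \<Rightarrow> nat \<Rightarrow> nat \<Rightarrow> nat \<Rightarrow> 'a" where
  "tpow M b c 0 x y = 1"
| "tpow M b c (Suc k) x y = M (x mod b) (y mod c) * tpow M b c k (x div b) (y div c)"

text \<open>The output transformation leads from length \<open>r^k\<close> to
  \<open>(t * t)^k\<close>, so it applies a power of the transpose of the matrix that occurs in the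
  identity.\<close>

lemma tpow_swap: "tpow (\<lambda>x y. M y x) c b k y x = tpow M b c k x y"
  by (induction k arbitrary: x y) simp_all

text \<open>A digit in base \<open>t^2\<close> is a row digit times \<open>t\<close> plus a column
  digit. Leading zeros contribute nothing, so no number of digits has to be supplied; the test
  \<open>t < 2\<close> secures termination.\<close>

function zrow :: "nat \<Rightarrow> nat \<Rightarrow> nat" where
  "zrow t x = (if x = 0 \<or> t < 2 then 0 else zrow t (x div (t * t)) * t + x mod (t * t) div t)"
  by auto
termination
proof (relation "measure snd")
  fix t x :: nat assume "\<not> (x = 0 \<or> t < 2)"
  then have "1 < t * t" "0 < x" by (auto intro: one_less_mult)
  then show "((t, x div (t * t)), (t, x)) \<in> measure snd" by simp
qed simp

function zcol :: "nat \<Rightarrow> nat \<Rightarrow> nat" where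
  "zcol t x = (if x = 0 \<or> t < 2 then 0 else zcol t (x div (t * t)) * t + x mod (t * t) mod t)"
  by auto
termination
proof (relation "measure snd")
  fix t x :: nat assume "\<not> (x = 0 \<or> t < 2)"
  then have "1 < t * t" "0 < x" by (auto intro: one_less_mult)
  then show "((t, x div (t * t)), (t, x)) \<in> measure snd" by simp
qed simp

declare zrow.simps [simp del] zcol.simps [simp del]

text \<open>\<open>x\<close>, \<open>y\<close> and \<open>z\<close> are positions in the left
  factor, the right factor and the product: the entries at \<open>x\<close> and \<open>y\<close> are
  multiplied for the entry at \<open>z\<close>.\<close>

definition zmul :: "nat \<Rightarrow> nat \<Rightarrow> nat \<Rightarrow> nat \<Rightarrow> bool" where
  "zmul t x y z \<longleftrightarrow> zrow t x = zrow t z \<and> zcol t x = zrow t y \<and> zcol t y = zcol t z"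

lemma zrow_0 [simp]: "zrow t 0 = 0" and zcol_0 [simp]: "zcol t 0 = 0"
  by (simp_all add: zrow.simps zcol.simps)

context
  fixes t :: nat
  assumes t: "t \<ge> 2"
begin

lemma zrow_step: "zrow t x = zrow t (x div (t * t)) * t + x mod (t * t) div t"
  using t by (subst zrow.simps) simp

lemma zcol_step: "zcol t x = zcol t (x div (t * t)) * t + x mod (t * t) mod t"
  using t by (subst zcol.simps) simp

lemma zrow_le: "zrow t x \<le> x" and zcol_le: "zcol t x \<le> x"
proof (induction x rule: less_induct)
  case (less x)
  have "zrow t x \<le> x \<and> zcol t x \<le> x"
  proof (cases "x = 0")
    case False
    have "1 < t * t" using t by (auto intro: one_less_mult)
    then have "x div (t * t) < x" using False by simp
    then have IH: "zrow t (x div (t * t)) \<le> x div (t * t)" "zcol t (x div (t * t)) \<le> x div (t * t)"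
      using less by auto
    have *: "x div (t * t) * t + x mod (t * t) \<le> x"
    proof -
      have "x div (t * t) * t \<le> x div (t * t) * (t * t)" using t by simp
      then show ?thesis using div_mult_mod_eq[of x "t * t"] by linarith
    qed
    have "zrow t (x div (t * t)) * t \<le> x div (t * t) * t" "zcol t (x div (t * t)) * t \<le> x div (t * t) * t"
      using IH by simp_all
    moreover have "x mod (t * t) div t \<le> x mod (t * t)" "x mod (t * t) mod t \<le> x mod (t * t)" by simp_all
    ultimately show ?thesis
      unfolding zrow_step[of x] zcol_step[of x] using * by linarith
  qed simp
  then show "zrow t x \<le> x" "zcol t x \<le> x" by auto
qed

text \<open>The leading digits address a block and the last \<open>h\<close> digits an entry inside
  it, so a block is a contiguous segment in Z-order.\<close>

lemma zrow_append:
  assumes "e < (t * t) ^ h"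
  shows "zrow t (x * (t * t) ^ h + e) = zrow t x * t ^ h + zrow t e
       \<and> zcol t (x * (t * t) ^ h + e) = zcol t x * t ^ h + zcol t e"
  using assms
proof (induction h arbitrary: e)
  case (Suc h)
  let ?d = "t * t"
  have d: "0 < ?d" using t by simp
  have e: "e div ?d < ?d ^ h"
    using Suc.prems by (simp add: less_mult_imp_div_less mult.commute)
  have 1: "(x * ?d ^ Suc h + e) div ?d = x * ?d ^ h + e div ?d"
  proof -
    have "x * ?d ^ Suc h + e = e + (x * ?d ^ h) * ?d" by simp
    then show ?thesis using d by (metis add.commute div_mult_self1 less_not_refl2)
  qed
  have 2: "(x * ?d ^ Suc h + e) mod ?d = e mod ?d"
  proof -
    have "x * ?d ^ Suc h + e = e + (x * ?d ^ h) * ?d" by simp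
    then show ?thesis by (metis mod_mult_self1)
  qed
  show ?case
    unfolding zrow_step[of "x * ?d ^ Suc h + e"] zcol_step[of "x * ?d ^ Suc h + e"] 1 2
    using Suc.IH[OF e] by (simp add: zrow_step[of e] zcol_step[of e] algebra_simps)
qed simp

lemma zrow_less: "x < (t * t) ^ k \<Longrightarrow> zrow t x < t ^ k"
  and zcol_less: "x < (t * t) ^ k \<Longrightarrow> zcol t x < t ^ k"
proof (induction k arbitrary: x)
  case (Suc k)
  have d: "0 < t * t" using t by simp
  have e: "x div (t * t) < (t * t) ^ k" if "x < (t * t) ^ Suc k" for x
    using that by (simp add: less_mult_imp_div_less mult.commute)
  have *: "u * t + v < t ^ Suc k" if "u < t ^ k" "v < t" for u v
    using append_less[OF that] by (simp add: mult.commute)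
  have dd: "x mod (t * t) div t < t" "x mod (t * t) mod t < t" for x
    using t d by (auto intro!: less_mult_imp_div_less)
  { case 1 then show ?case unfolding zrow_step[of x] by (intro * Suc.IH(1) e dd) }
  { case 2 then show ?case unfolding zcol_step[of x] by (intro * Suc.IH(2) e dd) }
qed simp_all

lemma zrow_zcol_surj: "i < t ^ k \<Longrightarrow> j < t ^ k \<Longrightarrow> \<exists>x<(t * t) ^ k. zrow t x = i \<and> zcol t x = j"
proof (induction k arbitrary: i j)
  case (Suc k)
  have "i div t < t ^ k" "j div t < t ^ k"
    using Suc.prems by (simp_all add: less_mult_imp_div_less mult.commute)
  then obtain x where x: "x < (t * t) ^ k" "zrow t x = i div t" "zcol t x = j div t"
    using Suc.IH by blast
  let ?v = "(i mod t) * t + j mod t"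
  have v: "?v < t * t" using t by (intro append_less) auto
  have vd: "?v div t = i mod t" "?v mod t = j mod t" using t by simp_all
  let ?x = "x * (t * t) + ?v"
  have xd: "?x div (t * t) = x" "?x mod (t * t) = ?v"
    using div_append[OF v] mod_append[OF v] by blast+
  have "zrow t ?x = i" "zcol t ?x = j"
    unfolding zrow_step[of ?x] zcol_step[of ?x] xd vd x by simp_all
  moreover have "?x < (t * t) ^ Suc k" using append_less[OF x(1) v] by (simp only: power_Suc2)
  ultimately show ?case by blast
qed simp

text \<open>Bijectivity of Z-order, in the form in which it is used: as a change of summation
  indices.\<close>

lemma sum_zorder:
  fixes F :: "nat \<Rightarrow> nat \<Rightarrow> 'b::comm_monoid_add"
  shows "(\<Sum>x<(t * t) ^ k. F (zrow t x) (zcol t x)) = (\<Sum>i<t ^ k. \<Sum>j<t ^ k. F i j)"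
proof (induction k arbitrary: F)
  case (Suc k)
  have c: "zrow t (x * (t * t) + v) = zrow t x * t + v div t"
    "zcol t (x * (t * t) + v) = zcol t x * t + v mod t" if "v < t * t" for x v
    unfolding zrow_step[of "x * (t * t) + v"] zcol_step[of "x * (t * t) + v"]
      div_append[OF that] mod_append[OF that] by simp_all
  have "(\<Sum>x<(t * t) ^ Suc k. F (zrow t x) (zcol t x))
     = (\<Sum>x<(t * t) ^ k * (t * t). F (zrow t x) (zcol t x))" by (simp add: mult.commute)
  also have "\<dots> = (\<Sum>x<(t * t) ^ k. \<Sum>v<t * t. F (zrow t x * t + v div t) (zcol t x * t + v mod t))"
    by (subst sum_nested_digits) (simp add: c)
  also have "\<dots> = (\<Sum>i<t ^ k. \<Sum>j<t ^ k. \<Sum>v<t * t. F (i * t + v div t) (j * t + v mod t))"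
    by (rule Suc.IH)
  also have "\<dots> = (\<Sum>i<t ^ k. \<Sum>j<t ^ k. \<Sum>u<t. \<Sum>v<t. F (i * t + u) (j * t + v))"
    by (subst sum_nested_digits) simp
  also have "\<dots> = (\<Sum>i<t ^ k. \<Sum>u<t. \<Sum>j<t ^ k. \<Sum>v<t. F (i * t + u) (j * t + v))"
    by (intro sum.cong refl sum.swap)
  also have "\<dots> = (\<Sum>i<t ^ k * t. \<Sum>j<t ^ k * t. F i j)"
    unfolding sum_nested_digits ..
  finally show ?case by (simp add: mult.commute)
qed simp

lemma zmul_step:
  "zmul t x y z \<longleftrightarrow> zmul t (x div (t * t)) (y div (t * t)) (z div (t * t)) \<and>
     x mod (t * t) div t = z mod (t * t) div t \<and> x mod (t * t) mod t = y mod (t * t) div t \<and>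
     y mod (t * t) mod t = z mod (t * t) mod t"
proof -
  note eq = append_eq_iff[of _ t]
  have dd: "x mod (t * t) div t < t" "x mod (t * t) mod t < t" for x
    using t by (auto simp: less_mult_imp_div_less)
  show ?thesis
    unfolding zmul_def zrow_step[of x] zrow_step[of y] zrow_step[of z]
      zcol_step[of x] zcol_step[of y] zcol_step[of z]
    using eq dd by auto
qed

lemma zmul_append:
  assumes "a < (t * t) ^ h" "b < (t * t) ^ h" "c < (t * t) ^ h"
  shows "zmul t (x * (t * t) ^ h + a) (y * (t * t) ^ h + b) (z * (t * t) ^ h + c)
      \<longleftrightarrow> zmul t x y z \<and> zmul t a b c"
proof -
  note eq = append_eq_iff[of _ "t ^ h"]
  show ?thesis
    unfolding zmul_def using assms by (auto simp: zrow_append eq zrow_less zcol_less)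
qed

text \<open>The matrix multiplication tensor of side \<open>t^k\<close> is the \<open>k\<close>-th
  tensor power of the one of side \<open>t\<close>: the sum factors along the base-\<open>r\<close>
  digits of \<open>l\<close>, and each factor is the base identity for one digit of
  \<open>x\<close>, \<open>y\<close> and \<open>z\<close>.\<close>

lemma tpow_identity:
  fixes a b c :: "nat \<Rightarrow> nat \<Rightarrow> 'a::comm_ring_1"
  assumes base: "\<And>p1 p2 p3. p1 < t * t \<Longrightarrow> p2 < t * t \<Longrightarrow> p3 < t * t \<Longrightarrow>
      (\<Sum>l<r. a p1 l * b p2 l * c p3 l) =
        (if p1 div t = p3 div t \<and> p1 mod t = p2 div t \<and> p2 mod t = p3 mod t then 1 else 0)"
    and "x < (t * t) ^ k" "y < (t * t) ^ k" "z < (t * t) ^ k"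
  shows "(\<Sum>l<r ^ k. tpow a (t * t) r k x l * tpow b (t * t) r k y l * tpow c (t * t) r k z l)
     = (if zmul t x y z then 1 else 0)"
  using assms(2-)
proof (induction k arbitrary: x y z)
  case 0
  then show ?case by (simp add: zmul_def)
next
  case (Suc k)
  let ?d = "t * t"
  have d: "0 < ?d" using t by simp
  have e: "x div ?d < ?d ^ k" "y div ?d < ?d ^ k" "z div ?d < ?d ^ k"
    using Suc.prems by (simp_all add: less_mult_imp_div_less mult.commute)
  have "(\<Sum>l<r ^ Suc k. tpow a ?d r (Suc k) x l * tpow b ?d r (Suc k) y l * tpow c ?d r (Suc k) z l)
     = (\<Sum>l<r ^ k * r. tpow a ?d r (Suc k) x l * tpow b ?d r (Suc k) y l * tpow c ?d r (Suc k) z l)"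
    by (simp add: mult.commute)
  also have "\<dots> = (\<Sum>u<r ^ k. \<Sum>v<r. 
       (tpow a ?d r k (x div ?d) u * tpow b ?d r k (y div ?d) u * tpow c ?d r k (z div ?d) u) *
       (a (x mod ?d) v * b (y mod ?d) v * c (z mod ?d) v))"
    unfolding sum_nested_digits by (intro sum.cong refl) (simp add: algebra_simps)
  also have "\<dots> = (\<Sum>u<r ^ k. tpow a ?d r k (x div ?d) u * tpow b ?d r k (y div ?d) u * tpow c ?d r k (z div ?d) u) *
      (\<Sum>v<r. a (x mod ?d) v * b (y mod ?d) v * c (z mod ?d) v)"
    by (simp add: sum_product)
  also have "\<dots> = (if zmul t x y z then 1 else 0)"
    unfolding Suc.IH[OF e] zmul_step[of x y z] using d by (subst base) auto
  finally show ?case .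
qed

text \<open>The left side is what the program computes: transformed blocks of \<open>P\<close> and
  \<open>Q\<close> are multiplied and the products transformed back. Expansion leaves a sum over
  \<open>l\<close> of three tensor powers, which \<open>tpow_identity\<close> evaluates; the
  condition on blocks and the condition inside blocks then merge by
  \<open>zmul_append\<close>.\<close>

lemma block_product:
  fixes a b c :: "nat \<Rightarrow> nat \<Rightarrow> 'a::comm_ring_1" and P Q :: "nat \<Rightarrow> nat \<Rightarrow> 'a"
  assumes base: "\<And>p1 p2 p3. p1 < t * t \<Longrightarrow> p2 < t * t \<Longrightarrow> p3 < t * t \<Longrightarrow>
      (\<Sum>l<r. a p1 l * b p2 l * c p3 l) =
        (if p1 div t = p3 div t \<and> p1 mod t = p2 div t \<and> p2 mod t = p3 mod t then 1 else 0)"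
    and xe: "x < (t * t) ^ k" "e < (t * t) ^ h"
  defines "d \<equiv> t * t"
  shows "(\<Sum>l<r ^ k. tpow c d r k x l * (\<Sum>e1<d ^ h. \<Sum>e2<d ^ h. (if zmul t e1 e2 e then
        (\<Sum>x1<d ^ k. tpow a d r k x1 l * P (zrow t (x1 * d ^ h + e1)) (zcol t (x1 * d ^ h + e1))) *
        (\<Sum>x2<d ^ k. tpow b d r k x2 l * Q (zrow t (x2 * d ^ h + e2)) (zcol t (x2 * d ^ h + e2)))
        else 0)))
     = (\<Sum>j<t ^ (k + h). P (zrow t (x * d ^ h + e)) j * Q j (zcol t (x * d ^ h + e)))"
    (is "?L = ?R")
proof -
  define P' where "P' x e = P (zrow t (x * d ^ h + e)) (zcol t (x * d ^ h + e))" for x e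
  define Q' where "Q' x e = Q (zrow t (x * d ^ h + e)) (zcol t (x * d ^ h + e))" for x e
  let ?K = "d ^ k" and ?H = "d ^ h"
  let ?z = "x * ?H + e"
  \<comment> \<open>The right position is summed out in \<open>F\<close>, so that
    \<open>sum_zorder\<close> can be applied to one position at a time.\<close>
  define F where "F i j = (\<Sum>g<(t * t) ^ (k + h). if i = zrow t ?z \<and> j = zrow t g \<and> zcol t g = zcol t ?z
      then P i j * Q (zrow t g) (zcol t g) else 0)" for i j
  have pull: "v * (\<Sum>e1<?H. \<Sum>e2<?H. G e1 e2) = (\<Sum>e1<?H. \<Sum>e2<?H. v * G e1 e2)"
    for v :: 'a and G by (simp add: sum_distrib_left)
  have "?L = (\<Sum>l<r ^ k. \<Sum>e1<?H. \<Sum>e2<?H. \<Sum>x1<?K. \<Sum>x2<?K. if zmul t e1 e2 e then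
       tpow a d r k x1 l * tpow b d r k x2 l * tpow c d r k x l * (P' x1 e1 * Q' x2 e2) else 0)"
    unfolding pull
  proof (intro sum.cong refl)
    fix l e1 e2
    show "tpow c d r k x l * (if zmul t e1 e2 e then
        (\<Sum>x1<?K. tpow a d r k x1 l * P (zrow t (x1 * ?H + e1)) (zcol t (x1 * ?H + e1))) *
        (\<Sum>x2<?K. tpow b d r k x2 l * Q (zrow t (x2 * ?H + e2)) (zcol t (x2 * ?H + e2))) else 0)
      = (\<Sum>x1<?K. \<Sum>x2<?K. if zmul t e1 e2 e then
       tpow a d r k x1 l * tpow b d r k x2 l * tpow c d r k x l * (P' x1 e1 * Q' x2 e2) else 0)"
      unfolding sum_product P'_def Q'_def by (simp add: sum_distrib_left mult_ac)
  qed
  \<comment> \<open>Four interchanges carry the sum over \<open>l\<close> to the innermost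
    place.\<close>
  also have "\<dots> = (\<Sum>e1<?H. \<Sum>e2<?H. \<Sum>x1<?K. \<Sum>x2<?K. \<Sum>l<r ^ k. if zmul t e1 e2 e then
       tpow a d r k x1 l * tpow b d r k x2 l * tpow c d r k x l * (P' x1 e1 * Q' x2 e2) else 0)"
    by (rule trans[OF sum.swap], rule sum.cong[OF refl], rule trans[OF sum.swap], rule sum.cong[OF refl],
        rule trans[OF sum.swap], rule sum.cong[OF refl], rule sum.swap)
  also have "\<dots> = (\<Sum>e1<?H. \<Sum>e2<?H. \<Sum>x1<?K. \<Sum>x2<?K. if zmul t e1 e2 e then
       (\<Sum>l<r ^ k. tpow a d r k x1 l * tpow b d r k x2 l * tpow c d r k x l) * (P' x1 e1 * Q' x2 e2) else 0)"
    by (intro sum.cong refl) (simp add: sum_distrib_right)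
  also have "\<dots> = (\<Sum>e1<?H. \<Sum>e2<?H. \<Sum>x1<?K. \<Sum>x2<?K.
      if zmul t (x1 * ?H + e1) (x2 * ?H + e2) ?z then P' x1 e1 * Q' x2 e2 else 0)"
  proof (intro sum.cong refl)
    fix e1 e2 x1 x2 assume "e1 \<in> {..<?H}" "e2 \<in> {..<?H}" "x1 \<in> {..<?K}" "x2 \<in> {..<?K}"
    then show "(if zmul t e1 e2 e then
       (\<Sum>l<r ^ k. tpow a d r k x1 l * tpow b d r k x2 l * tpow c d r k x l) * (P' x1 e1 * Q' x2 e2) else 0)
      = (if zmul t (x1 * ?H + e1) (x2 * ?H + e2) ?z then P' x1 e1 * Q' x2 e2 else 0)"
      using tpow_identity[where a = a and b = b and c = c and r = r and x = x1 and y = x2 and z = x and k = k,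
          OF base] zmul_append[of e1 h e2 e x1 x2 x] xe
      unfolding d_def by auto
  qed
  \<comment> \<open>Block number and inner index of the same factor become neighbours, to be read as
    one Z-order index.\<close>
  also have "\<dots> = (\<Sum>x1<?K. \<Sum>e1<?H. \<Sum>x2<?K. \<Sum>e2<?H.
      if zmul t (x1 * ?H + e1) (x2 * ?H + e2) ?z then P' x1 e1 * Q' x2 e2 else 0)"
  proof -
    have "(\<Sum>e1<?H. \<Sum>e2<?H. \<Sum>x1<?K. \<Sum>x2<?K. G e1 e2 x1 x2)
      = (\<Sum>x1<?K. \<Sum>e1<?H. \<Sum>x2<?K. \<Sum>e2<?H. G e1 e2 x1 x2)" for G :: "nat \<Rightarrow> nat \<Rightarrow> nat \<Rightarrow> nat \<Rightarrow> 'a"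
    proof -
      have "(\<Sum>e1<?H. \<Sum>e2<?H. \<Sum>x1<?K. \<Sum>x2<?K. G e1 e2 x1 x2)
        = (\<Sum>e1<?H. \<Sum>x1<?K. \<Sum>e2<?H. \<Sum>x2<?K. G e1 e2 x1 x2)"
        by (intro sum.cong refl sum.swap)
      also have "\<dots> = (\<Sum>x1<?K. \<Sum>e1<?H. \<Sum>e2<?H. \<Sum>x2<?K. G e1 e2 x1 x2)" by (rule sum.swap)
      also have "\<dots> = (\<Sum>x1<?K. \<Sum>e1<?H. \<Sum>x2<?K. \<Sum>e2<?H. G e1 e2 x1 x2)"
        by (intro sum.cong refl sum.swap)
      finally show ?thesis .
    qed
    then show ?thesis .
  qed
  also have "\<dots> = (\<Sum>g1<d ^ (k + h). \<Sum>g2<d ^ (k + h). if zmul t g1 g2 ?z then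
      P (zrow t g1) (zcol t g1) * Q (zrow t g2) (zcol t g2) else 0)"
    unfolding power_add sum_nested_digits P'_def Q'_def ..
  also have "\<dots> = (\<Sum>g1<(t * t) ^ (k + h). F (zrow t g1) (zcol t g1))"
    unfolding F_def zmul_def d_def ..
  also have "\<dots> = (\<Sum>i<t ^ (k + h). \<Sum>j<t ^ (k + h). F i j)"
    by (rule sum_zorder)
  also have "\<dots> = (\<Sum>i<t ^ (k + h). \<Sum>j<t ^ (k + h). \<Sum>i'<t ^ (k + h). \<Sum>j'<t ^ (k + h).
      if i = zrow t ?z \<and> j = i' \<and> j' = zcol t ?z then P i j * Q i' j' else 0)"
    unfolding F_def by (intro sum.cong refl sum_zorder)
  also have "\<dots> = (\<Sum>j<t ^ (k + h). \<Sum>i<t ^ (k + h). \<Sum>i'<t ^ (k + h). \<Sum>j'<t ^ (k + h).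
      if i = zrow t ?z \<and> i' = j \<and> j' = zcol t ?z then P i j * Q i' j' else 0)"
    by (rule trans[OF sum.swap]) (simp add: eq_commute)
  also have "\<dots> = ?R"
  proof (rule sum.cong[OF refl])
    fix j assume "j \<in> {..<t ^ (k + h)}"
    moreover have "?z < (t * t) ^ (k + h)"
      using append_less[OF xe] by (simp add: power_add d_def)
    ultimately show "(\<Sum>i<t ^ (k + h). \<Sum>i'<t ^ (k + h). \<Sum>j'<t ^ (k + h).
        if i = zrow t ?z \<and> i' = j \<and> j' = zcol t ?z then P i j * Q i' j' else 0)
      = P (zrow t ?z) j * Q j (zcol t ?z)"
      using zrow_less zcol_less by (intro sum_triple_delta) auto
  qed
  finally show ?thesis .
qed

section \<open>Lower bound for the rank\<close>

lemma rank_gt: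
  fixes a b c :: "nat \<Rightarrow> nat \<Rightarrow> 'a::{field,finite}"
  assumes base: "\<And>p1 p2 p3. p1 < t * t \<Longrightarrow> p2 < t * t \<Longrightarrow> p3 < t * t \<Longrightarrow>
      (\<Sum>l<r. a p1 l * b p2 l * c p3 l) =
        (if p1 div t = p3 div t \<and> p1 mod t = p2 div t \<and> p2 mod t = p3 mod t then 1 else 0)"
    and r: "1 \<le> r"
  shows "t * t < r"
proof (rule ccontr)
  assume "\<not> t * t < r"
  define d where "d = t * t"
  have rd: "r - 1 < d" using \<open>\<not> t * t < r\<close> r unfolding d_def by simp
  define D where "D = ({..<d} \<rightarrow>\<^sub>E (UNIV :: 'a set))"
  define f where "f X = (\<lambda>l\<in>{..<r - 1}. \<Sum>p<d. X p * a p l)" for X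
  have q: "1 < card (UNIV :: 'a set)"
    using card_mono[of UNIV "{0, 1 :: 'a}"] by (simp add: card_insert_if)
  \<comment> \<open>There are more vectors than value tuples under the first \<open>r - 1\<close>
    forms, so two vectors agree on all of them; their difference will be \<open>X\<close>. The count
    uses that the field is finite.\<close>
  have "card (f ` D) \<le> card ({..<r - 1} \<rightarrow>\<^sub>E (UNIV :: 'a set))"
    by (intro card_mono finite_PiE) (auto simp: f_def split: if_splits)
  also have "\<dots> = card (UNIV :: 'a set) ^ (r - 1)" by (simp add: card_PiE)
  also have "\<dots> < card (UNIV :: 'a set) ^ d" using rd q by (rule power_strict_increasing)
  also have "\<dots> = card D" by (simp add: D_def card_PiE)
  finally have "\<not> inj_on f D" using card_image by fastforce
  then obtain X1 X2 where X: "X1 \<in> D" "X2 \<in> D" "f X1 = f X2" "X1 \<noteq> X2" by (auto simp: inj_on_def)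
  then obtain p0 where "X1 p0 \<noteq> X2 p0" "p0 < d"
    by (metis D_def PiE_ext lessThan_iff)
  define X where "X p = X1 p - X2 p" for p
  have Xp0: "X p0 \<noteq> 0" using \<open>X1 p0 \<noteq> X2 p0\<close> by (simp add: X_def)
  have kill: "(\<Sum>p<d. X p * a p l) = 0" if "l < r - 1" for l
  proof -
    have "f X1 l = f X2 l" using X by simp
    then show ?thesis using that by (simp add: f_def X_def left_diff_distrib sum_subtractf)
  qed
  define s where "s = (\<Sum>p<d. X p * a p (r - 1))"
  have form: "(\<Sum>p<d. X p * (if p div t = p3 div t \<and> p mod t = p2 div t \<and> p2 mod t = p3 mod t then 1 else 0))
      = s * b p2 (r - 1) * c p3 (r - 1)" if "p2 < d" "p3 < d" for p2 p3
  proof -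
    have "(\<Sum>p<d. X p * (if p div t = p3 div t \<and> p mod t = p2 div t \<and> p2 mod t = p3 mod t then 1 else 0))
      = (\<Sum>p<d. X p * (\<Sum>l<r. a p l * b p2 l * c p3 l))"
      using that base unfolding d_def by (intro sum.cong refl) simp
    also have "\<dots> = (\<Sum>l<r. (\<Sum>p<d. X p * a p l) * (b p2 l * c p3 l))"
    proof -
      have "(\<Sum>p<d. X p * (\<Sum>l<r. a p l * b p2 l * c p3 l)) = (\<Sum>p<d. \<Sum>l<r. X p * a p l * (b p2 l * c p3 l))"
        by (simp add: sum_distrib_left mult_ac)
      also have "\<dots> = (\<Sum>l<r. \<Sum>p<d. X p * a p l * (b p2 l * c p3 l))" by (rule sum.swap)
      finally show ?thesis by (simp add: sum_distrib_right)
    qed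
    also have "\<dots> = (\<Sum>l<Suc (r - 1). (\<Sum>p<d. X p * a p l) * (b p2 l * c p3 l))" using r by simp
    also have "\<dots> = s * b p2 (r - 1) * c p3 (r - 1)"
      by (simp add: kill s_def algebra_simps)
    finally show ?thesis .
  qed
  \<comment> \<open>\<open>p0\<close> is the position of a nonzero entry of \<open>X\<close>. Row
    \<open>j\<close> of the right factor and row \<open>i\<close> of the product isolate this
    entry.\<close>
  define i j where "i = p0 div t" and "j = p0 mod t"
  have ij: "i < t" "j < t" using \<open>p0 < d\<close> t by (auto simp: i_def j_def d_def less_mult_imp_div_less)
  have idx: "u * t + v < d" if "u < t" "v < t" for u v
    using append_less[OF that] by (simp add: d_def)
  have val: "s * b (j * t + v) (r - 1) * c (i * t + w) (r - 1) = (if v = w then X p0 else 0)"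
    if "v < t" "w < t" for v w
  proof -
    have "s * b (j * t + v) (r - 1) * c (i * t + w) (r - 1)
      = (\<Sum>p<d. X p * (if p div t = i \<and> p mod t = j \<and> v = w then 1 else 0))"
      using form[of "j * t + v" "i * t + w"] idx ij that by simp
    also have "\<dots> = (\<Sum>p<d. if p = p0 then (if v = w then X p0 else 0) else 0)"
    proof (intro sum.cong refl)
      fix p
      have "p div t = i \<and> p mod t = j \<longleftrightarrow> p = p0"
        unfolding i_def j_def by (metis div_mult_mod_eq)
      then show "X p * (if p div t = i \<and> p mod t = j \<and> v = w then 1 else 0)
          = (if p = p0 then (if v = w then X p0 else 0) else 0)" by auto
    qed
    also have "\<dots> = (if v = w then X p0 else 0)" using \<open>p0 < d\<close> by simp
    finally show ?thesis .
  qed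
  have "0 < t" "1 < t" using t by auto
  \<comment> \<open>\<open>val\<close> writes a nonzero multiple of the identity matrix in
    \<open>v\<close> and \<open>w\<close> as a product of a factor in \<open>v\<close> and a factor
    in \<open>w\<close>; the indices 0 and 1, available as \<open>t \<ge> 2\<close>, already
    contradict this.\<close>
  show False
    using val[of 0 0] val[of 1 1] val[of 0 1] Xp0 \<open>0 < t\<close> \<open>1 < t\<close> by auto
qed

end

section \<open>Words of digits\<close>

text \<open>
  \<open>table_exp f m e\<close> evaluates the finite function \<open>f\<close> on \<open>{..<m}\<close> by comparing the argument with every
  constant, so tables of constant size need no memory.
\<close>

fun table_exp :: "(nat \<Rightarrow> nat) \<Rightarrow> nat \<Rightarrow> aexp \<Rightarrow> aexp" where
  "table_exp f 0 e = Lit 0"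
| "table_exp f (Suc m) e = Bin PLUS (table_exp f m e)
     (Bin TIMES (Lit (f m)) (Bin MINUS (Lit 1) (Bin PLUS (Bin LESS e (Lit m)) (Bin LESS (Lit m) e))))"

lemma aval_table_exp: "aval (table_exp f m e) a = (if aval e a < m then f (aval e a) else 0)"
  by (induction m) (auto simp: less_Suc_eq)

lemma bounded_table_exp: "bounded_exp (table_exp f m e)"
  by (induction m) auto

lemma linear_table_exp: "linear_exp e \<Longrightarrow> linear_exp (table_exp f m e)"
  by (induction m) auto

text \<open>
  If step \<open>g'\<close> of a flat loop adds \<open>\<tau> g'\<close> to cell \<open>g' div m\<close>, then \<open>part m g y \<tau>\<close> is the content of cell
  \<open>y\<close> after \<open>g\<close> steps.
\<close>

definition part :: "nat \<Rightarrow> nat \<Rightarrow> nat \<Rightarrow> (nat \<Rightarrow> 'a::comm_monoid_add) \<Rightarrow> 'a" where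
  "part m g y \<tau> = (\<Sum>p | p < m \<and> y * m + p < g. \<tau> (y * m + p))"

lemma part_0 [simp]: "part m 0 y \<tau> = 0"
  by (simp add: part_def)

lemma part_Suc:
  assumes "0 < m"
  shows "part m (Suc g) y \<tau> = part m g y \<tau> + (if y = g div m then \<tau> g else 0)"
proof (cases "y = g div m")
  case True
  have eq: "{p. p < m \<and> y * m + p < Suc g} = insert (g mod m) {p. p < m \<and> y * m + p < g}"
  proof -
    have "y * m + p < Suc g \<longleftrightarrow> y * m + p < g \<or> p = g mod m" for p
      using div_mult_mod_eq[of g m] unfolding True by linarith
    moreover have "g mod m < m" using assms by simp
    ultimately show ?thesis by blast
  qed
  have "g mod m \<notin> {p. p < m \<and> y * m + p < g}" using True by auto
  then have "part m (Suc g) y \<tau> = \<tau> (y * m + g mod m) + part m g y \<tau>"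
    unfolding part_def eq by (subst sum.insert) auto
  then show ?thesis using True by (simp add: add.commute)
next
  case False
  have "{p. p < m \<and> y * m + p < Suc g} = {p. p < m \<and> y * m + p < g}"
    using False by (auto simp: less_Suc_eq)
  then show ?thesis using False by (simp add: part_def)
qed

lemma part_full: "y < M \<Longrightarrow> part m (M * m) y \<tau> = (\<Sum>p<m. \<tau> (y * m + p))"
  unfolding part_def by (intro sum.cong refl) (auto intro: append_less)

text \<open>Describes an array that is being filled together with its unwritten cells, so that
  invariants are equations between functions.\<close>

definition initseg :: "(nat \<Rightarrow> nat) \<Rightarrow> nat \<Rightarrow> nat \<Rightarrow> nat" where
  "initseg f m = (\<lambda>x. if x < m then f x else 0)"

lemma initseg_less: "x < m \<Longrightarrow> initseg f m x = f x"
  by (simp add: initseg_def)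

lemma initseg_Suc: "(initseg f m)(m := f m) = initseg f (Suc m)"
  by (auto simp: initseg_def)

lemma initseg_0: "initseg f 0 = (\<lambda>_. 0)"
  by (simp add: initseg_def)

text \<open>Indices count from 0, and a pair \<open>(i, j)\<close> is flattened to
  \<open>i * t + j\<close>, which is the digit used in Z-order.\<close>

locale encoded_scheme =
  fixes t r :: nat
    and ca cb cg :: "nat \<Rightarrow> nat \<Rightarrow> 'a::{field,finite}"
    and enc :: "'a \<Rightarrow> nat"
  assumes t: "t \<ge> 2" and r: "r \<ge> 1"
    and base: "\<And>p1 p2 p3. p1 < t * t \<Longrightarrow> p2 < t * t \<Longrightarrow> p3 < t * t \<Longrightarrow>
      (\<Sum>l<r. ca p1 l * cb p2 l * cg p3 l) =
        (if p1 div t = p3 div t \<and> p1 mod t = p2 div t \<and> p2 mod t = p3 mod t then 1 else 0)"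
    and enc: "bij_betw enc UNIV {..<card (UNIV :: 'a set)}"
begin

definition d :: nat where "d = t * t"

definition q :: nat where "q = card (UNIV :: 'a set)"

text \<open>
  Internally zero is encoded by 0, so that fresh memory holds zero matrices; \<open>swp\<close> translates
  between the two encodings in both directions.
\<close>

definition swp :: "nat \<Rightarrow> nat" where
  "swp x = (if x = 0 then enc 0 else if x = enc 0 then 0 else x)"

definition phi :: "'a \<Rightarrow> nat" where "phi x = swp (enc x)"

definition un :: "nat \<Rightarrow> 'a" where "un = inv_into UNIV phi"

lemma d_gt: "d < r"
  unfolding d_def using rank_gt[OF t base r] .

lemma d_ge: "4 \<le> d"
  unfolding d_def using mult_le_mono[OF t t] by simp

lemma q_ge: "2 \<le> q"
  unfolding q_def using card_mono[of UNIV "{0, 1 :: 'a}"] by simp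

lemma enc_less: "enc x < q"
  using bij_betwE[OF enc] by (auto simp: q_def)

lemma swp_swp: "swp (swp x) = x" and swp_less: "x < q \<Longrightarrow> swp x < q"
  using enc_less[of 0] by (auto simp: swp_def)

lemma phi_less: "phi x < q"
  unfolding phi_def by (intro swp_less enc_less)

lemma bij_phi: "bij_betw phi UNIV {..<q}"
proof -
  have "bij_betw swp {..<q} {..<q}"
    by (rule bij_betw_byWitness[of _ swp]) (auto simp: swp_swp swp_less)
  then show ?thesis
    using bij_betw_trans[OF enc[folded q_def]] by (simp add: phi_def[abs_def] comp_def)
qed

lemma un_phi: "un (phi x) = x"
  using bij_phi by (simp add: un_def bij_betw_def)

lemma phi_un: "c < q \<Longrightarrow> phi (un c) = c"
  using bij_phi by (auto simp: un_def bij_betw_def f_inv_into_f)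

lemma phi_0 [simp]: "phi 0 = 0"
  by (simp add: phi_def swp_def)

lemma un_0 [simp]: "un 0 = 0"
  using un_phi[of 0] by simp

lemma un_eq_0_iff: "c < q \<Longrightarrow> un c = 0 \<longleftrightarrow> c = 0"
  using phi_un by fastforce

text \<open>A number is read as a vector over the field, with the least significant digit at
  position 0 and zeros beyond its length.\<close>

definition dig :: "nat \<Rightarrow> nat \<Rightarrow> 'a" where "dig i x = un (x div q ^ i mod q)"

lemma dig_zero [simp]: "dig i 0 = 0"
  by (simp add: dig_def)

lemma dig_0: "dig 0 x = un (x mod q)" and dig_Suc: "dig (Suc i) x = dig i (x div q)"
  by (simp_all add: dig_def div_mult2_eq)

lemma dig_cons: "e < q \<Longrightarrow> dig i (v * q + e) = (case i of 0 \<Rightarrow> un e | Suc j \<Rightarrow> dig j v)"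
  by (auto simp: dig_0 dig_Suc div_append mod_append simp del: div_mult_self3 split: nat.split)

lemma dig_high: "x < q ^ H \<Longrightarrow> H \<le> i \<Longrightarrow> dig i x = 0"
proof -
  assume "x < q ^ H" "H \<le> i"
  moreover have "q ^ H \<le> q ^ i" using \<open>H \<le> i\<close> q_ge by (intro power_increasing) auto
  ultimately have "x < q ^ i" by simp
  then show ?thesis by (simp add: dig_def)
qed

text \<open>Bounds a word by its decoded digits. This depends on 0 being the only digit that decodes
  to zero.\<close>

lemma less_of_dig: "(\<And>i. H \<le> i \<Longrightarrow> dig i x = 0) \<Longrightarrow> x < q ^ H"
proof (induction H arbitrary: x)
  case 0
  have "x = 0" if "\<And>i. dig i x = 0" for x
    using that
  proof (induction x rule: less_induct)
    case (less x)
    show ?case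
    proof (rule ccontr)
      assume x: "x \<noteq> 0"
      have "x div q = 0" using x q_ge less(2)[of "Suc _"] by (intro less(1)) (auto simp: dig_Suc)
      moreover have "x mod q = 0"
        using less(2)[of 0] un_eq_0_iff[of "x mod q"] q_ge by (simp add: dig_0)
      ultimately show False using x div_mult_mod_eq[of x q] by simp
    qed
  qed
  then show ?case using 0 by simp
next
  case (Suc H)
  have "x div q < q ^ H" using Suc.prems[of "Suc _"] by (intro Suc.IH) (simp add: dig_Suc)
  then show ?case using q_ge by (simp add: div_less_iff_less_mult mult.commute)
qed

lemma dig_unit: "c < q \<Longrightarrow> dig i (c * q ^ e) = (if i = e then un c else 0)"
proof (induction e arbitrary: i)
  case 0
  then show ?case using dig_cons[of c i 0] by (cases i) auto
next
  case (Suc e)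
  have "dig i (c * q ^ e * q + 0) = (case i of 0 \<Rightarrow> un 0 | Suc j \<Rightarrow> dig j (c * q ^ e))"
    using q_ge by (intro dig_cons) simp
  then show ?case using Suc by (cases i) (simp_all add: mult_ac)
qed

lemma unit_less: "c < q \<Longrightarrow> e < H \<Longrightarrow> c * q ^ e < q ^ H"
  by (rule less_of_dig) (simp add: dig_unit)

text \<open>Digitwise \<open>x + c y\<close>, with the code of the scalar \<open>c\<close> in front
  of the key; all additions of words go through this table.\<close>

definition isTAB :: "nat \<Rightarrow> (nat \<Rightarrow> nat) \<Rightarrow> bool" where
  "isTAB Q T \<longleftrightarrow> (\<forall>c<q. \<forall>x<Q. \<forall>y<Q. T ((c * Q + x) * Q + y) < Q \<and>
     (\<forall>i. dig i (T ((c * Q + x) * Q + y)) = dig i x + un c * dig i y))"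

text \<open>The cells from \<open>b\<close> on are accumulators for the vectors
  \<open>\<tau> g\<close>, and those below \<open>b\<close> are as in \<open>f0\<close>. All
  \<open>y\<close> are covered, also those never reached, so that the cells behind the results are
  known to be 0 afterwards.\<close>

definition accs :: "nat \<Rightarrow> nat \<Rightarrow> nat \<Rightarrow> (nat \<Rightarrow> nat \<Rightarrow> 'a) \<Rightarrow> nat \<Rightarrow> (nat \<Rightarrow> nat) \<Rightarrow> (nat \<Rightarrow> nat) \<Rightarrow> bool" where
  "accs Q b m \<tau> g f0 f \<longleftrightarrow> (\<forall>y<b. f y = f0 y) \<and>
     (\<forall>y. f (b + y) < Q \<and> (\<forall>i. dig i (f (b + y)) = part m g y (\<lambda>g. \<tau> g i)))"

lemma accs_0: "0 < Q \<Longrightarrow> (\<And>y. f (b + y) = 0) \<Longrightarrow> accs Q b m \<tau> 0 f f"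
  by (simp add: accs_def)

lemma accs_Suc:
  assumes "accs Q b m \<tau> g f0 f" "isTAB Q T" "c < q" "w < Q" "0 < m"
    and "\<And>i. un c * dig i w = \<tau> g i"
  shows "accs Q b m \<tau> (Suc g) f0
     (f(b + g div m := T ((c * Q + f (b + g div m)) * Q + w)))"
  using assms by (auto simp: accs_def isTAB_def part_Suc)

lemma accs_val_less:
  assumes "accs Q b m \<tau> g f0 f" "isTAB Q T" "c < q" "w < Q"
  shows "T ((c * Q + f (b + y)) * Q + w) < Q"
  using assms by (auto simp: accs_def isTAB_def)

end

section \<open>The lookup tables\<close>

text \<open>Variables 7 and 9 are the counter and the bound of every inner loop.\<close>

definition Loop :: "aexp \<Rightarrow> com \<Rightarrow> ram_program" where
  "Loop e c = Seq (to_prog (Mov 9 e)) (For 7 9 (to_prog c))"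

definition kloop :: "aexp \<Rightarrow> com \<Rightarrow> nat" where
  "kloop e c = com_coeff (Mov 9 e) + kfor 7 9 + com_coeff c"

lemma triple_Loop:
  assumes body: "\<And>i a. i < m \<Longrightarrow> I i a \<Longrightarrow> vr a 7 = i \<Longrightarrow> vr a 9 = m \<Longrightarrow> bounded_state L Off a \<Longrightarrow>
       wp L Off c (\<lambda>a. I (Suc i) a \<and> vr a 7 = i \<and> vr a 9 = m) a"
    and indep: "\<And>i a v. I i a \<Longrightarrow> I i (a\<lparr>vr := (vr a)(7 := v)\<rparr>)"
      "\<And>i a v. I i a \<Longrightarrow> I i (a\<lparr>vr := (vr a)(9 := v)\<rparr>)"
    and pre: "\<And>a. P a \<Longrightarrow> I 0 a \<and> aval e a = m"
    and post: "\<And>a. I m a \<Longrightarrow> Q a"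
    and m: "m < 2 ^ L" and W: "1 \<le> L" "L \<le> W" "L * L \<le> W \<or> (linear_exp e \<and> linear_com c)"
  shows "triple Off L P (Loop e c) Q ((m + 1) * (kloop e c * W))"
proof -
  have "triple Off L P (Loop e c) Q (com_coeff (Mov 9 e) * W + (m + 1) * ((kfor 7 9 + com_coeff c) * W))"
    unfolding Loop_def
  proof (rule triple_Seq)
    show "triple Off L P (to_prog (Mov 9 e)) (\<lambda>a. I 0 a \<and> vr a 9 = m) (com_coeff (Mov 9 e) * W)"
      using pre indep(2) m W by (intro triple_com) auto
    show "triple Off L (\<lambda>a. I 0 a \<and> vr a 9 = m) (For 7 9 (to_prog c)) Q ((m + 1) * ((kfor 7 9 + com_coeff c) * W))"
      using body indep(1) post W by (intro triple_For_com[where I = I]) auto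
  qed
  moreover have "com_coeff (Mov 9 e) * W + (m + 1) * ((kfor 7 9 + com_coeff c) * W) \<le> (m + 1) * (kloop e c * W)"
    unfolding kloop_def by (simp add: distrib_right del: com_coeff.simps)
  ultimately show ?thesis using triple_conseq by blast
qed

text \<open>At most one of the two comparisons holds, so the truncated difference is 0 or 1; its
  literal minuend makes the expression a bounded one.\<close>

definition EQ :: "aexp \<Rightarrow> aexp \<Rightarrow> aexp" where
  "EQ e1 e2 = Bin MINUS (Lit 1) (Bin PLUS (Bin LESS e1 e2) (Bin LESS e2 e1))"

lemma aval_EQ: "aval (EQ e1 e2) a = (if aval e1 a = aval e2 a then 1 else 0)"
  by (simp add: EQ_def)

text \<open>Each power-of-two bound controls the largest number of one kind: Z-order indices, keys
  of the addition table, the counter of the loop that fills the multiplication table, and positions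
  and counters in the transformations.\<close>

locale sized_scheme = encoded_scheme t r ca cb cg enc
  for t r :: nat and ca cb cg :: "nat \<Rightarrow> nat \<Rightarrow> 'a::{field,finite}" and enc +
  fixes n h k L :: nat
  assumes n: "1 \<le> n" and L: "1 \<le> L"
    and nN: "n \<le> t ^ (k + h)"
    and bSH: "d ^ k * d ^ h < 2 ^ L"
    and bTAB: "q * q ^ d ^ h * q ^ d ^ h < 2 ^ L"
    and bMUL: "q ^ d ^ h * q ^ d ^ h * (d ^ h * (d ^ h * d ^ h)) < 2 ^ L"
    and bR: "(k + 1) * r ^ k * r < 2 ^ L"
begin

definition H :: nat where "H = d ^ h"
definition Q :: nat where "Q = q ^ H"
definition S :: nat where "S = d ^ k"
definition R :: nat where "R = r ^ k"
definition Off :: nat where "Off = 3 * (n * n)"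

text \<open>
  Words hold \<open>H = t^(2 h)\<close> digits, hence are less than \<open>Q = q^H\<close>.  Variables 10 and 11 will hold the start
  and the length of the array segment being transformed; 16 and 17 keep the starts of the two
  transformed factors.
\<close>

definition cfg :: "nat \<Rightarrow> nat \<Rightarrow> ast \<Rightarrow> bool" where
  "cfg u v a \<longleftrightarrow> vr a 0 = n \<and> vr a 1 = H \<and> vr a 2 = Q \<and> vr a 4 = k \<and> vr a 5 = S \<and> vr a 6 = R
     \<and> vr a 16 = u \<and> vr a 17 = v"

lemma H_pos: "0 < H" and S_pos: "0 < S" and R_pos: "0 < R"
  using d_ge r by (auto simp: H_def S_def R_def)

lemma q_le_Q: "q \<le> Q"
  unfolding Q_def using power_increasing[of 1 H q] H_pos q_ge by simp

lemma Q_pos: "0 < Q"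
  using q_le_Q q_ge by simp

lemma H_less_Q: "H < Q"
proof -
  have "H < 2 ^ H" by simp
  also have "\<dots> \<le> Q" unfolding Q_def using q_ge by (rule power_mono) simp
  finally show ?thesis .
qed

lemma SH_less: "S * H < 2 ^ L" and qQQ_less: "q * Q * Q < 2 ^ L"
  and MUL_less: "Q * Q * (H * (H * H)) < 2 ^ L" and kRr_less: "(k + 1) * R * r < 2 ^ L"
  using bSH bTAB bMUL bR by (simp_all add: H_def Q_def S_def R_def)

lemma Q_le: "Q \<le> q * Q * Q" and qQ_le: "q * Q \<le> q * Q * Q"
  using Q_pos q_ge by simp_all

lemma qQ_less: "q * Q < 2 ^ L"
  using qQ_le qQQ_less by (rule le_less_trans)

lemma Q_less: "x \<le> Q \<Longrightarrow> x < 2 ^ L"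
  using Q_le qQQ_less by linarith

lemma q_less: "x \<le> q \<Longrightarrow> x < 2 ^ L"
  using Q_less q_le_Q by simp

abbreviation "eSH \<equiv> Bin TIMES (Var 5) (Var 1)"

definition bodyZ :: com where
  "bodyZ = Sq
     (Put RHO (Var 7) (Bin PLUS (Bin TIMES (Cell RHO (Bin DIV (Var 7) (Lit d))) (Lit t)) (Bin DIV (Bin MOD (Var 7) (Lit d)) (Lit t))))
     (Put KAP (Var 7) (Bin PLUS (Bin TIMES (Cell KAP (Bin DIV (Var 7) (Lit d))) (Lit t)) (Bin MOD (Bin MOD (Var 7) (Lit d)) (Lit t))))"

lemma triple_Z:
  assumes A0: "A0 RHO = (\<lambda>_. 0)" "A0 KAP = (\<lambda>_. 0)"
  shows "triple Off L (\<lambda>a. cfg u v a \<and> lo a = l0 \<and> ar a = A0) (Loop eSH bodyZ)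
    (\<lambda>a. cfg u v a \<and> lo a = l0 \<and> ar a RHO = initseg (zrow t) (S * H) \<and> ar a KAP = initseg (zcol t) (S * H) \<and>
       (\<forall>j. j \<notin> {RHO, KAP} \<longrightarrow> ar a j = A0 j))
    ((S * H + 1) * (kloop eSH bodyZ * (L * L)))"
proof (rule triple_Loop[where I = "\<lambda>i a. cfg u v a \<and> lo a = l0 \<and> ar a RHO = initseg (zrow t) i
       \<and> ar a KAP = initseg (zcol t) i \<and> (\<forall>j. j \<notin> {RHO, KAP} \<longrightarrow> ar a j = A0 j)"])
  fix i a
  assume i: "i < S * H" and I: "cfg u v a \<and> lo a = l0 \<and> ar a RHO = initseg (zrow t) i
       \<and> ar a KAP = initseg (zcol t) i \<and> (\<forall>j. j \<notin> {RHO, KAP} \<longrightarrow> ar a j = A0 j)"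
    and v: "vr a 7 = i" "vr a 9 = S * H"
  have d2: "2 \<le> d" using d_ge by simp
  \<comment> \<open>At \<open>i = 0\<close> the cell refers to itself, which gives the correct value
    as it is still 0.\<close>
  have "i div d < i \<or> i = 0" using d2 by (cases "i = 0") auto
  then have 1: "initseg (zrow t) i (i div d) = zrow t (i div d)" "initseg (zcol t) i (i div d) = zcol t (i div d)"
    by (auto simp: initseg_def)
  have 2: "zrow t (i div d) * t + i mod d div t = zrow t i" "zcol t (i div d) * t + i mod d mod t = zcol t i"
    unfolding d_def using zrow_step[OF t, of i] zcol_step[OF t, of i] by simp_all
  have 3: "zrow t i < 2 ^ L" "zcol t i < 2 ^ L"
    using zrow_le[OF t, of i] zcol_le[OF t, of i] i SH_less by linarith+
  show "wp L Off bodyZ (\<lambda>a. (cfg u v a \<and> lo a = l0 \<and> ar a RHO = initseg (zrow t) (Suc i)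
       \<and> ar a KAP = initseg (zcol t) (Suc i) \<and> (\<forall>j. j \<notin> {RHO, KAP} \<longrightarrow> ar a j = A0 j)) \<and>
       vr a 7 = i \<and> vr a 9 = S * H) a"
    unfolding bodyZ_def using I v 3 by (simp add: 1 2 initseg_Suc cfg_def)
qed (use L SH_less A0 in \<open>simp_all add: cfg_def initseg_0\<close>)

definition bodyPOW :: com where
  "bodyPOW = Put POW (Bin PLUS (Var 7) (Lit 1)) (Bin TIMES (Cell POW (Var 7)) (Lit q))"

definition progPOW :: ram_program where
  "progPOW = Seq (to_prog (Put POW (Lit 0) (Lit 1))) (Loop (Var 1) bodyPOW)"

definition kPOW :: nat where
  "kPOW = com_coeff (Put POW (Lit 0) (Lit 1)) + kloop (Var 1) bodyPOW"

lemma triple_POW: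
  assumes A0: "A0 POW = (\<lambda>_. 0)"
  shows "triple Off L (\<lambda>a. cfg u v a \<and> lo a = l0 \<and> ar a = A0) progPOW
    (\<lambda>a. cfg u v a \<and> lo a = l0 \<and> ar a POW = initseg (\<lambda>e. q ^ e) (Suc H) \<and> frame POW A0 a)
    ((H + 1) * (kPOW * (L * L)))"
proof -
  define I where "I i a \<longleftrightarrow> cfg u v a \<and> lo a = l0 \<and> ar a POW = initseg (\<lambda>e. q ^ e) (Suc i)
    \<and> frame POW A0 a" for i a
  have T1: "triple Off L (\<lambda>a. cfg u v a \<and> lo a = l0 \<and> ar a = A0) progPOW (I H)
    (com_coeff (Put POW (Lit 0) (Lit 1)) * (L * L) + (H + 1) * (kloop (Var 1) bodyPOW * (L * L)))"
    unfolding progPOW_def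
  proof (rule triple_Seq)
    show "triple Off L (\<lambda>a. cfg u v a \<and> lo a = l0 \<and> ar a = A0) (to_prog (Put POW (Lit 0) (Lit 1))) (I 0)
      (com_coeff (Put POW (Lit 0) (Lit 1)) * (L * L))"
      using L A0 q_less[of 1] q_ge by (intro triple_com) (simp_all add: I_def cfg_def initseg_def fun_eq_iff)
    show "triple Off L (I 0) (Loop (Var 1) bodyPOW) (I H) ((H + 1) * (kloop (Var 1) bodyPOW * (L * L)))"
    proof (rule triple_Loop[where I = I])
      fix i a assume i: "i < H" and I: "I i a" and v: "vr a 7 = i" "vr a 9 = H"
      have "q ^ Suc i \<le> Q" unfolding Q_def using i q_ge by (intro power_increasing) auto
      then have "q ^ Suc i < 2 ^ L" by (rule Q_less)
      then have b: "q ^ i * q < 2 ^ L" by (simp add: mult.commute)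
      have "(initseg (\<lambda>e. q ^ e) (Suc i))(Suc i := q ^ i * q) = initseg (\<lambda>e. q ^ e) (Suc (Suc i))"
        using initseg_Suc[of "\<lambda>e. q ^ e" "Suc i"] by (simp add: mult.commute)
      then show "wp L Off bodyPOW (\<lambda>a. I (Suc i) a \<and> vr a 7 = i \<and> vr a 9 = H) a"
        unfolding bodyPOW_def using I v b by (simp add: I_def cfg_def initseg_less)
    qed (use L H_less_Q Q_less[of H] in \<open>simp_all add: I_def cfg_def\<close>)
  qed
  have T2: "com_coeff (Put POW (Lit 0) (Lit 1)) * (L * L) + (H + 1) * (kloop (Var 1) bodyPOW * (L * L))
      \<le> (H + 1) * (kPOW * (L * L))"
    unfolding kPOW_def by (simp add: distrib_right del: com_coeff.simps)
  show ?thesis by (rule triple_conseq[OF T1 _ _ T2]) (simp_all add: I_def)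
qed

text \<open>
  In linear time, the table key \<open>(c * Q + x) * Q + y\<close> is computed as \<open>SH[c * Q + x] + y\<close>, as
  multiplying two full words would cost \<open>L^2\<close>.
\<close>

definition bodySH :: com where "bodySH = Put SH (Var 7) (Bin TIMES (Var 7) (Var 2))"

lemma triple_SH:
  assumes A0: "A0 SH = (\<lambda>_. 0)"
  shows "triple Off L (\<lambda>a. cfg u v a \<and> lo a = l0 \<and> ar a = A0) (Loop (Bin TIMES (Lit q) (Var 2)) bodySH)
    (\<lambda>a. cfg u v a \<and> lo a = l0 \<and> ar a SH = initseg (\<lambda>z. z * Q) (q * Q) \<and> frame SH A0 a)
    ((q * Q + 1) * (kloop (Bin TIMES (Lit q) (Var 2)) bodySH * (L * L)))"
proof (rule triple_Loop[where I = "\<lambda>i a. cfg u v a \<and> lo a = l0 \<and> ar a SH = initseg (\<lambda>z. z * Q) i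
       \<and> frame SH A0 a"])
  fix i a
  assume i: "i < q * Q" and I: "cfg u v a \<and> lo a = l0 \<and> ar a SH = initseg (\<lambda>z. z * Q) i
       \<and> frame SH A0 a" and v: "vr a 7 = i" "vr a 9 = q * Q"
  have "i * Q \<le> q * Q * Q" using i by simp
  then have b: "i * Q < 2 ^ L" using qQQ_less by linarith
  have u: "(initseg (\<lambda>z. z * Q) i)(i := i * Q) = initseg (\<lambda>z. z * Q) (Suc i)"
    by (rule initseg_Suc)
  show "wp L Off bodySH (\<lambda>a. (cfg u v a \<and> lo a = l0 \<and> ar a SH = initseg (\<lambda>z. z * Q) (Suc i)
       \<and> frame SH A0 a) \<and> vr a 7 = i \<and> vr a 9 = q * Q) a"
    unfolding bodySH_def using I v b by (simp add: cfg_def u)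
qed (use L A0 qQ_less in \<open>simp_all add: cfg_def initseg_0\<close>)

text \<open>
  The entry for \<open>(c, x, y)\<close> is read off the entry for \<open>(c, x div q, y div q)\<close>.  For \<open>x = y = 0\<close> this is the
  entry itself, which works because it is still 0.
\<close>

definition TABI :: "nat \<Rightarrow> (nat \<Rightarrow> nat) \<Rightarrow> bool" where
  "TABI w T \<longleftrightarrow> (\<forall>c<q. \<forall>x<Q. \<forall>y<Q.
     ((c * Q + x) * Q + y < w \<longrightarrow> T ((c * Q + x) * Q + y) < Q \<and>
       (\<forall>i. dig i (T ((c * Q + x) * Q + y)) = dig i x + un c * dig i y)) \<and>
     (w \<le> (c * Q + x) * Q + y \<longrightarrow> T ((c * Q + x) * Q + y) = 0))"

lemma TABI_Suc:
  assumes T: "TABI w T" and w: "w = (c * Q + x) * Q + y" and c: "c < q" and x: "x < Q" and y: "y < Q"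
  defines "z \<equiv> T ((c * Q + x div q) * Q + y div q) * q + phi (un (x mod q) + un c * un (y mod q))"
  shows "z < Q" "TABI (Suc w) (T(w := z))"
proof -
  have xy': "x div q < Q" "y div q < Q" using x y div_le_dividend le_less_trans by blast+
  have z: "dig i z = dig i x + un c * dig i y" for i
  proof (cases "x = 0 \<and> y = 0")
    case True
    have "T w = 0" using T[unfolded TABI_def, rule_format, OF c x y, THEN conjunct2] w by simp
    then have "z = 0" using True unfolding z_def w by simp
    then show ?thesis using True by simp
  next
    case False
    have q1: "x div q \<le> x" "y div q \<le> y" by simp_all
    \<comment> \<open>Whichever argument shrinks, the key becomes smaller, so the entry referred to
      has been filled before.\<close>
    have "x div q < x \<or> y div q < y" using False q_ge by auto
    then have "(c * Q + x div q) * Q + y div q < w"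
    proof
      assume "x div q < x"
      then have "(c * Q + x div q) * Q + y div q < (c * Q + x) * Q"
        using xy' by (intro append_less) auto
      then show ?thesis unfolding w by linarith
    next
      assume "y div q < y"
      moreover have "(c * Q + x div q) * Q \<le> (c * Q + x) * Q" using q1 by (intro mult_le_mono1) simp
      ultimately show ?thesis unfolding w by linarith
    qed
    then have "dig j (T ((c * Q + x div q) * Q + y div q)) = dig j (x div q) + un c * dig j (y div q)" for j
      using T c xy' unfolding TABI_def by blast
    then show ?thesis unfolding z_def dig_cons[OF phi_less]
      by (cases i) (simp_all add: un_phi dig_0 dig_Suc)
  qed
  \<comment> \<open>The digits of \<open>z\<close> vanish from position \<open>H\<close> on because
    those of \<open>x\<close> and \<open>y\<close> do.\<close>
  show "z < Q" unfolding Q_def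
    by (rule less_of_dig) (use z x y in \<open>simp add: dig_high[of _ H] Q_def\<close>)
  then show "TABI (Suc w) (T(w := z))"
    unfolding TABI_def
  proof (intro allI impI)
    fix c' x' y' assume a: "c' < q" "x' < Q" "y' < Q"
    let ?w = "(c' * Q + x') * Q + y'"
    have eq: "?w = w \<longleftrightarrow> c' = c \<and> x' = x \<and> y' = y"
      unfolding w using a x y by (simp only: append_eq_iff) blast
    show "(?w < Suc w \<longrightarrow> (T(w := z)) ?w < Q \<and> (\<forall>i. dig i ((T(w := z)) ?w) = dig i x' + un c' * dig i y')) \<and>
      (Suc w \<le> ?w \<longrightarrow> (T(w := z)) ?w = 0)"
    proof (cases "?w = w")
      case True
      then show ?thesis using z \<open>z < Q\<close> eq by simp
    next
      case False
      then show ?thesis using T a unfolding TABI_def by (simp add: less_Suc_eq)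
    qed
  qed
qed

text \<open>The argument packs \<open>c\<close> and the last digits of \<open>x\<close> and
  \<open>y\<close> in base \<open>q\<close>, so that one \<open>table_exp\<close> of size
  \<open>q^3\<close> covers all cases.\<close>

definition addf :: "nat \<Rightarrow> nat" where
  "addf z = phi (un (z div q mod q) + un (z div (q * q)) * un (z mod q))"

definition bodyTAB :: com where
  "bodyTAB = Sq (Mov 10 (Bin DIV (Bin DIV (Var 7) (Var 2)) (Var 2))) (Sq (Mov 11 (Bin MOD (Bin DIV (Var 7) (Var 2)) (Var 2)))
     (Sq (Mov 12 (Bin MOD (Var 7) (Var 2)))
     (Put TAB (Var 7) (Bin PLUS (Bin TIMES (Cell TAB (Bin PLUS (Bin TIMES (Bin PLUS (Bin TIMES (Var 10) (Var 2)) 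
          (Bin DIV (Var 11) (Lit q))) (Var 2)) (Bin DIV (Var 12) (Lit q)))) (Lit q))
        (table_exp addf (q * q * q) (Bin PLUS (Bin TIMES (Bin PLUS (Bin TIMES (Var 10) (Lit q)) (Bin MOD (Var 11) (Lit q))) (Lit q))
          (Bin MOD (Var 12) (Lit q))))))))"

lemma triple_TAB:
  assumes A0: "A0 TAB = (\<lambda>_. 0)"
  shows "triple Off L (\<lambda>a. cfg u v a \<and> lo a = l0 \<and> ar a = A0) (Loop (Bin TIMES (Bin TIMES (Lit q) (Var 2)) (Var 2)) bodyTAB)
    (\<lambda>a. cfg u v a \<and> lo a = l0 \<and> isTAB Q (ar a TAB) \<and> frame TAB A0 a)
    ((q * Q * Q + 1) * (kloop (Bin TIMES (Bin TIMES (Lit q) (Var 2)) (Var 2)) bodyTAB * (L * L)))"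
proof (rule triple_Loop[where I = "\<lambda>i a. cfg u v a \<and> lo a = l0 \<and> TABI i (ar a TAB)
       \<and> frame TAB A0 a"])
  fix i a
  assume i: "i < q * Q * Q" and I: "cfg u v a \<and> lo a = l0 \<and> TABI i (ar a TAB)
       \<and> frame TAB A0 a" and v: "vr a 7 = i" "vr a 9 = q * Q * Q"
  define c x y where "c = i div Q div Q" and "x = i div Q mod Q" and "y = i mod Q"
  have cxy: "c < q" "x < Q" "y < Q"
    using i Q_pos by (auto simp: c_def x_def y_def intro!: less_mult_imp_div_less)
  have iw: "i = (c * Q + x) * Q + y" unfolding c_def x_def y_def by simp
  have key: "(c * q + x mod q) * q + y mod q < q * q * q"
    using cxy q_ge by (intro append_less) auto
  have addf: "addf ((c * q + x mod q) * q + y mod q) = phi (un (x mod q) + un c * un (y mod q))"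
    using q_ge by (simp add: addf_def div_mult2_eq div_append mod_append del: div_mult_self3 mod_mult_self3)
  let ?z = "ar a TAB ((c * Q + x div q) * Q + y div q) * q + phi (un (x mod q) + un c * un (y mod q))"
  have z: "?z < Q" "TABI (Suc i) ((ar a TAB)(i := ?z))"
    using TABI_Suc[OF _ iw cxy] I by auto
  have b: "?z < 2 ^ L" "c < 2 ^ L" "x < 2 ^ L" "y < 2 ^ L"
    using z cxy Q_less q_less by (auto intro!: Q_less q_less)
  show "wp L Off bodyTAB (\<lambda>a. (cfg u v a \<and> lo a = l0 \<and> TABI (Suc i) (ar a TAB)
       \<and> frame TAB A0 a) \<and> vr a 7 = i \<and> vr a 9 = q * Q * Q) a"
    unfolding bodyTAB_def using I v b z(2) 
    by (simp add: cfg_def aval_table_exp c_def[symmetric] x_def[symmetric] y_def[symmetric] key addf)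
next
  fix a assume "cfg u v a \<and> lo a = l0 \<and> TABI (q * Q * Q) (ar a TAB) \<and> frame TAB A0 a"
  moreover have "(c * Q + x) * Q + y < q * Q * Q" if "c < q" "x < Q" "y < Q" for c x y
    using that by (intro append_less)
  ultimately show "cfg u v a \<and> lo a = l0 \<and> isTAB Q (ar a TAB) \<and> frame TAB A0 a"
    by (auto simp: TABI_def isTAB_def)
qed (use L A0 qQQ_less in \<open>simp_all add: cfg_def TABI_def\<close>)

end

section \<open>Geometric sums for the lengths of the stages\<close>

text \<open>Total array length in an input transformation. The induction uses the sharper bound
  \<open>d * r^k\<close>, for which \<open>d + 1 \<le> r\<close> closes the step.\<close>

lemma geometric_up:
  fixes d r k :: nat
  assumes "d < r"
  shows "(\<Sum>s<k. d ^ (k - s) * r ^ s) \<le> r * r ^ k"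
proof -
  have "(\<Sum>s<k. d ^ (k - s) * r ^ s) \<le> d * r ^ k"
  proof (induction k)
    case (Suc k)
    have "(\<Sum>s<Suc k. d ^ (Suc k - s) * r ^ s) = (\<Sum>s<k. d ^ (Suc k - s) * r ^ s) + d * r ^ k" by simp
    also have "(\<Sum>s<k. d ^ (Suc k - s) * r ^ s) = d * (\<Sum>s<k. d ^ (k - s) * r ^ s)"
      by (simp add: sum_distrib_left Suc_diff_le mult_ac)
    also have "\<dots> + d * r ^ k \<le> d * (d * r ^ k) + d * r ^ k"
      using Suc by (intro add_mono mult_le_mono) auto
    also have "\<dots> = d * ((d + 1) * r ^ k)" by (simp add: algebra_simps)
    also have "\<dots> \<le> d * (r * r ^ k)" using assms by (intro mult_le_mono) auto
    finally show ?case by simp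
  qed simp
  also have "\<dots> \<le> r * r ^ k" using assms by simp
  finally show ?thesis .
qed

text \<open>The counterpart for the output transformation. The extra term \<open>r * d^k\<close>
  strengthens the induction: it and the new summand together are \<open>r * (d + 1) * d^k\<close>,
  and \<open>d + 1 \<le> r\<close> suffices again.\<close>

lemma geometric_down:
  fixes d r k :: nat
  assumes "d < r"
  shows "(\<Sum>s<k. r ^ (k - s) * d ^ s) \<le> r * r ^ k"
proof -
  have "(\<Sum>s<k. r ^ (k - s) * d ^ s) + r * d ^ k \<le> r * r ^ k"
  proof (induction k)
    case (Suc k)
    have "(\<Sum>s<Suc k. r ^ (Suc k - s) * d ^ s) = (\<Sum>s<k. r ^ (Suc k - s) * d ^ s) + r * d ^ k" by simp
    also have "(\<Sum>s<k. r ^ (Suc k - s) * d ^ s) = r * (\<Sum>s<k. r ^ (k - s) * d ^ s)"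
      by (simp add: sum_distrib_left Suc_diff_le mult_ac)
    finally have "(\<Sum>s<Suc k. r ^ (Suc k - s) * d ^ s) + r * d ^ Suc k
      = r * (\<Sum>s<k. r ^ (k - s) * d ^ s) + r * ((d + 1) * d ^ k)" by (simp add: algebra_simps)
    also have "\<dots> \<le> r * (\<Sum>s<k. r ^ (k - s) * d ^ s) + r * (r * d ^ k)"
      using assms by (intro add_mono mult_le_mono) auto
    also have "\<dots> = r * ((\<Sum>s<k. r ^ (k - s) * d ^ s) + r * d ^ k)" by (simp add: algebra_simps)
    also have "\<dots> \<le> r * (r * r ^ k)" using Suc by (intro mult_le_mono) auto
    finally show ?case by simp
  qed simp
  then show ?thesis by simp
qed

lemma part_empty: "M \<le> y \<Longrightarrow> part m (M * m) y \<tau> = 0"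
proof -
  assume "M \<le> y"
  then have "M * m \<le> y * m" by (rule mult_le_mono1)
  then have "\<not> y * m + p < M * m" for p by linarith
  then show ?thesis unfolding part_def by simp
qed

context sized_scheme
begin

lemma eq_0_of_dig: "(\<And>i. dig i x = 0) \<Longrightarrow> x = 0"
  using less_of_dig[of 0 x] by simp

section \<open>The table of block products\<close>

definition mulf :: "nat \<Rightarrow> nat" where
  "mulf z = phi (un (z div q) * un (z mod q))"

text \<open>The counter packs a pair of words (\<open>Var 10\<close>) and three entry positions
  (\<open>Var 12\<close> to \<open>Var 14\<close>). \<open>Var 15\<close> is the code of the product
  of two entries if the positions fit together, and 0 otherwise; a unit word times this scalar is
  added by a lookup in \<open>TAB\<close>. The \<open>H^3\<close> steps for each pair of words cost
  only powers of \<open>log n\<close>.\<close>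

definition bodyMUL :: com where
  "bodyMUL = Sq (Mov 10 (Bin DIV (Var 7) (Bin TIMES (Var 1) (Bin TIMES (Var 1) (Var 1)))))
    (Sq (Mov 11 (Bin MOD (Var 7) (Bin TIMES (Var 1) (Bin TIMES (Var 1) (Var 1)))))
    (Sq (Mov 12 (Bin DIV (Var 11) (Bin TIMES (Var 1) (Var 1))))
    (Sq (Mov 13 (Bin MOD (Bin DIV (Var 11) (Var 1)) (Var 1)))
    (Sq (Mov 14 (Bin MOD (Var 11) (Var 1)))
    (Sq (Mov 15 (Bin TIMES (Bin TIMES (EQ (Cell RHO (Var 12)) (Cell RHO (Var 14))) (Bin TIMES (EQ (Cell KAP (Var 12)) (Cell RHO (Var 13)))
        (EQ (Cell KAP (Var 13)) (Cell KAP (Var 14)))))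
        (table_exp mulf (q * q) (Bin PLUS (Bin TIMES (Bin MOD (Bin DIV (Bin DIV (Var 10) (Var 2)) (Cell POW (Var 12))) (Lit q)) (Lit q))
           (Bin MOD (Bin DIV (Bin MOD (Var 10) (Var 2)) (Cell POW (Var 13))) (Lit q))))))
    (Put MUL (Var 10) (Cell TAB (Bin PLUS (Bin TIMES (Bin PLUS (Bin TIMES (Var 15) (Var 2)) (Cell MUL (Var 10))) (Var 2))
        (Bin TIMES (Lit (phi 1)) (Cell POW (Var 14)))))))))))"

definition isMUL :: "(nat \<Rightarrow> nat) \<Rightarrow> bool" where
  "isMUL f \<longleftrightarrow> (\<forall>x<Q. \<forall>y<Q. f (x * Q + y) < Q \<and> (\<forall>i<H. dig i (f (x * Q + y)) =
     (\<Sum>e1<H. \<Sum>e2<H. if zmul t e1 e2 i then dig e1 x * dig e2 y else 0)))"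

definition tauMUL :: "nat \<Rightarrow> nat \<Rightarrow> 'a" where
  "tauMUL g i = (let w = g div (H * (H * H)); p = g mod (H * (H * H));
     e1 = p div (H * H); e2 = p div H mod H; e3 = p mod H in
     if zmul t e1 e2 e3 \<and> i = e3 then dig e1 (w div Q) * dig e2 (w mod Q) else 0)"

lemma isMUL_of_accs:
  assumes "accs Q 0 (H * (H * H)) tauMUL (Q * Q * (H * (H * H))) f0 f"
  shows "isMUL f"
  unfolding isMUL_def
proof (intro allI impI conjI)
  fix x y assume xy: "x < Q" "y < Q"
  show "f (x * Q + y) < Q" using assms by (simp add: accs_def)
  fix i assume i: "i < H"
  have "dig i (f (x * Q + y)) = part (H * (H * H)) (Q * Q * (H * (H * H))) (x * Q + y) (\<lambda>g. tauMUL g i)"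
    using assms by (simp add: accs_def)
  also have "\<dots> = (\<Sum>p<H * (H * H). tauMUL ((x * Q + y) * (H * (H * H)) + p) i)"
    by (rule part_full[OF append_less[OF xy]])
  also have "\<dots> = (\<Sum>e1<H. \<Sum>e2<H. \<Sum>e3<H. tauMUL ((x * Q + y) * (H * (H * H)) + (e1 * (H * H) + (e2 * H + e3))) i)"
    by (subst sum_nested_digits, subst sum_nested_digits, rule refl)
  also have "\<dots> = (\<Sum>e1<H. \<Sum>e2<H. \<Sum>e3<H. if e3 = i then (if zmul t e1 e2 i then dig e1 x * dig e2 y else 0) else 0)"
  proof (intro sum.cong refl)
    fix e1 e2 e3 assume "e1 \<in> {..<H}" "e2 \<in> {..<H}" "e3 \<in> {..<H}"
    then have e: "e1 < H" "e2 < H" "e3 < H" by auto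
    let ?p = "e1 * (H * H) + (e2 * H + e3)"
    have v: "e2 * H + e3 < H * H" using e by (intro append_less)
    have p: "?p < H * (H * H)" using e v by (intro append_less)
    have p': "?p = (e1 * H + e2) * H + e3" by (simp add: algebra_simps)
    have 1: "?p div (H * H) = e1" by (rule div_append[OF v])
    have 2: "?p div H = e1 * H + e2" "?p mod H = e3"
      unfolding p' by (rule div_append[OF e(3)], rule mod_append[OF e(3)])
    have 3: "((x * Q + y) * (H * (H * H)) + ?p) div (H * (H * H)) = x * Q + y"
      "((x * Q + y) * (H * (H * H)) + ?p) mod (H * (H * H)) = ?p"
      by (rule div_append[OF p], rule mod_append[OF p])
    show "tauMUL ((x * Q + y) * (H * (H * H)) + ?p) i =
       (if e3 = i then (if zmul t e1 e2 i then dig e1 x * dig e2 y else 0) else 0)"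
      unfolding tauMUL_def Let_def 3 1 2 mod_append[OF e(2)] div_append[OF xy(2)] mod_append[OF xy(2)] by auto
  qed
  also have "\<dots> = (\<Sum>e1<H. \<Sum>e2<H. if zmul t e1 e2 i then dig e1 x * dig e2 y else 0)"
    using i by simp
  finally show "dig i (f (x * Q + y)) = (\<Sum>e1<H. \<Sum>e2<H. if zmul t e1 e2 i then dig e1 x * dig e2 y else 0)" .
qed

abbreviation "eMUL \<equiv> Bin TIMES (Bin TIMES (Var 2) (Var 2)) (Bin TIMES (Var 1) (Bin TIMES (Var 1) (Var 1)))"

lemma triple_MUL:
  assumes A0: "A0 MUL = (\<lambda>_. 0)" "A0 RHO = initseg (zrow t) (S * H)" "A0 KAP = initseg (zcol t) (S * H)"
    "A0 POW = initseg (\<lambda>e. q ^ e) (Suc H)" "isTAB Q (A0 TAB)"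
  shows "triple Off L (\<lambda>a. cfg u v a \<and> lo a = l0 \<and> ar a = A0) (Loop eMUL bodyMUL)
    (\<lambda>a. cfg u v a \<and> lo a = l0 \<and> isMUL (ar a MUL) \<and> frame MUL A0 a)
    ((Q * Q * (H * (H * H)) + 1) * (kloop eMUL bodyMUL * (L * L)))"
proof -
  let ?m = "H * (H * H)"
  define I where "I g a \<longleftrightarrow> cfg u v a \<and> lo a = l0 \<and> accs Q 0 ?m tauMUL g (\<lambda>_. 0) (ar a MUL)
       \<and> frame MUL A0 a" for g a
  show ?thesis
  proof (rule triple_Loop[where I = I])
    fix g a
    assume g: "g < Q * Q * ?m" and I: "I g a" and v: "vr a 7 = g" "vr a 9 = Q * Q * ?m"
    define w p where "w = g div ?m" and "p = g mod ?m"
    define e1 e2 e3 where "e1 = p div (H * H)" and "e2 = p div H mod H" and "e3 = p mod H"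
    define x y where "x = w div Q" and "y = w mod Q"
    have m: "0 < ?m" using H_pos by simp
    have w: "w < Q * Q" unfolding w_def using g by (intro less_mult_imp_div_less)
    have p: "p < ?m" unfolding p_def using m by simp
    have e: "e1 < H" "e2 < H" "e3 < H"
      using p H_pos unfolding e1_def e2_def e3_def by (auto intro!: less_mult_imp_div_less)
    have eS: "e < S * H" if "e < H" for e using that S_pos by (metis less_le_trans mult_le_mono1 nat_mult_1 Suc_leI One_nat_def)
    have xy: "x < Q" "y < Q" using w Q_pos unfolding x_def y_def by (auto intro!: less_mult_imp_div_less)
    have Aa: "ar a RHO = initseg (zrow t) (S * H)" "ar a KAP = initseg (zcol t) (S * H)"
      "ar a POW = initseg (\<lambda>e. q ^ e) (Suc H)" "isTAB Q (ar a TAB)" using I A0 by (simp_all add: I_def)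
    have key: "x div q ^ e1 mod q * q + y div q ^ e2 mod q < q * q"
      using q_ge by (intro append_less) auto
    have mulf: "mulf (x div q ^ e1 mod q * q + y div q ^ e2 mod q) = phi (dig e1 x * dig e2 y)"
      using q_ge by (simp add: mulf_def dig_def div_append mod_append del: div_mult_self3 mod_mult_self3)
    define c where "c = (if zmul t e1 e2 e3 then phi (dig e1 x * dig e2 y) else 0)"
    have c: "c < q" using phi_less q_ge by (simp add: c_def)
    \<comment> \<open>The code of the one of the field need not be the number 1, hence
      \<open>phi 1\<close>.\<close>
    let ?u = "phi 1 * q ^ e3"
    have u: "?u < Q" unfolding Q_def by (rule unit_less[OF phi_less e(3)])
    have acc: "accs Q 0 ?m tauMUL g (\<lambda>_. 0) (ar a MUL)" using I by (simp add: I_def)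
    have tau: "un c * dig i ?u = tauMUL g i" for i
      unfolding tauMUL_def Let_def w_def[symmetric] p_def[symmetric] e1_def[symmetric] e2_def[symmetric]
        e3_def[symmetric] x_def[symmetric] y_def[symmetric]
      by (simp add: c_def un_phi dig_unit[OF phi_less])
    have step: "accs Q 0 ?m tauMUL (Suc g) (\<lambda>_. 0)
       ((ar a MUL)(w := ar a TAB ((c * Q + ar a MUL w) * Q + ?u)))"
      using accs_Suc[OF acc Aa(4) c u m tau] by (simp add: w_def)
    have val: "ar a TAB ((c * Q + ar a MUL w) * Q + ?u) < 2 ^ L"
      using accs_val_less[OF acc Aa(4) c u, of w] Q_less by simp
    have b: "w < 2 ^ L" "p < 2 ^ L" "e1 < 2 ^ L" "e2 < 2 ^ L" "e3 < 2 ^ L" "c < 2 ^ L"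
    proof -
      have "Q * Q \<le> q * Q * Q" using q_ge by simp
      then show "w < 2 ^ L" using w qQQ_less by linarith
      have "?m \<le> Q * Q * ?m" using Q_pos by simp
      then show "p < 2 ^ L" using p MUL_less by linarith
      show "e1 < 2 ^ L" "e2 < 2 ^ L" "e3 < 2 ^ L" using e H_less_Q by (auto intro!: Q_less)
      show "c < 2 ^ L" using c by (auto intro!: q_less)
    qed
    have rdA: "A0 RHO e = zrow t e" "A0 KAP e = zcol t e" "A0 POW e = q ^ e" if "e < H" for e
      unfolding A0 using that eS[OF that] by (simp_all add: initseg_less)
    have AT: "A0 TAB = ar a TAB" using I by (simp add: I_def)
    show "wp L Off bodyMUL (\<lambda>a. I (Suc g) a \<and> vr a 7 = g \<and> vr a 9 = Q * Q * ?m) a"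
    proof (cases "zmul t e1 e2 e3")
      case True
      then have c1: "c = phi (dig e1 x * dig e2 y)" by (simp add: c_def)
      show ?thesis
        unfolding bodyMUL_def using I v b[unfolded c1] step[unfolded c1] val[unfolded c1] True[unfolded zmul_def]
        by (simp add: I_def cfg_def aval_table_exp aval_EQ w_def[symmetric] p_def[symmetric] e1_def[symmetric]
           e2_def[symmetric] e3_def[symmetric] x_def[symmetric] y_def[symmetric] rdA e key mulf AT[symmetric])
    next
      case False
      then have c0: "c = 0" by (simp add: c_def)
      show ?thesis
        unfolding bodyMUL_def using I v b step[unfolded c0] val[unfolded c0] False[unfolded zmul_def]
        by (auto simp add: I_def cfg_def aval_table_exp aval_EQ w_def[symmetric] p_def[symmetric] e1_def[symmetric]
           e2_def[symmetric] e3_def[symmetric] x_def[symmetric] y_def[symmetric] rdA e key mulf AT[symmetric])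
    qed
  next
    fix a assume "I (Q * Q * ?m) a"
    then show "cfg u v a \<and> lo a = l0 \<and> isMUL (ar a MUL) \<and> frame MUL A0 a"
      using isMUL_of_accs[of "\<lambda>_. 0" "ar a MUL"] by (simp add: I_def)
  qed (use L A0 MUL_less Q_pos in \<open>simp_all add: I_def cfg_def accs_0\<close>)
qed

section \<open>Packing and transforming\<close>

text \<open>Positions outside the given matrix supply \<open>enc 0\<close>, which \<open>swp\<close>
  turns into 0: the matrix is padded with zeros. An entry becomes a digit by adding its multiple of
  a unit word.\<close>

definition bodyPack :: "arr \<Rightarrow> aexp \<Rightarrow> com" where
  "bodyPack X e = Sq (Mov 13 (Cell RHO (Var 7))) (Sq (Mov 14 (Cell KAP (Var 7)))
    (Sq (Cnd (Bin TIMES (Bin LESS (Var 13) (Var 0)) (Bin LESS (Var 14) (Var 0)))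
       (Get 15 (Bin PLUS e (Bin PLUS (Bin TIMES (Var 13) (Var 0)) (Var 14)))) (Mov 15 (Lit (enc 0))))
    (Put X (Bin DIV (Var 7) (Var 1)) (Cell TAB (Bin PLUS (Bin TIMES (Bin PLUS (Bin TIMES (table_exp swp q (Var 15)) (Var 2))
        (Cell X (Bin DIV (Var 7) (Var 1)))) (Var 2)) (Bin TIMES (Lit (phi 1)) (Cell POW (Bin MOD (Var 7) (Var 1)))))))))"

definition packed :: "(nat \<Rightarrow> nat \<Rightarrow> 'a) \<Rightarrow> (nat \<Rightarrow> nat) \<Rightarrow> bool" where
  "packed P f \<longleftrightarrow> (\<forall>y<S. f y < Q \<and> (\<forall>i<H. dig i (f y) = P (zrow t (y * H + i)) (zcol t (y * H + i))))
     \<and> (\<forall>y\<ge>S. f y = 0)"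

lemma triple_Pack:
  assumes A0: "A0 X = (\<lambda>_. 0)" "A0 RHO = initseg (zrow t) (S * H)" "A0 KAP = initseg (zcol t) (S * H)"
    "A0 POW = initseg (\<lambda>e. q ^ e) (Suc H)" "isTAB Q (A0 TAB)" and X: "X \<in> {XA, XB}"
    and e: "\<And>a x z. x \<noteq> 0 \<Longrightarrow> aval e (a\<lparr>vr := (vr a)(x := z)\<rparr>) = aval e a"
       "\<And>a. cfg u v a \<Longrightarrow> aval e a = o0" and o0: "o0 + n * n \<le> Off"
    and P: "\<And>i j. i < n \<Longrightarrow> j < n \<Longrightarrow> l0 (o0 + (i * n + j)) = enc (P i j)"
       "\<And>i j. n \<le> i \<or> n \<le> j \<Longrightarrow> P i j = 0"
  shows "triple Off L (\<lambda>a. cfg u v a \<and> lo a = l0 \<and> ar a = A0) (Loop eSH (bodyPack X e))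
    (\<lambda>a. cfg u v a \<and> lo a = l0 \<and> packed P (ar a X) \<and> frame X A0 a)
    ((S * H + 1) * (kloop eSH (bodyPack X e) * (L * L)))"
proof -
  define tau where "tau g i = (if i = g mod H then P (zrow t g) (zcol t g) else 0)" for g i
  define I where "I g a \<longleftrightarrow> cfg u v a \<and> lo a = l0 \<and> accs Q 0 H tau g (\<lambda>_. 0) (ar a X)
       \<and> frame X A0 a" for g a
  have Xn: "RHO \<noteq> X" "KAP \<noteq> X" "POW \<noteq> X" "TAB \<noteq> X" using X by auto
  show ?thesis
  proof (rule triple_Loop[where I = I])
    fix g a
    assume g: "g < S * H" and I: "I g a" and v: "vr a 7 = g" "vr a 9 = S * H"
    let ?e = "g mod H" and ?i = "zrow t g" and ?j = "zcol t g"
    have Aa: "ar a RHO = initseg (zrow t) (S * H)" "ar a KAP = initseg (zcol t) (S * H)"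
      "ar a POW = initseg (\<lambda>e. q ^ e) (Suc H)" "isTAB Q (ar a TAB)" using I A0 Xn by (simp_all add: I_def)
    have e3: "?e < H" using H_pos by simp
    have rd: "A0 RHO g = ?i" "A0 KAP g = ?j" "A0 POW ?e = q ^ ?e"
      unfolding A0 using g e3 by (simp_all add: initseg_less)
    have AT: "A0 TAB = ar a TAB" using I Xn by (simp add: I_def)
    let ?u = "phi 1 * q ^ ?e" and ?c = "phi (P ?i ?j)"
    have u: "?u < Q" unfolding Q_def by (rule unit_less[OF phi_less e3])
    have acc: "accs Q 0 H tau g (\<lambda>_. 0) (ar a X)" using I by (simp add: I_def)
    have tau: "un ?c * dig i ?u = tau g i" for i
      by (simp add: tau_def un_phi dig_unit[OF phi_less])
    have step: "accs Q 0 H tau (Suc g) (\<lambda>_. 0)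
       ((ar a X)(g div H := ar a TAB ((?c * Q + ar a X (g div H)) * Q + ?u)))"
      using accs_Suc[OF acc Aa(4) phi_less u H_pos tau] by simp
    have val: "ar a TAB ((?c * Q + ar a X (g div H)) * Q + ?u) < 2 ^ L"
      using accs_val_less[OF acc Aa(4) phi_less u, of "P ?i ?j" "g div H"] Q_less by simp
    have b: "?i < 2 ^ L" "?j < 2 ^ L" "enc 0 < 2 ^ L"
      using zrow_le[OF t, of g] zcol_le[OF t, of g] g SH_less enc_less[of 0] q_less[of "enc 0"] by linarith+
    have ge: "o0 + (?i * n + ?j) < Off" if "?i < n" "?j < n"
      using append_less[OF that] o0 by simp
    have sw: "swp (enc z) = phi z" for z by (simp add: phi_def)
    show "wp L Off (bodyPack X e) (\<lambda>a. I (Suc g) a \<and> vr a 7 = g \<and> vr a 9 = S * H) a"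
    proof (cases "?i < n \<and> ?j < n")
      case True
      then show ?thesis
        unfolding bodyPack_def using I v b step val ge X Xn
        by (simp add: I_def cfg_def aval_table_exp rd e P enc_less sw AT[symmetric])
    next
      case False
      then have P0: "P ?i ?j = 0" using P(2) by (auto simp: not_less)
      have "swp (enc 0) = 0" unfolding sw by simp
      moreover have "?i < n \<Longrightarrow> \<not> ?j < n" using False by simp
      ultimately show ?thesis
        unfolding bodyPack_def using I v b step[unfolded P0 phi_0] val[unfolded P0 phi_0] X Xn
        by (simp add: I_def cfg_def aval_table_exp rd e enc_less AT[symmetric])
    qed
  next
    fix a assume I: "I (S * H) a"
    let ?f = "ar a X"
    have acc: "?f y < Q" "dig i (?f y) = part H (S * H) y (\<lambda>g. tau g i)" for y i
      using I by (auto simp: I_def accs_def)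
    have "dig i (?f y) = P (zrow t (y * H + i)) (zcol t (y * H + i))" if "y < S" "i < H" for y i
    proof -
      have "dig i (?f y) = (\<Sum>p<H. tau (y * H + p) i)"
        unfolding acc by (rule part_full[OF that(1)])
      also have "\<dots> = (\<Sum>p<H. if p = i then P (zrow t (y * H + p)) (zcol t (y * H + p)) else 0)"
        by (intro sum.cong refl) (simp add: tau_def mod_append)
      also have "\<dots> = P (zrow t (y * H + i)) (zcol t (y * H + i))" using that by simp
      finally show ?thesis .
    qed
    moreover have "?f y = 0" if "S \<le> y" for y
      by (rule eq_0_of_dig) (simp add: acc part_empty[OF that])
    ultimately show "cfg u v a \<and> lo a = l0 \<and> packed P (ar a X) \<and> frame X A0 a"
      using I acc by (simp add: I_def packed_def)
  qed (use L A0 SH_less Q_pos in \<open>simp_all add: I_def cfg_def accs_0\<close>)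
qed

end

context sized_scheme
begin

section \<open>Kronecker powers applied in stages\<close>

text \<open>\<open>Var 10\<close> is the start of the source, \<open>Var 11\<close> its length and
  \<open>Var 12\<close> this length divided by \<open>b\<close>, called \<open>E\<close> below. If
  \<open>p\<close> is the counter modulo \<open>b\<close> and \<open>y\<close> the counter divided
  by \<open>b\<close>, then \<open>M p (y mod c)\<close> times source cell
  \<open>p * E + y div c\<close> is added to target cell \<open>y\<close>. Every product, quotient
  and remainder has an operand of constant size, so the step is linear.\<close>

definition bodyTr :: "arr \<Rightarrow> nat \<Rightarrow> nat \<Rightarrow> (nat \<Rightarrow> nat \<Rightarrow> 'a) \<Rightarrow> com" where
  "bodyTr X b c M = (let ix = Bin PLUS (Bin PLUS (Var 10) (Var 11)) (Bin DIV (Var 7) (Lit b)) in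
     Put X ix (Cell TAB (Bin PLUS
       (Cell SH (Bin PLUS (Bin TIMES (table_exp (\<lambda>z. phi (M (z mod b) (z div b))) (b * c) (Bin MOD (Var 7) (Lit (b * c)))) (Var 2))
         (Cell X ix)))
       (Cell X (Bin PLUS (Bin PLUS (Var 10) (Bin TIMES (Bin MOD (Var 7) (Lit b)) (Var 12))) (Bin DIV (Var 7) (Lit (b * c))))))))"

definition stage :: "arr \<Rightarrow> nat \<Rightarrow> nat \<Rightarrow> (nat \<Rightarrow> nat \<Rightarrow> 'a) \<Rightarrow> ram_program" where
  "stage X b c M = Seq (to_prog (Mov 12 (Bin DIV (Var 11) (Lit b))))
     (Seq (Loop (Bin TIMES (Var 11) (Lit c)) (bodyTr X b c M))
       (to_prog (Sq (Mov 10 (Bin PLUS (Var 10) (Var 11))) (Mov 11 (Bin TIMES (Var 12) (Lit c))))))"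

definition kstage :: "arr \<Rightarrow> nat \<Rightarrow> nat \<Rightarrow> (nat \<Rightarrow> nat \<Rightarrow> 'a) \<Rightarrow> nat" where
  "kstage X b c M = com_coeff (Mov 12 (Bin DIV (Var 11) (Lit b))) + kloop (Bin TIMES (Var 11) (Lit c)) (bodyTr X b c M)
     + com_coeff (Sq (Mov 10 (Bin PLUS (Var 10) (Var 11))) (Mov 11 (Bin TIMES (Var 12) (Lit c))))"

text \<open>The state after \<open>s\<close> stages: the \<open>s\<close> leading input digits have
  been summed out, and the index \<open>y\<close> keeps the other \<open>k - s\<close> input digits
  in front and the \<open>s\<close> output digits behind them.\<close>

definition transf :: "nat \<Rightarrow> nat \<Rightarrow> (nat \<Rightarrow> nat \<Rightarrow> 'a) \<Rightarrow> (nat \<Rightarrow> nat \<Rightarrow> 'a) \<Rightarrow> nat \<Rightarrow> nat \<Rightarrow> nat \<Rightarrow> 'a" where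
  "transf b c M w s y i =
     (\<Sum>x<b ^ s. tpow M b c s x (y mod c ^ s) * w (x * b ^ (k - s) + y div c ^ s) i)"

lemma transf_0: "transf b c M w 0 y i = w y i"
  by (simp add: transf_def)

text \<open>\<open>p\<close> runs over the input digit that now leads, whose weight is
  \<open>E\<close>, and \<open>y mod c\<close> is the output digit appended in its place. After
  \<open>k\<close> stages the output digits stand in the order of the input digits.\<close>

lemma transf_Suc:
  assumes s: "s < k" and b: "0 < b" and c: "0 < c" and E: "E = b ^ (k - Suc s) * c ^ s"
  shows "(\<Sum>p<b. M p (y mod c) * transf b c M w s (p * E + y div c) i) = transf b c M w (Suc s) y i"
proof -
  let ?BB = "b ^ (k - Suc s)"
  have bits_const: "b ^ (k - s) = b * ?BB" using s by (simp add: Suc_diff_Suc flip: power_Suc)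
  have 1: "(p * E + y div c) mod c ^ s = y div c mod c ^ s" for p
    unfolding E mult.assoc[symmetric] by simp
  have 2: "(p * E + y div c) div c ^ s = p * ?BB + y div c div c ^ s" for p
    unfolding E mult.assoc[symmetric] using c by simp
  have 3: "y mod c ^ Suc s mod c = y mod c" "y mod c ^ Suc s div c = y div c mod c ^ s"
    "y div c ^ Suc s = y div c div c ^ s"
    by (simp_all add: mod_mult2_eq div_mult2_eq)
       (metis add.commute c div_mult_self2 less_not_refl2 mod_div_trivial plus_nat.add_0)+
  have "transf b c M w (Suc s) y i = (\<Sum>x<b ^ s * b. tpow M b c (Suc s) x (y mod c ^ Suc s) *
      w (x * ?BB + y div c ^ Suc s) i)"
    by (simp add: transf_def mult.commute)
  also have "\<dots> = (\<Sum>x<b ^ s. \<Sum>p<b. M p (y mod c) * (tpow M b c s x (y div c mod c ^ s) *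
      w (x * b ^ (k - s) + (p * ?BB + y div c div c ^ s)) i))"
  proof (subst sum_nested_digits, intro sum.cong refl)
    fix x p assume "p \<in> {..<b}"
    then have p: "p < b" by simp
    have "(x * b + p) * ?BB + y div c ^ Suc s = x * b ^ (k - s) + (p * ?BB + y div c div c ^ s)"
      unfolding 3 bits_const by (simp add: algebra_simps)
    then show "tpow M b c (Suc s) (x * b + p) (y mod c ^ Suc s) * w ((x * b + p) * ?BB + y div c ^ Suc s) i
      = M p (y mod c) * (tpow M b c s x (y div c mod c ^ s) *
        w (x * b ^ (k - s) + (p * ?BB + y div c div c ^ s)) i)"
      unfolding tpow.simps 3 div_append[OF p] mod_append[OF p] by (simp add: mult.assoc add.assoc)
  qed
  also have "\<dots> = (\<Sum>p<b. \<Sum>x<b ^ s. M p (y mod c) * (tpow M b c s x (y div c mod c ^ s) *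
      w (x * b ^ (k - s) + (p * ?BB + y div c div c ^ s)) i))"
    by (rule sum.swap)
  also have "\<dots> = (\<Sum>p<b. M p (y mod c) * transf b c M w s (p * E + y div c) i)"
    by (simp add: transf_def 1 2 sum_distrib_left)
  finally show ?thesis ..
qed

text \<open>
  The result of stage \<open>s\<close> lies at the cells from \<open>o0\<close> on; the next stage writes behind it, into
  cells that are still 0.
\<close>

definition content :: "nat \<Rightarrow> nat \<Rightarrow> (nat \<Rightarrow> nat \<Rightarrow> 'a) \<Rightarrow> (nat \<Rightarrow> nat \<Rightarrow> 'a) \<Rightarrow> nat \<Rightarrow> nat \<Rightarrow> (nat \<Rightarrow> nat) \<Rightarrow> bool" where
  "content b c M w s o0 f \<longleftrightarrow> (\<forall>y<b ^ (k - s) * c ^ s. f (o0 + y) < Q \<and> (\<forall>i. dig i (f (o0 + y)) = transf b c M w s y i))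
     \<and> (\<forall>y\<ge>o0 + b ^ (k - s) * c ^ s. f y = 0)"

abbreviation "staged u v l0 A0 X b c M w s a \<equiv> cfg u v a \<and> lo a = l0 \<and> frame X A0 a \<and>
  vr a 11 = b ^ (k - s) * c ^ s \<and> vr a 10 \<le> s * R \<and> content b c M w s (vr a 10) (ar a X)"

lemma triple_stage:
  assumes A0: "A0 SH = initseg (\<lambda>z. z * Q) (q * Q)" "isTAB Q (A0 TAB)"
    and X: "X \<in> {XA, XB, XC}" and s: "s < k" and b: "0 < b" and c: "0 < c" "c \<le> r"
    and R: "b ^ (k - s) * c ^ s \<le> R" "b ^ (k - Suc s) * c ^ Suc s \<le> R"
  shows "triple Off L (\<lambda>a. vr a 8 = s \<and> staged u v l0 A0 X b c M w s a)
     (stage X b c M)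
     (\<lambda>a. vr a 8 = s \<and> staged u v l0 A0 X b c M w (Suc s) a)
     ((b ^ (k - s) * c ^ s * c + 1) * (kstage X b c M * L))"
proof -
  define E where "E = b ^ (k - Suc s) * c ^ s"
  define D where "D = b ^ (k - s) * c ^ s"
  have D: "D = b * E" using s unfolding D_def E_def by (simp add: Suc_diff_Suc flip: power_Suc)
  have DE: "D * c = (E * c) * b" by (simp add: D)
  have Ec: "b ^ (k - Suc s) * c ^ Suc s = E * c" by (simp add: E_def)
  have Dc: "D * c < 2 ^ L"
  proof -
    have "D * c \<le> R * r" using R c by (intro mult_le_mono) (auto simp: D_def)
    also have "\<dots> \<le> (k + 1) * R * r" by simp
    finally show ?thesis using kRr_less by linarith
  qed
  have sR: "Suc s * R < 2 ^ L"
  proof -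
    have "Suc s * R \<le> (k + 1) * R * 1" using s by (simp only: mult_1_right) (intro mult_le_mono, auto)
    also have "\<dots> \<le> (k + 1) * R * r" using r by (intro mult_le_mono) auto
    finally show ?thesis using kRr_less by linarith
  qed
  \<comment> \<open>\<open>x\<close> records the contents of the array and the start of the source
    at the beginning of the stage; the loop invariant refers to both.\<close>
  define J where "J x = (\<lambda>a. cfg u v a \<and> lo a = l0 \<and> frame X A0 a \<and> vr a 8 = s \<and>
     vr a 11 = D \<and> vr a 12 = E \<and> vr a 10 = snd x \<and> snd x \<le> s * R \<and> content b c M w s (snd x) (fst x))"
    for x :: "(nat \<Rightarrow> nat) \<times> nat"
  define tau where "tau x g i = M (g mod b) (g div b mod c) * dig i (fst x (snd x + (g mod b * E + g div (b * c))))"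
    for x :: "(nat \<Rightarrow> nat) \<times> nat" and g i
  define I where "I x g a \<longleftrightarrow> J x a \<and> accs Q (snd x + D) b (tau x) g (fst x) (ar a X)" for x g a
  let ?k1 = "com_coeff (Mov 12 (Bin DIV (Var 11) (Lit b)))" and ?k2 = "kloop (Bin TIMES (Var 11) (Lit c)) (bodyTr X b c M)"
    and ?k3 = "com_coeff (Sq (Mov 10 (Bin PLUS (Var 10) (Var 11))) (Mov 11 (Bin TIMES (Var 12) (Lit c))))"
  have Xn: "SH \<noteq> X" "TAB \<noteq> X" using X by auto
  have lc: "linear_com (bodyTr X b c M)"
    using b c by (simp add: bodyTr_def Let_def linear_table_exp bounded_table_exp)
  have tau_dig: "dig i (g (o1 + (p * E + y div c))) = transf b c M w s (p * E + y div c) i"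
    if "content b c M w s o1 g" "y < E * c" "p < b" for g o1 y p i
  proof -
    have "p * E + y div c < b * E" using that by (intro append_less less_mult_imp_div_less)
    then have "p * E + y div c < b ^ (k - s) * c ^ s" using D unfolding D_def by simp
    then show ?thesis using that(1) unfolding content_def by blast
  qed
  have loop: "triple Off L (\<lambda>a. J x a \<and> ar a X = fst x) (Loop (Bin TIMES (Var 11) (Lit c)) (bodyTr X b c M))
    (I x (E * c * b)) ((E * c * b + 1) * (?k2 * L))" for x
  proof (rule triple_Loop[where I = "I x"])
    fix g a assume g: "g < E * c * b" and I: "I x g a" and vv: "vr a 7 = g" "vr a 9 = E * c * b"
    obtain f0 o1 where x: "x = (f0, o1)" by (cases x)
    let ?p = "g mod b" and ?l = "g div b mod c" and ?z = "g mod (b * c)"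
    have acc: "accs Q (o1 + D) b (tau x) g f0 (ar a X)" using I by (simp add: I_def x)
    have TB: "isTAB Q (ar a TAB)" using I A0(2) Xn by (simp add: I_def J_def)
    have z: "?z mod b = ?p" "?z div b = ?l"
      using b c by (simp_all add: mod_mult2_eq div_append)
    have zl: "?z < b * c" using b c by (intro mod_less_divisor) simp
    have gl: "g div (b * c) < E" using g by (intro less_mult_imp_div_less) (simp add: mult_ac)
    have src: "?p * E + g div (b * c) < D" unfolding D using b gl by (intro append_less) auto
    let ?w = "f0 (o1 + (?p * E + g div (b * c)))"
    have w: "?w < Q" using I src unfolding I_def J_def x content_def D_def by simp
    have wa: "ar a X (o1 + (?p * E + g div (b * c))) = ?w"
      using acc src unfolding accs_def by simp
    let ?c = "phi (M ?p ?l)" and ?t = "o1 + D + g div b"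
    have tau: "un ?c * dig i ?w = tau x g i" for i by (simp add: tau_def x un_phi)
    have step: "accs Q (o1 + D) b (tau x) (Suc g) f0
        ((ar a X)(?t := ar a TAB ((?c * Q + ar a X ?t) * Q + ?w)))"
      by (rule accs_Suc[OF acc TB phi_less w b tau])
    have val: "ar a TAB ((?c * Q + ar a X ?t) * Q + ?w) < 2 ^ L"
      using accs_val_less[OF acc TB phi_less w, of "M ?p ?l" "g div b"] by (intro Q_less less_imp_le)
    have "ar a X ?t < Q" using acc unfolding accs_def by simp
    \<comment> \<open>The argument of \<open>SH\<close> stays within the part of that array that has
      been filled.\<close>
    then have "?c * Q + ar a X ?t < q * Q" by (intro append_less phi_less)
    then have SHv: "A0 SH (?c * Q + ar a X ?t) = (?c * Q + ar a X ?t) * Q"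
      unfolding A0 by (rule initseg_less)
    have AT: "A0 TAB = ar a TAB" using I Xn by (simp add: I_def J_def)
    show "wp L Off (bodyTr X b c M) (\<lambda>a. I x (Suc g) a \<and> vr a 7 = g \<and> vr a 9 = E * c * b) a"
      unfolding bodyTr_def Let_def using I vv step val X Xn
      by (simp add: I_def J_def x cfg_def aval_table_exp z zl wa SHv[unfolded add.assoc] AT[symmetric] add.assoc)
  next
    show "E * c * b < 2 ^ L" using Dc DE by simp
  next
    fix a assume "J x a \<and> ar a X = fst x"
    then show "I x 0 a \<and> aval (Bin TIMES (Var 11) (Lit c)) a = E * c * b"
      using Q_pos DE by (auto simp: I_def J_def content_def D_def[symmetric] intro!: accs_0)
  qed (use L lc in \<open>simp_all add: I_def J_def cfg_def\<close>)
  have post: "content b c M w (Suc s) (snd x + D) (ar a X)" if "I x (E * c * b) a" for x a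
    unfolding content_def Ec
  proof (intro conjI allI impI)
    obtain f0 o1 where x: "x = (f0, o1)" by (cases x)
    have acc: "ar a X (o1 + D + y) < Q" "dig i (ar a X (o1 + D + y)) = part b (E * c * b) y (\<lambda>g. tau x g i)" for y i
      using that by (auto simp: I_def accs_def x)
    have ct: "content b c M w s o1 f0" using that by (simp add: I_def J_def x)
    { fix y assume "y < E * c"
      show "ar a X (snd x + D + y) < Q" using acc by (simp add: x)
      fix i
      have "dig i (ar a X (o1 + D + y)) = (\<Sum>p<b. tau x (y * b + p) i)"
        unfolding acc by (rule part_full[OF \<open>y < E * c\<close>])
      also have "\<dots> = (\<Sum>p<b. M p (y mod c) * transf b c M w s (p * E + y div c) i)"
        using tau_dig[OF ct \<open>y < E * c\<close>]
        by (intro sum.cong refl) (simp add: tau_def x div_mult2_eq div_append mod_append)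
      also have "\<dots> = transf b c M w (Suc s) y i"
        by (rule transf_Suc[OF s b c(1) E_def])
      finally show "dig i (ar a X (snd x + D + y)) = transf b c M w (Suc s) y i" by (simp add: x) }
    fix y assume y: "snd x + D + E * c \<le> y"
    define y' where "y' = y - (o1 + D)"
    have y': "y = o1 + D + y'" "E * c \<le> y'" using y by (auto simp: y'_def x)
    \<comment> \<open>Nothing has been accumulated behind the target, so the next stage finds zeros
      there.\<close>
    show "ar a X y = 0"
      unfolding y'(1) by (rule eq_0_of_dig) (simp only: acc part_empty[OF y'(2)])
  qed
  have T1: "triple Off L (\<lambda>a. vr a 8 = s \<and> staged u v l0 A0 X b c M w s a)
     (stage X b c M)
     (\<lambda>a. vr a 8 = s \<and> staged u v l0 A0 X b c M w (Suc s) a)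
     (?k1 * L + ((E * c * b + 1) * (?k2 * L) + ?k3 * L))"
    unfolding stage_def
  proof (rule triple_Seq[OF _ triple_Seq])
    show "triple Off L (\<lambda>a. vr a 8 = s \<and> staged u v l0 A0 X b c M w s a)
      (to_prog (Mov 12 (Bin DIV (Var 11) (Lit b)))) (\<lambda>a. \<exists>x. J x a \<and> ar a X = fst x) (?k1 * L)"
    proof (rule triple_com)
      fix a assume "vr a 8 = s \<and> staged u v l0 A0 X b c M w s a"
      moreover have "E < 2 ^ L"
      proof -
        have "E \<le> D * c" unfolding DE using b c by simp
        then show ?thesis using Dc by linarith
      qed
      moreover have "D div b = E" using b by (simp add: D)
      ultimately show "wp L Off (Mov 12 (Bin DIV (Var 11) (Lit b))) (\<lambda>a. \<exists>x. J x a \<and> ar a X = fst x) a"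
        by (simp add: J_def cfg_def D_def[symmetric])
    qed (use L in simp_all)
    show "triple Off L (\<lambda>a. \<exists>x. J x a \<and> ar a X = fst x) (Loop (Bin TIMES (Var 11) (Lit c)) (bodyTr X b c M))
       (\<lambda>a. \<exists>x. I x (E * c * b) a) ((E * c * b + 1) * (?k2 * L))"
      by (rule triple_ex, rule triple_conseq[OF loop]) auto
    show "triple Off L (\<lambda>a. \<exists>x. I x (E * c * b) a)
      (to_prog (Sq (Mov 10 (Bin PLUS (Var 10) (Var 11))) (Mov 11 (Bin TIMES (Var 12) (Lit c)))))
      (\<lambda>a. vr a 8 = s \<and> staged u v l0 A0 X b c M w (Suc s) a)
      (?k3 * L)"
    proof (rule triple_com)
      fix a assume "\<exists>x. I x (E * c * b) a"
      then obtain x where I: "I x (E * c * b) a" ..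
      note p = post[OF I]
      have DR: "D \<le> R" using R by (simp add: D_def)
      have o1: "snd x + D \<le> Suc s * R" using I DR by (simp add: I_def J_def)
      have "E * c < 2 ^ L"
      proof -
        have "E * c \<le> D * c" unfolding DE using b by simp
        then show ?thesis using Dc by linarith
      qed
      then show "wp L Off (Sq (Mov 10 (Bin PLUS (Var 10) (Var 11))) (Mov 11 (Bin TIMES (Var 12) (Lit c))))
        (\<lambda>a. vr a 8 = s \<and> staged u v l0 A0 X b c M w (Suc s) a) a"
        unfolding Ec using I p o1 sR by (simp add: I_def J_def cfg_def)
    qed (use L in simp_all)
  qed
  have T2: "?k1 * L + ((E * c * b + 1) * (?k2 * L) + ?k3 * L) \<le> (D * c + 1) * (kstage X b c M * L)"
    unfolding DE kstage_def by (simp add: distrib_right del: com_coeff.simps)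
  show ?thesis by (rule triple_conseq[OF T1 _ _ T2[unfolded D_def]])
qed

definition progTr :: "arr \<Rightarrow> nat \<Rightarrow> nat \<Rightarrow> (nat \<Rightarrow> nat \<Rightarrow> 'a) \<Rightarrow> nat \<Rightarrow> ram_program" where
  "progTr X b c M x0 = Seq (to_prog (Sq (Mov 10 (Lit 0)) (Mov 11 (Var x0)))) (For 8 4 (stage X b c M))"

definition kTr :: "arr \<Rightarrow> nat \<Rightarrow> nat \<Rightarrow> (nat \<Rightarrow> nat \<Rightarrow> 'a) \<Rightarrow> nat \<Rightarrow> nat" where
  "kTr X b c M x0 = com_coeff (Sq (Mov 10 (Lit 0)) (Mov 11 (Var x0))) + 2 * kfor 8 4 + (r * r + 1) * kstage X b c M"

text \<open>Lets the overhead of the \<open>k\<close> stages be absorbed into the bound.\<close>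

lemma k_le_R: "k \<le> R"
proof -
  have "k < 2 ^ k" by simp
  also have "\<dots> \<le> r ^ k" using d_gt d_ge by (intro power_mono) auto
  finally show ?thesis by (simp add: R_def)
qed

text \<open>The two cases are the input transformation, from \<open>d^k\<close> to
  \<open>r^k\<close> words, and the output transformation in the opposite direction; variables 5 and
  6 hold these lengths. Both bases are at most \<open>r\<close>, so no intermediate array is longer
  than \<open>R\<close>.\<close>

lemma triple_Tr:
  assumes A0: "A0 SH = initseg (\<lambda>z. z * Q) (q * Q)" "isTAB Q (A0 TAB)"
    and X: "X \<in> {XA, XB, XC}" and bc: "(b, c, x0) \<in> {(d, r, 5), (r, d, 6)}"
    and w: "\<And>y. y < b ^ k \<Longrightarrow> A0 X y < Q" "\<And>y i. y < b ^ k \<Longrightarrow> w y i = dig i (A0 X y)"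
      "\<And>y. b ^ k \<le> y \<Longrightarrow> A0 X y = 0"
  shows "triple Off L (\<lambda>a. cfg u v a \<and> lo a = l0 \<and> ar a = A0) (progTr X b c M x0)
     (\<lambda>a. cfg u v a \<and> lo a = l0 \<and> frame X A0 a \<and> vr a 10 \<le> k * R \<and>
        (\<forall>y<c ^ k. ar a X (vr a 10 + y) < Q \<and>
          (\<forall>i. dig i (ar a X (vr a 10 + y)) = (\<Sum>x<b ^ k. tpow M b c k x y * w x i))))
     (kTr X b c M x0 * (R * L))"
proof -
  have b: "0 < b" "0 < c" "c \<le> r" using bc d_gt d_ge by auto
  have DR: "b ^ (k - s) * c ^ s \<le> R" if "s \<le> k" for s
  proof -
    have "b ^ (k - s) * c ^ s \<le> r ^ (k - s) * r ^ s"
      using bc d_gt by (intro mult_le_mono power_mono) auto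
    also have "\<dots> = R" using that by (simp add: R_def flip: power_add)
    finally show ?thesis .
  qed
  have geo: "(\<Sum>s<k. b ^ (k - s) * c ^ s) \<le> r * R"
    using bc geometric_up[OF d_gt, of k] geometric_down[OF d_gt, of k] by (auto simp: R_def)
  let ?k1 = "com_coeff (Sq (Mov 10 (Lit 0)) (Mov 11 (Var x0)))" and ?ks = "kstage X b c M"
  define I where "I s a \<longleftrightarrow> staged u v l0 A0 X b c M w s a" for s a
  have 1: "triple Off L (\<lambda>a. cfg u v a \<and> lo a = l0 \<and> ar a = A0) (to_prog (Sq (Mov 10 (Lit 0)) (Mov 11 (Var x0)))) (I 0) (?k1 * L)"
  proof (rule triple_com)
    fix a assume a: "cfg u v a \<and> lo a = l0 \<and> ar a = A0" and Bin: "bounded_state L Off a"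
    have x0: "vr a x0 = b ^ k" "x0 \<noteq> 10" using a bc by (auto simp: cfg_def S_def R_def)
    have "vr a x0 < 2 ^ L" using Bin by (simp add: bounded_state_def)
    moreover have "content b c M w 0 0 (A0 X)" using w by (simp add: content_def transf_0)
    ultimately show "wp L Off (Sq (Mov 10 (Lit 0)) (Mov 11 (Var x0))) (I 0) a"
      using a x0 by (simp add: I_def cfg_def)
  qed (use L in simp_all)
  have 2: "triple Off L (I 0) (For 8 4 (stage X b c M)) (I k)
    ((k + 1) * (kfor 8 4 * L) + (\<Sum>s<k. (b ^ (k - s) * c ^ s * c + 1) * (?ks * L)))"
  proof (rule triple_For[where I = I])
    fix s assume s: "s < k"
    show "triple Off L (\<lambda>a. I s a \<and> vr a 8 = s \<and> vr a 4 = k) (stage X b c M)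
       (\<lambda>a. I (Suc s) a \<and> vr a 8 = s \<and> vr a 4 = k) ((b ^ (k - s) * c ^ s * c + 1) * (?ks * L))"
      by (rule triple_conseq[OF triple_stage[OF A0 X s b DR DR]]) (use s in \<open>auto simp: I_def cfg_def\<close>)
  qed (use L in \<open>auto simp: I_def cfg_def\<close>)
  have cost: "?k1 * L + ((k + 1) * (kfor 8 4 * L) + (\<Sum>s<k. (b ^ (k - s) * c ^ s * c + 1) * (?ks * L)))
     \<le> kTr X b c M x0 * (R * L)"
  proof -
    have "(\<Sum>s<k. b ^ (k - s) * c ^ s * c + 1) = (\<Sum>s<k. b ^ (k - s) * c ^ s) * c + k"
      by (simp only: sum.distrib sum_distrib_right) simp
    also have "\<dots> \<le> (r * R) * r + R" using geo b k_le_R by (intro add_mono mult_le_mono) auto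
    finally have "(\<Sum>s<k. (b ^ (k - s) * c ^ s * c + 1) * (?ks * L)) \<le> ((r * R) * r + R) * (?ks * L)"
      unfolding sum_distrib_right[symmetric] by (rule mult_le_mono1)
    moreover have "(k + 1) * (kfor 8 4 * L) \<le> (2 * R) * (kfor 8 4 * L)"
      using k_le_R R_pos by (intro mult_le_mono1) linarith
    moreover have "?k1 * L \<le> ?k1 * (R * L)" using R_pos by (intro mult_le_mono2) simp
    ultimately have "?k1 * L + ((k + 1) * (kfor 8 4 * L) + (\<Sum>s<k. (b ^ (k - s) * c ^ s * c + 1) * (?ks * L)))
      \<le> ?k1 * (R * L) + ((2 * R) * (kfor 8 4 * L) + ((r * R) * r + R) * (?ks * L))"
      by linarith
    also have "\<dots> = kTr X b c M x0 * (R * L)"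
      unfolding kTr_def by (simp only: algebra_simps)
    finally show ?thesis .
  qed
  show ?thesis unfolding progTr_def
    by (rule triple_conseq[OF triple_Seq[OF 1 2] _ _ cost]) (auto simp: I_def content_def transf_def)
qed

end

section \<open>Composition\<close>

text \<open>An adapter for composition: the rules for the phases fix the initial arrays as
  \<open>A0\<close>, whereas the assertions between phases describe them only by a predicate
  \<open>sp\<close>.\<close>

lemma triple_arrays:
  assumes 1: "\<And>A0. sp A0 \<Longrightarrow> triple Off L (\<lambda>a. C a \<and> lo a = l0 \<and> ar a = A0) c (Q A0) T"
    and 2: "\<And>a. P a \<Longrightarrow> C a \<and> lo a = l0 \<and> sp (ar a)"
    and 3: "\<And>A0 a. sp A0 \<Longrightarrow> Q A0 a \<Longrightarrow> P' a"
  shows "triple Off L P c P' T"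
  unfolding triple_def
proof (intro allI impI, elim conjE)
  fix a s assume "rel Off a s" "bounded_state L Off a" "P a"
  then have "\<exists>T' a' s'. exec c s T' s' \<and> T' \<le> T \<and> rel Off a' s' \<and> bounded_state L Off a' \<and> Q (ar a) a'"
    using 1[of "ar a"] 2[of a] unfolding triple_def by blast
  then show "\<exists>T' a' s'. exec c s T' s' \<and> T' \<le> T \<and> rel Off a' s' \<and> bounded_state L Off a' \<and> P' a'"
    using 3[of "ar a"] 2[OF \<open>P a\<close>] by blast
qed

context sized_scheme
begin

section \<open>Pointwise products and output\<close>

text \<open>At a plain word \<open>x\<close>, that is with scalar 0, \<open>SH\<close> yields
  \<open>x * Q\<close>, so the key \<open>x * Q + y\<close> is formed without a product of two
  words.\<close>

definition bodyPt :: com where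
  "bodyPt = Put XC (Var 7) (Cell MUL (Bin PLUS (Cell SH (Cell XA (Bin PLUS (Var 16) (Var 7)))) (Cell XB (Bin PLUS (Var 17) (Var 7)))))"

lemma triple_Pt:
  assumes A0: "A0 SH = initseg (\<lambda>z. z * Q) (q * Q)" "isMUL (A0 MUL)" "A0 XC = (\<lambda>_. 0)"
    and X: "\<And>y. y < R \<Longrightarrow> A0 XA (u + y) < Q" "\<And>y. y < R \<Longrightarrow> A0 XB (v + y) < Q"
  shows "triple Off L (\<lambda>a. cfg u v a \<and> lo a = l0 \<and> ar a = A0) (Loop (Var 6) bodyPt)
    (\<lambda>a. cfg u v a \<and> lo a = l0 \<and> frame XC A0 a \<and>
       (\<forall>y<R. ar a XC y < Q \<and> (\<forall>i<H. dig i (ar a XC y) = (\<Sum>e1<H. \<Sum>e2<H. if zmul t e1 e2 i then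
          dig e1 (A0 XA (u + y)) * dig e2 (A0 XB (v + y)) else 0))) \<and> (\<forall>y\<ge>R. ar a XC y = 0))
    ((R + 1) * (kloop (Var 6) bodyPt * L))"
proof -
  define f where "f y = A0 MUL (A0 XA (u + y) * Q + A0 XB (v + y))" for y
  have f: "f y < Q" "\<And>i. i < H \<Longrightarrow> dig i (f y) = (\<Sum>e1<H. \<Sum>e2<H. if zmul t e1 e2 i then
      dig e1 (A0 XA (u + y)) * dig e2 (A0 XB (v + y)) else 0)" if "y < R" for y
    using A0(2) X[OF that] unfolding isMUL_def f_def by blast+
  have RL: "R < 2 ^ L"
  proof -
    have "R * 1 \<le> (k + 1) * R * r" using r by (intro mult_le_mono) auto
    then show ?thesis using kRr_less by linarith
  qed
  show ?thesis
  proof (rule triple_Loop[where I = "\<lambda>i a. cfg u v a \<and> lo a = l0 \<and> frame XC A0 a \<and> ar a XC = initseg f i"])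
    fix i a
    assume i: "i < R" and I: "cfg u v a \<and> lo a = l0 \<and> frame XC A0 a \<and> ar a XC = initseg f i"
      and vv: "vr a 7 = i" "vr a 9 = R"
    have "A0 XA (u + i) < q * Q" using X(1)[OF i] qQ_le Q_pos q_ge by (auto intro: less_le_trans)
    then have s: "A0 SH (A0 XA (u + i)) = A0 XA (u + i) * Q" unfolding A0 by (rule initseg_less)
    have b: "f i < 2 ^ L" using f(1)[OF i] by (intro Q_less) simp
    show "wp L Off bodyPt (\<lambda>a. (cfg u v a \<and> lo a = l0 \<and> frame XC A0 a \<and>
        ar a XC = initseg f (Suc i)) \<and> vr a 7 = i \<and> vr a 9 = R) a"
      unfolding bodyPt_def using I vv b by (simp add: cfg_def s f_def[symmetric] initseg_Suc)
  next
    fix a assume "cfg u v a \<and> lo a = l0 \<and> frame XC A0 a \<and> ar a XC = initseg f R"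
    then show "cfg u v a \<and> lo a = l0 \<and> frame XC A0 a \<and>
       (\<forall>y<R. ar a XC y < Q \<and> (\<forall>i<H. dig i (ar a XC y) = (\<Sum>e1<H. \<Sum>e2<H. if zmul t e1 e2 i then
          dig e1 (A0 XA (u + y)) * dig e2 (A0 XB (v + y)) else 0))) \<and> (\<forall>y\<ge>R. ar a XC y = 0)"
      using f by (simp add: initseg_def)
  qed (use L A0 RL in \<open>simp_all add: cfg_def initseg_0 bodyPt_def\<close>)
qed

definition bodyOut :: com where
  "bodyOut = Sq (Mov 13 (Cell RHO (Var 7))) (Sq (Mov 14 (Cell KAP (Var 7)))
    (Cnd (Bin TIMES (Bin LESS (Var 13) (Var 0)) (Bin LESS (Var 14) (Var 0)))
       (Out (Bin PLUS (Bin TIMES (Lit 2) (Bin TIMES (Var 0) (Var 0))) (Bin PLUS (Bin TIMES (Var 13) (Var 0)) (Var 14)))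
         (table_exp swp q (Bin MOD (Bin DIV (Cell XC (Bin PLUS (Var 10) (Bin DIV (Var 7) (Var 1)))) (Cell POW (Bin MOD (Var 7) (Var 1)))) (Lit q))))
       Sk))"

lemma triple_Out:
  assumes A0: "A0 RHO = initseg (zrow t) (S * H)" "A0 KAP = initseg (zcol t) (S * H)"
    "A0 POW = initseg (\<lambda>e. q ^ e) (Suc H)"
    and P: "\<And>x e. x < S \<Longrightarrow> e < H \<Longrightarrow> zrow t (x * H + e) < n \<Longrightarrow> zcol t (x * H + e) < n \<Longrightarrow>
       dig e (A0 XC (w + x)) = P (zrow t (x * H + e)) (zcol t (x * H + e))"
  shows "triple Off L (\<lambda>a. (cfg u v a \<and> vr a 10 = w) \<and> lo a = l0 \<and> ar a = A0) (Loop eSH bodyOut)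
    (\<lambda>a. \<forall>i<n. \<forall>j<n. lo a (2 * (n * n) + (i * n + j)) = enc (P i j))
    ((S * H + 1) * (kloop eSH bodyOut * (L * L)))"
proof (rule triple_Loop[where I = "\<lambda>g a. cfg u v a \<and> vr a 10 = w \<and> ar a = A0 \<and>
    (\<forall>x<g. zrow t x < n \<and> zcol t x < n \<longrightarrow>
      lo a (2 * (n * n) + (zrow t x * n + zcol t x)) = enc (P (zrow t x) (zcol t x)))"])
  fix g a
  assume g: "g < S * H" and I: "cfg u v a \<and> vr a 10 = w \<and> ar a = A0 \<and>
    (\<forall>x<g. zrow t x < n \<and> zcol t x < n \<longrightarrow>
      lo a (2 * (n * n) + (zrow t x * n + zcol t x)) = enc (P (zrow t x) (zcol t x)))"
    and vv: "vr a 7 = g" "vr a 9 = S * H"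
  let ?i = "zrow t g" and ?j = "zcol t g"
  have e3: "g mod H < H" using H_pos by simp
  have gd: "g div H < S" using g by (rule less_mult_imp_div_less)
  have rd: "A0 RHO g = ?i" "A0 KAP g = ?j" "A0 POW (g mod H) = q ^ (g mod H)"
    unfolding A0 using g e3 by (simp_all add: initseg_less)
  have b: "?i < 2 ^ L" "?j < 2 ^ L"
    using zrow_le[OF t, of g] zcol_le[OF t, of g] g SH_less by linarith+
  let ?z = "A0 XC (w + g div H) div q ^ (g mod H) mod q"
  have zq: "?z < q" using q_ge by simp
  have sw: "swp ?z = enc (P ?i ?j)" if "?i < n" "?j < n"
  proof -
    have "un ?z = P ?i ?j" using P[OF gd e3, unfolded div_mult_mod_eq, OF that] by (simp add: dig_def)
    then have "?z = phi (P ?i ?j)" using phi_un[OF zq] by simp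
    then show ?thesis by (simp add: phi_def swp_swp)
  qed
  have bo: "2 * (n * n) + (?i * n + ?j) < Off" if "?i < n" "?j < n"
    using append_less[OF that] by (simp add: Off_def)
  have be: "enc (P ?i ?j) < 2 ^ L" using enc_less by (intro q_less less_imp_le)
  \<comment> \<open>Two writes to one address come from the same position and carry the same entry,
    so what was written before stays correct.\<close>
  have eq: "i * n + j = ?i * n + ?j \<longleftrightarrow> i = ?i \<and> j = ?j" if "i < n" "j < n" "?i < n" "?j < n" for i j
    using that by (intro append_eq_iff)
  show "wp L Off bodyOut (\<lambda>a. (cfg u v a \<and> vr a 10 = w \<and> ar a = A0 \<and>
     (\<forall>x<Suc g. zrow t x < n \<and> zcol t x < n \<longrightarrow>
      lo a (2 * (n * n) + (zrow t x * n + zcol t x)) = enc (P (zrow t x) (zcol t x)))) \<and>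
      vr a 7 = g \<and> vr a 9 = S * H) a"
  proof (cases "?i < n \<and> ?j < n")
    case True
    then show ?thesis
      unfolding bodyOut_def using I vv b bo be
      by (simp add: cfg_def aval_table_exp rd zq sw less_Suc_eq eq)
  next
    case False
    then have "?i < n \<Longrightarrow> \<not> ?j < n" by simp
    then show ?thesis
      unfolding bodyOut_def using I vv b
      by (auto simp add: cfg_def rd less_Suc_eq)
  qed
next
  fix a
  assume I: "cfg u v a \<and> vr a 10 = w \<and> ar a = A0 \<and> (\<forall>x<S * H. zrow t x < n \<and> zcol t x < n \<longrightarrow>
      lo a (2 * (n * n) + (zrow t x * n + zcol t x)) = enc (P (zrow t x) (zcol t x)))"
  show "\<forall>i<n. \<forall>j<n. lo a (2 * (n * n) + (i * n + j)) = enc (P i j)"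
  proof (intro allI impI)
    fix i j assume ij: "i < n" "j < n"
    then have "i < t ^ (k + h)" "j < t ^ (k + h)" using nN by auto
    then obtain x where x: "x < (t * t) ^ (k + h)" "zrow t x = i" "zcol t x = j"
      using zrow_zcol_surj[OF t] by blast
    have "x < S * H" using x by (simp add: S_def H_def d_def power_add)
    then show "lo a (2 * (n * n) + (i * n + j)) = enc (P i j)" using I x ij by blast
  qed
qed (use L A0 SH_less in \<open>simp_all add: cfg_def\<close>)

section \<open>Correctness of the whole computation\<close>

definition tabs :: "(arr \<Rightarrow> nat \<Rightarrow> nat) \<Rightarrow> bool" where
  "tabs f \<longleftrightarrow> f RHO = initseg (zrow t) (S * H) \<and> f KAP = initseg (zcol t) (S * H) \<and>
     f POW = initseg (\<lambda>e. q ^ e) (Suc H) \<and> f SH = initseg (\<lambda>z. z * Q) (q * Q) \<and> isTAB Q (f TAB) \<and> isMUL (f MUL)"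

lemma tabs_cong: "tabs f \<Longrightarrow> (\<And>j. j \<notin> {XA, XB, XC} \<Longrightarrow> g j = f j) \<Longrightarrow> tabs g"
  by (simp add: tabs_def)

definition eB :: aexp where "eB = Bin TIMES (Var 0) (Var 0)"

definition progTabs :: ram_program where
  "progTabs = Seq (Loop eSH bodyZ) (Seq progPOW (Seq (Loop (Bin TIMES (Lit q) (Var 2)) bodySH)
     (Seq (Loop (Bin TIMES (Bin TIMES (Lit q) (Var 2)) (Var 2)) bodyTAB) (Loop eMUL bodyMUL))))"

definition costTabs :: nat where
  "costTabs = (S * H + 1) * (kloop eSH bodyZ * (L * L)) +
     ((H + 1) * (kPOW * (L * L)) + ((q * Q + 1) * (kloop (Bin TIMES (Lit q) (Var 2)) bodySH * (L * L)) +
      ((q * Q * Q + 1) * (kloop (Bin TIMES (Bin TIMES (Lit q) (Var 2)) (Var 2)) bodyTAB * (L * L)) +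
       (Q * Q * (H * (H * H)) + 1) * (kloop eMUL bodyMUL * (L * L)))))"

lemma triple_Tabs:
  "triple Off L (\<lambda>a. cfg u v a \<and> lo a = l0 \<and> ar a = (\<lambda>_ _. 0)) progTabs
    (\<lambda>a. cfg u v a \<and> lo a = l0 \<and> tabs (ar a) \<and> ar a XA = (\<lambda>_. 0) \<and> ar a XB = (\<lambda>_. 0) \<and> ar a XC = (\<lambda>_. 0)) costTabs"
proof -
  let ?C = "\<lambda>a. cfg u v a \<and> lo a = l0"
  define s1 where "s1 f \<longleftrightarrow> f RHO = initseg (zrow t) (S * H) \<and> f KAP = initseg (zcol t) (S * H) \<and>
     f XA = (\<lambda>_. 0) \<and> f XB = (\<lambda>_. 0) \<and> f XC = (\<lambda>_. 0) \<and> f MUL = (\<lambda>_. 0)" for f :: "arr \<Rightarrow> nat \<Rightarrow> nat"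
  define s2 where "s2 f \<longleftrightarrow> s1 f \<and> f POW = initseg (\<lambda>e. q ^ e) (Suc H)" for f :: "arr \<Rightarrow> nat \<Rightarrow> nat"
  define s3 where "s3 f \<longleftrightarrow> s2 f \<and> f SH = initseg (\<lambda>z. z * Q) (q * Q)" for f :: "arr \<Rightarrow> nat \<Rightarrow> nat"
  define s4 where "s4 f \<longleftrightarrow> s3 f \<and> isTAB Q (f TAB)" for f :: "arr \<Rightarrow> nat \<Rightarrow> nat"
  note s_defs = s1_def s2_def s3_def s4_def
  have 1: "triple Off L (\<lambda>a. ?C a \<and> ar a = (\<lambda>_ _. 0)) (Loop eSH bodyZ)
     (\<lambda>a. ?C a \<and> s1 (ar a) \<and> ar a POW = (\<lambda>_. 0) \<and> ar a SH = (\<lambda>_. 0) \<and> ar a TAB = (\<lambda>_. 0))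
     ((S * H + 1) * (kloop eSH bodyZ * (L * L)))"
    by (rule triple_conseq[OF triple_Z[where ?A0.0 = "\<lambda>_ _. 0" and u = u and v = v and ?l0.0 = l0]]) (simp_all add: s1_def)
  have 2: "triple Off L (\<lambda>a. ?C a \<and> s1 (ar a) \<and> ar a POW = (\<lambda>_. 0) \<and> ar a SH = (\<lambda>_. 0) \<and> ar a TAB = (\<lambda>_. 0)) progPOW
     (\<lambda>a. ?C a \<and> s2 (ar a) \<and> ar a SH = (\<lambda>_. 0) \<and> ar a TAB = (\<lambda>_. 0)) ((H + 1) * (kPOW * (L * L)))"
    by (rule triple_arrays[where C = "cfg u v" and ?l0.0 = l0 and sp = "\<lambda>f. s1 f \<and> f POW = (\<lambda>_. 0) \<and> f SH = (\<lambda>_. 0) \<and> f TAB = (\<lambda>_. 0)"],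
        rule triple_POW) (simp_all add: s_defs)
  have 3: "triple Off L (\<lambda>a. ?C a \<and> s2 (ar a) \<and> ar a SH = (\<lambda>_. 0) \<and> ar a TAB = (\<lambda>_. 0)) (Loop (Bin TIMES (Lit q) (Var 2)) bodySH)
     (\<lambda>a. ?C a \<and> s3 (ar a) \<and> ar a TAB = (\<lambda>_. 0)) ((q * Q + 1) * (kloop (Bin TIMES (Lit q) (Var 2)) bodySH * (L * L)))"
    by (rule triple_arrays[where C = "cfg u v" and ?l0.0 = l0 and sp = "\<lambda>f. s2 f \<and> f SH = (\<lambda>_. 0) \<and> f TAB = (\<lambda>_. 0)"],
        rule triple_SH) (simp_all add: s_defs)
  have 4: "triple Off L (\<lambda>a. ?C a \<and> s3 (ar a) \<and> ar a TAB = (\<lambda>_. 0)) (Loop (Bin TIMES (Bin TIMES (Lit q) (Var 2)) (Var 2)) bodyTAB)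
     (\<lambda>a. ?C a \<and> s4 (ar a)) ((q * Q * Q + 1) * (kloop (Bin TIMES (Bin TIMES (Lit q) (Var 2)) (Var 2)) bodyTAB * (L * L)))"
    by (rule triple_arrays[where C = "cfg u v" and ?l0.0 = l0 and sp = "\<lambda>f. s3 f \<and> f TAB = (\<lambda>_. 0)"],
        rule triple_TAB) (simp_all add: s_defs)
  have 5: "triple Off L (\<lambda>a. ?C a \<and> s4 (ar a)) (Loop eMUL bodyMUL)
     (\<lambda>a. cfg u v a \<and> lo a = l0 \<and> tabs (ar a) \<and> ar a XA = (\<lambda>_. 0) \<and> ar a XB = (\<lambda>_. 0) \<and> ar a XC = (\<lambda>_. 0))
     ((Q * Q * (H * (H * H)) + 1) * (kloop eMUL bodyMUL * (L * L)))"
    by (rule triple_arrays[where C = "cfg u v" and ?l0.0 = l0 and sp = s4],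
        rule triple_MUL) (simp_all add: s_defs tabs_def)
  show ?thesis
    unfolding progTabs_def costTabs_def
    by (rule triple_conseq[OF triple_Seq[OF 1 triple_Seq[OF 2 triple_Seq[OF 3 triple_Seq[OF 4 5]]]]]) auto
qed

definition progMain :: ram_program where
  "progMain = Seq (Loop eSH (bodyPack XA (Lit 0)))
     (Seq (Loop eSH (bodyPack XB eB))
     (Seq (progTr XA d r ca 5) (Seq (to_prog (Mov 16 (Var 10)))
     (Seq (progTr XB d r cb 5) (Seq (to_prog (Mov 17 (Var 10)))
     (Seq (Loop (Var 6) bodyPt) (Seq (progTr XC r d (\<lambda>l p. cg p l) 6)
     (Loop eSH bodyOut))))))))"

definition costMain :: nat where
  "costMain = (S * H + 1) * (kloop eSH (bodyPack XA (Lit 0)) * (L * L)) +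
     ((S * H + 1) * (kloop eSH (bodyPack XB eB) * (L * L)) +
     (kTr XA d r ca 5 * (R * L) + (com_coeff (Mov 16 (Var 10)) * L +
     (kTr XB d r cb 5 * (R * L) + (com_coeff (Mov 17 (Var 10)) * L +
     ((R + 1) * (kloop (Var 6) bodyPt * L) + (kTr XC r d (\<lambda>l p. cg p l) 6 * (R * L) +
     (S * H + 1) * (kloop eSH bodyOut * (L * L)))))))))"

definition transd :: "(nat \<Rightarrow> nat \<Rightarrow> 'a) \<Rightarrow> (nat \<Rightarrow> nat \<Rightarrow> 'a) \<Rightarrow> nat \<Rightarrow> (nat \<Rightarrow> nat) \<Rightarrow> bool" where
  "transd M P u f \<longleftrightarrow> (\<forall>y<R. f (u + y) < Q \<and> (\<forall>i<H. dig i (f (u + y)) =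
     (\<Sum>x<S. tpow M d r k x y * P (zrow t (x * H + i)) (zcol t (x * H + i)))))"

lemma triple_Main:
  assumes P: "\<And>i j. i < n \<Longrightarrow> j < n \<Longrightarrow> l0 (i * n + j) = enc (P i j)"
      "\<And>i j. n \<le> i \<or> n \<le> j \<Longrightarrow> P i j = 0"
    and P': "\<And>i j. i < n \<Longrightarrow> j < n \<Longrightarrow> l0 (n * n + (i * n + j)) = enc (P' i j)"
      "\<And>i j. n \<le> i \<or> n \<le> j \<Longrightarrow> P' i j = 0"
  shows "triple Off L (\<lambda>a. cfg u v a \<and> lo a = l0 \<and> tabs (ar a) \<and> ar a XA = (\<lambda>_. 0) \<and> ar a XB = (\<lambda>_. 0) \<and> ar a XC = (\<lambda>_. 0))
    progMain (\<lambda>a. \<forall>i<n. \<forall>j<n. lo a (2 * (n * n) + (i * n + j)) = enc (\<Sum>w<n. P i w * P' w j)) costMain"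
proof -
  let ?C = "\<lambda>u v a. cfg u v a \<and> lo a = l0"
  let ?Z = "\<lambda>f. f = (\<lambda>_. 0 :: nat)"
  \<comment> \<open>What the pointwise products leave behind: digit by digit, the inner sum on the
    left side of \<open>block_product\<close>.\<close>
  define D where "D f \<longleftrightarrow> (\<forall>y<R. f y < Q \<and> (\<forall>i<H. dig i (f y) = (\<Sum>e1<H. \<Sum>e2<H. if zmul t e1 e2 i then
      (\<Sum>x<S. tpow ca d r k x y * P (zrow t (x * H + e1)) (zcol t (x * H + e1))) *
      (\<Sum>x<S. tpow cb d r k x y * P' (zrow t (x * H + e2)) (zcol t (x * H + e2))) else 0))) \<and> (\<forall>y\<ge>R. f y = 0)" for f
  define C where "C i j = (\<Sum>w<t ^ (k + h). P i w * P' w j)" for i j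
  let ?G = "\<lambda>f w. \<forall>x<S. \<forall>e<H. dig e (f XC (w + x)) = C (zrow t (x * H + e)) (zcol t (x * H + e))"
  let ?p1 = "\<lambda>a. ?C u v a \<and> tabs (ar a) \<and> packed P (ar a XA) \<and> ?Z (ar a XB) \<and> ?Z (ar a XC)"
    and ?p2 = "\<lambda>a. ?C u v a \<and> tabs (ar a) \<and> packed P (ar a XA) \<and> packed P' (ar a XB) \<and> ?Z (ar a XC)"
    and ?p3 = "\<lambda>a. ?C u v a \<and> tabs (ar a) \<and> transd ca P (vr a 10) (ar a XA) \<and> packed P' (ar a XB) \<and> ?Z (ar a XC)"
    and ?p4 = "\<lambda>u a. ?C u v a \<and> tabs (ar a) \<and> transd ca P u (ar a XA) \<and> packed P' (ar a XB) \<and> ?Z (ar a XC)"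
    and ?p5 = "\<lambda>u a. ?C u v a \<and> tabs (ar a) \<and> transd ca P u (ar a XA) \<and> transd cb P' (vr a 10) (ar a XB) \<and> ?Z (ar a XC)"
    and ?p6 = "\<lambda>u v a. ?C u v a \<and> tabs (ar a) \<and> transd ca P u (ar a XA) \<and> transd cb P' v (ar a XB) \<and> ?Z (ar a XC)"
    and ?p7 = "\<lambda>u v a. ?C u v a \<and> tabs (ar a) \<and> D (ar a XC)"
    and ?p8 = "\<lambda>u v a. ?C u v a \<and> tabs (ar a) \<and> ?G (ar a) (vr a 10)"
  have 1: "triple Off L (\<lambda>a. ?C u v a \<and> tabs (ar a) \<and> ?Z (ar a XA) \<and> ?Z (ar a XB) \<and> ?Z (ar a XC))
     (Loop eSH (bodyPack XA (Lit 0)))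
     ?p1
     ((S * H + 1) * (kloop eSH (bodyPack XA (Lit 0)) * (L * L)))"
    by (rule triple_arrays[where C = "cfg u v" and ?l0.0 = l0 and sp = "\<lambda>f. tabs f \<and> ?Z (f XA) \<and> ?Z (f XB) \<and> ?Z (f XC)"],
        rule triple_Pack[where ?o0.0 = 0 and P = P])
       (simp_all add: P tabs_def Off_def)
  have 2: "triple Off L ?p1
     (Loop eSH (bodyPack XB eB))
     ?p2
     ((S * H + 1) * (kloop eSH (bodyPack XB eB) * (L * L)))"
    by (rule triple_arrays[where C = "cfg u v" and ?l0.0 = l0 and sp = "\<lambda>f. tabs f \<and> packed P (f XA) \<and> ?Z (f XB) \<and> ?Z (f XC)"],
        rule triple_Pack[where ?o0.0 = "n * n" and P = P'])
       (simp_all add: P' tabs_def Off_def eB_def cfg_def)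
  have tr: "triple Off L (\<lambda>a. cfg u v a \<and> lo a = l0 \<and> ar a = A0) (progTr X d r M 5)
      (\<lambda>a. ?C u v a \<and> frame X A0 a \<and> transd M p (vr a 10) (ar a X)) (kTr X d r M 5 * (R * L))"
    if "tabs A0" "packed p (A0 X)" "X \<in> {XA, XB}" for A0 X p u v M
  proof (rule triple_conseq[OF triple_Tr[where u = u and v = v and ?l0.0 = l0 and X = X and b = d and c = r and
        ?x0.0 = 5 and w = "\<lambda>y i. dig i (A0 X y)" and ?A0.0 = A0 and M = M]])
    fix a assume "cfg u v a \<and> lo a = l0 \<and> frame X A0 a \<and> vr a 10 \<le> k * R \<and>
        (\<forall>y<r ^ k. ar a X (vr a 10 + y) < Q \<and>
          (\<forall>i. dig i (ar a X (vr a 10 + y)) = (\<Sum>x<d ^ k. tpow M d r k x y * dig i (A0 X x))))"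
    then show "?C u v a \<and> frame X A0 a \<and> transd M p (vr a 10) (ar a X)"
      using that(2) unfolding transd_def packed_def R_def[symmetric] S_def[symmetric] by simp
  qed (use that in \<open>auto simp: tabs_def packed_def S_def\<close>)
  have 3: "triple Off L ?p2
     (progTr XA d r ca 5)
     ?p3
     (kTr XA d r ca 5 * (R * L))"
    by (rule triple_arrays[where C = "cfg u v" and ?l0.0 = l0 and sp = "\<lambda>f. tabs f \<and> packed P (f XA) \<and> packed P' (f XB) \<and> ?Z (f XC)"],
        rule tr[of _ P]) (simp_all add: tabs_def)
  \<comment> \<open>The start of the transformed array is known only as the value of variable 10.
    Once saved in variable 16 it becomes a fixed but unknown \<open>u\<close>, bound existentially
    from here on.\<close>
  have 4: "triple Off L ?p3
     (to_prog (Mov 16 (Var 10)))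
     (\<lambda>a. \<exists>u. ?p4 u a)
     (com_coeff (Mov 16 (Var 10)) * L)"
    using L by (intro triple_com) (auto simp: cfg_def bounded_state_def)
  have 5: "triple Off L (\<lambda>a. \<exists>u. ?p4 u a)
     (progTr XB d r cb 5)
     (\<lambda>a. \<exists>u. ?p5 u a)
     (kTr XB d r cb 5 * (R * L))"
  proof (rule triple_ex)
    fix u
    show "triple Off L (?p4 u)
      (progTr XB d r cb 5)
      (\<lambda>a. \<exists>u. ?p5 u a)
      (kTr XB d r cb 5 * (R * L))"
    proof (rule triple_arrays[where C = "cfg u v" and ?l0.0 = l0 and sp = "\<lambda>f. tabs f \<and> transd ca P u (f XA) \<and> packed P' (f XB) \<and> ?Z (f XC)"],
        rule tr[of _ P'])
    qed (auto simp add: tabs_def)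
  qed
  have 6: "triple Off L (\<lambda>a. \<exists>u. ?p5 u a)
     (to_prog (Mov 17 (Var 10)))
     (\<lambda>a. \<exists>u v. ?p6 u v a)
     (com_coeff (Mov 17 (Var 10)) * L)"
    using L by (intro triple_com) (auto simp: cfg_def bounded_state_def)
  have 7: "triple Off L (\<lambda>a. \<exists>u v. ?p6 u v a)
     (Loop (Var 6) bodyPt) (\<lambda>a. \<exists>u v. ?p7 u v a) ((R + 1) * (kloop (Var 6) bodyPt * L))"
  proof (rule triple_ex, rule triple_ex)
    fix u v
    show "triple Off L (?p6 u v)
     (Loop (Var 6) bodyPt) (\<lambda>a. \<exists>u v. ?p7 u v a) ((R + 1) * (kloop (Var 6) bodyPt * L))"
    proof (rule triple_arrays[where C = "cfg u v" and ?l0.0 = l0 and sp = "\<lambda>f. tabs f \<and> transd ca P u (f XA) \<and> transd cb P' v (f XB) \<and> ?Z (f XC)"],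
        rule triple_Pt)
      fix A0 a
      assume A0: "tabs A0 \<and> transd ca P u (A0 XA) \<and> transd cb P' v (A0 XB) \<and> ?Z (A0 XC)"
        and Qa: "cfg u v a \<and> lo a = l0 \<and> frame XC A0 a \<and>
       (\<forall>y<R. ar a XC y < Q \<and> (\<forall>i<H. dig i (ar a XC y) = (\<Sum>e1<H. \<Sum>e2<H. if zmul t e1 e2 i then
          dig e1 (A0 XA (u + y)) * dig e2 (A0 XB (v + y)) else 0))) \<and> (\<forall>y\<ge>R. ar a XC y = 0)"
      have "(\<Sum>e1<H. \<Sum>e2<H. if zmul t e1 e2 i then
          dig e1 (A0 XA (u + y)) * dig e2 (A0 XB (v + y)) else 0) = (\<Sum>e1<H. \<Sum>e2<H. if zmul t e1 e2 i then
      (\<Sum>x<S. tpow ca d r k x y * P (zrow t (x * H + e1)) (zcol t (x * H + e1))) *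
      (\<Sum>x<S. tpow cb d r k x y * P' (zrow t (x * H + e2)) (zcol t (x * H + e2))) else 0)" if "y < R" for y i
        using A0 that unfolding transd_def by (intro sum.cong refl) simp
      then have "D (ar a XC)" using Qa unfolding D_def by simp
      moreover have "tabs (ar a)" using A0 Qa by (auto intro: tabs_cong[of A0])
      ultimately show "\<exists>u v. ?p7 u v a" using Qa by blast
    qed (auto simp: tabs_def transd_def)
  qed
  have 8: "triple Off L (\<lambda>a. \<exists>u v. ?p7 u v a) (progTr XC r d (\<lambda>l p. cg p l) 6)
     (\<lambda>a. \<exists>u v. ?p8 u v a)
     (kTr XC r d (\<lambda>l p. cg p l) 6 * (R * L))"
  proof (rule triple_ex, rule triple_ex)
    fix u v
    show "triple Off L (?p7 u v) (progTr XC r d (\<lambda>l p. cg p l) 6)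
     (\<lambda>a. \<exists>u v. ?p8 u v a)
     (kTr XC r d (\<lambda>l p. cg p l) 6 * (R * L))"
    proof (rule triple_arrays[where C = "cfg u v" and ?l0.0 = l0 and sp = "\<lambda>f. tabs f \<and> D (f XC)"])
      fix A0 :: "arr \<Rightarrow> nat \<Rightarrow> nat" assume A0: "tabs A0 \<and> D (A0 XC)"
      show "triple Off L (\<lambda>a. cfg u v a \<and> lo a = l0 \<and> ar a = A0) (progTr XC r d (\<lambda>l p. cg p l) 6)
        (\<lambda>a. cfg u v a \<and> lo a = l0 \<and> frame XC A0 a \<and> vr a 10 \<le> k * R \<and>
          (\<forall>y<d ^ k. ar a XC (vr a 10 + y) < Q \<and> (\<forall>i. dig i (ar a XC (vr a 10 + y)) =
             (\<Sum>x<r ^ k. tpow (\<lambda>l p. cg p l) r d k x y * dig i (A0 XC x)))))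
        (kTr XC r d (\<lambda>l p. cg p l) 6 * (R * L))"
        by (rule triple_Tr[where w = "\<lambda>y i. dig i (A0 XC y)"])
           (use A0 in \<open>auto simp: tabs_def D_def R_def\<close>)
    next
      fix A0 a
      assume A0: "tabs A0 \<and> D (A0 XC)" and Qa: "cfg u v a \<and> lo a = l0 \<and> frame XC A0 a \<and>
         vr a 10 \<le> k * R \<and> (\<forall>y<d ^ k. ar a XC (vr a 10 + y) < Q \<and> (\<forall>i. dig i (ar a XC (vr a 10 + y)) =
             (\<Sum>x<r ^ k. tpow (\<lambda>l p. cg p l) r d k x y * dig i (A0 XC x))))"
      have "dig e (ar a XC (vr a 10 + x)) = C (zrow t (x * H + e)) (zcol t (x * H + e))" if "x < S" "e < H" for x e
      proof -
        \<comment> \<open>\<open>tpow_swap\<close> turns the transposed power computed by the stages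
          into the one that occurs in the identity.\<close>
        have "dig e (ar a XC (vr a 10 + x)) = (\<Sum>l<r ^ k. tpow cg d r k x l * dig e (A0 XC l))"
          using Qa that by (simp add: S_def tpow_swap[of cg r d])
        also have "\<dots> = (\<Sum>l<r ^ k. tpow cg d r k x l * (\<Sum>e1<H. \<Sum>e2<H. if zmul t e1 e2 e then
          (\<Sum>x<S. tpow ca d r k x l * P (zrow t (x * H + e1)) (zcol t (x * H + e1))) *
          (\<Sum>x<S. tpow cb d r k x l * P' (zrow t (x * H + e2)) (zcol t (x * H + e2))) else 0))"
          using A0 that by (intro sum.cong refl) (simp add: D_def R_def)
        also have "\<dots> = C (zrow t (x * H + e)) (zcol t (x * H + e))"
          using block_product[OF t base, of x k e h P P'] that
          unfolding C_def S_def H_def d_def by simp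
        finally show ?thesis .
      qed
      moreover have "tabs (ar a)" using A0 Qa by (auto intro: tabs_cong[of A0])
      ultimately show "\<exists>u v. ?p8 u v a" using Qa by blast
    qed auto
  qed
  \<comment> \<open>The padding contributes nothing, so the sum over the enlarged side
    \<open>t^(k + h)\<close> shrinks to \<open>n\<close>.\<close>
  have C: "C i j = (\<Sum>w<n. P i w * P' w j)" for i j
  proof -
    have "C i j = (\<Sum>w\<in>{..<n}. P i w * P' w j)"
      unfolding C_def using nN P(2) by (intro sum.mono_neutral_right) auto
    then show ?thesis .
  qed
  have 9: "triple Off L (\<lambda>a. \<exists>u v. ?p8 u v a) (Loop eSH bodyOut)
     (\<lambda>a. \<forall>i<n. \<forall>j<n. lo a (2 * (n * n) + (i * n + j)) = enc (C i j))
     ((S * H + 1) * (kloop eSH bodyOut * (L * L)))"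
  proof (rule triple_ex, rule triple_ex)
    fix u v
    have "triple Off L (\<lambda>a. \<exists>w. ?C u v a \<and> vr a 10 = w \<and> tabs (ar a) \<and> ?G (ar a) w) (Loop eSH bodyOut)
      (\<lambda>a. \<forall>i<n. \<forall>j<n. lo a (2 * (n * n) + (i * n + j)) = enc (C i j))
      ((S * H + 1) * (kloop eSH bodyOut * (L * L)))"
    proof (rule triple_ex)
      fix w
      show "triple Off L (\<lambda>a. ?C u v a \<and> vr a 10 = w \<and> tabs (ar a) \<and> ?G (ar a) w) (Loop eSH bodyOut)
        (\<lambda>a. \<forall>i<n. \<forall>j<n. lo a (2 * (n * n) + (i * n + j)) = enc (C i j))
        ((S * H + 1) * (kloop eSH bodyOut * (L * L)))"
        by (rule triple_arrays[where C = "\<lambda>a. cfg u v a \<and> vr a 10 = w" and ?l0.0 = l0 and sp = "\<lambda>f. tabs f \<and> ?G f w"], rule triple_Out[where w = w]) (auto simp: tabs_def)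
    qed
    then show "triple Off L (\<lambda>a. ?p8 u v a) (Loop eSH bodyOut)
      (\<lambda>a. \<forall>i<n. \<forall>j<n. lo a (2 * (n * n) + (i * n + j)) = enc (C i j))
      ((S * H + 1) * (kloop eSH bodyOut * (L * L)))"
      by (rule triple_conseq) simp_all
  qed
  show ?thesis
    unfolding progMain_def costMain_def
    by (rule triple_conseq[OF triple_Seq[OF 1 triple_Seq[OF 2 triple_Seq[OF 3 triple_Seq[OF 4 triple_Seq[OF 5 triple_Seq[OF 6
          triple_Seq[OF 7 triple_Seq[OF 8 9]]]]]]]]]) (auto simp: C)
qed

end

context sized_scheme
begin

section \<open>Total cost\<close>

definition cT :: nat where "cT = t * t + q * q * q + 2"

definition kMain :: nat where
  "kMain = cT * (kloop eSH bodyZ + kPOW + kloop (Bin TIMES (Lit q) (Var 2)) bodySH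
       + kloop (Bin TIMES (Bin TIMES (Lit q) (Var 2)) (Var 2)) bodyTAB + kloop eMUL bodyMUL
       + kloop eSH (bodyPack XA (Lit 0)) + kloop eSH (bodyPack XB eB)
       + kloop eSH bodyOut)
     + (kTr XA d r ca 5 + com_coeff (Mov 16 (Var 10)) + kTr XB d r cb 5 + com_coeff (Mov 17 (Var 10))
       + 2 * kloop (Var 6) bodyPt + kTr XC r d (\<lambda>l p. cg p l) 6)"

text \<open>Transformations and pointwise products cost a constant times \<open>R * L\<close>. The
  other phases take at most a constant times \<open>n^2 * L^3\<close> steps, the \<open>L^3\<close>
  coming from the triples of positions in the multiplication table, at a cost of order
  \<open>L^2\<close> each.\<close>

lemma cost_le:
  assumes SH: "S * H \<le> t * t * (n * n)" and QQ: "Q * Q \<le> q * q * n" and Hn: "H \<le> n" and HL: "H \<le> L"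
  shows "costTabs + costMain \<le> kMain * (R * L + n * n * L ^ 5)"
proof -
  define U where "U = n * n * L ^ 5"
  define M where "M = n * n * L ^ 3"
  have n1: "n \<le> n * n" "1 \<le> n * n" using n by simp_all
  have L3: "1 \<le> L ^ 3" using L by simp
  have nM: "n * n \<le> M" "1 \<le> M" using L3 n1 unfolding M_def by (simp_all add: Suc_le_eq)
  have ineq: "m + 1 \<le> cT * M" if "m \<le> t * t * M \<or> m \<le> q * q * q * M" for m
  proof -
    have "t * t * M \<le> cT * M - 2 * M" "q * q * q * M \<le> cT * M - 2 * M" "2 * M \<le> cT * M"
      unfolding cT_def by (simp_all add: algebra_simps)
    then show ?thesis using that nM by linarith
  qed
  have tt: "t * t * (n * n) \<le> t * t * M" using nM by (intro mult_le_mono2)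
  have qn: "q * q * q * n \<le> q * q * q * M" using nM n1 by (intro mult_le_mono2) linarith
  have 1: "S * H + 1 \<le> cT * M" using SH tt by (intro ineq) linarith
  have qqq: "1 \<le> q * q * q" using q_ge by (simp add: Suc_le_eq)
  have 2: "H + 1 \<le> cT * M"
  proof (intro ineq disjI2)
    have "H \<le> 1 * M" using Hn n1 nM by linarith
    also have "\<dots> \<le> q * q * q * M" using qqq by (intro mult_le_mono1)
    finally show "H \<le> q * q * q * M" .
  qed
  have 4: "q * Q * Q \<le> q * q * q * n" using mult_le_mono2[OF QQ, of q] by (simp add: mult.assoc)
  have 3: "q * Q + 1 \<le> cT * M" using 4 qn qQ_le by (intro ineq disjI2) linarith
  have 4: "q * Q * Q + 1 \<le> cT * M" using 4 qn by (intro ineq disjI2) linarith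
  have 5: "Q * Q * (H * (H * H)) + 1 \<le> cT * M"
  proof (intro ineq disjI2)
    have "Q * Q * (H * (H * H)) \<le> (q * q * n) * (L * (L * L))"
      by (rule mult_le_mono[OF QQ mult_le_mono[OF HL mult_le_mono[OF HL HL]]])
    also have "\<dots> = q * q * 1 * (n * L ^ 3)" by (simp add: power3_eq_cube)
    also have "\<dots> \<le> q * q * q * (n * n * L ^ 3)"
      using q_ge n1 by (intro mult_le_mono) auto
    finally show "Q * Q * (H * (H * H)) \<le> q * q * q * M" by (simp add: M_def)
  qed
  have T: "(m + 1) * (\<kappa> * (L * L)) \<le> cT * \<kappa> * U" if "m + 1 \<le> cT * M" for m \<kappa>
  proof -
    have "(m + 1) * (\<kappa> * (L * L)) \<le> (cT * M) * (\<kappa> * (L * L))" using that by (rule mult_le_mono1)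
    also have "\<dots> = cT * \<kappa> * U" unfolding M_def U_def by (simp add: algebra_simps eval_nat_numeral)
    finally show ?thesis .
  qed
  have RL: "\<kappa> * L \<le> \<kappa> * (R * L)" for \<kappa> using R_pos by (intro mult_le_mono2) simp
  have R2: "(R + 1) * (\<kappa> * L) \<le> 2 * \<kappa> * (R * L)" for \<kappa>
  proof -
    have "(R + 1) * (\<kappa> * L) \<le> (2 * R) * (\<kappa> * L)" using R_pos by (intro mult_le_mono1) simp
    then show ?thesis by (simp add: algebra_simps)
  qed
  let ?ka = "kloop eSH bodyZ"
    and ?kb = "kPOW"
    and ?kc = "kloop (Bin TIMES (Lit q) (Var 2)) bodySH"
    and ?kd = "kloop (Bin TIMES (Bin TIMES (Lit q) (Var 2)) (Var 2)) bodyTAB"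
    and ?ke = "kloop eMUL bodyMUL"
    and ?kf = "kloop eSH (bodyPack XA (Lit 0))"
    and ?kg = "kloop eSH (bodyPack XB eB)"
    and ?kh = "kloop eSH bodyOut"
    and ?ki = "kTr XA d r ca 5"
    and ?kj = "com_coeff (Mov 16 (Var 10))"
    and ?kk = "kTr XB d r cb 5"
    and ?kl = "com_coeff (Mov 17 (Var 10))"
    and ?km = "kloop (Var 6) bodyPt"
    and ?kn = "kTr XC r d (\<lambda>l p. cg p l) 6"
  have "costTabs + costMain \<le> (cT * ?ka * U + (cT * ?kb * U + (cT * ?kc * U + (cT * ?kd * U + cT * ?ke * U)))) +
      (cT * ?kf * U + (cT * ?kg * U + (?ki * (R * L) + (?kj * (R * L) + (?kk * (R * L) + (?kl * (R * L) + (2 * ?km * (R * L) + (?kn * (R * L) + cT * ?kh * U))))))))"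
    unfolding costTabs_def costMain_def
    by (intro add_mono T R2 RL order_refl 1 2 3 4 5)
  also have "\<dots> = cT * (?ka + ?kb + ?kc + ?kd + ?ke + ?kf + ?kg + ?kh) * U + (?ki + ?kj + ?kk + ?kl + 2 * ?km + ?kn) * (R * L)"
    by (simp only: distrib_left distrib_right ac_simps)
  also have "\<dots> \<le> kMain * U + kMain * (R * L)"
    unfolding kMain_def by (rule add_mono[OF mult_le_mono1[OF le_add1] mult_le_mono1[OF le_add2]])
  finally show ?thesis by (simp add: U_def distrib_left)
qed

end

context encoded_scheme
begin

section \<open>Choice of the parameters\<close>

fun pow_exp :: "aexp \<Rightarrow> nat \<Rightarrow> aexp" where
  "pow_exp e 0 = Lit 1"
| "pow_exp e (Suc m) = Bin TIMES e (pow_exp e m)"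

lemma aval_pw: "aval (pow_exp e m) a = aval e a ^ m"
  by (induction m) simp_all

text \<open>One round of the search for \<open>h\<close>. \<open>Var 2\<close> is
  \<open>q^(d^h)\<close>, so its power \<open>2 * d\<close> is the threshold for
  \<open>h + 1\<close>. The surrounding loop makes \<open>n\<close> rounds, more than enough, and
  idles once the threshold exceeds \<open>n\<close>. \<open>Var 3\<close> is \<open>t^h\<close>, to
  be multiplied on to \<open>t^(k + h)\<close> in the search for \<open>k\<close>.\<close>

definition bodyA :: com where
  "bodyA = Cnd (Bin LESS (Var 0) (pow_exp (Var 2) (2 * d))) Sk
     (Sq (Mov 2 (pow_exp (Var 2) d)) (Sq (Mov 1 (Bin TIMES (Var 1) (Lit d))) (Mov 3 (Bin TIMES (Var 3) (Lit t)))))"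

definition initA :: com where "initA = Sq (Mov 1 (Lit 1)) (Sq (Mov 2 (Lit q)) (Mov 3 (Lit 1)))"

definition bodyB :: com where
  "bodyB = Cnd (Bin LESS (Var 3) (Var 0))
     (Sq (Mov 3 (Bin TIMES (Var 3) (Lit t))) (Sq (Mov 4 (Bin PLUS (Var 4) (Lit 1)))
       (Sq (Mov 5 (Bin TIMES (Var 5) (Lit d))) (Mov 6 (Bin TIMES (Var 6) (Lit r)))))) Sk"

definition initB :: com where "initB = Sq (Mov 4 (Lit 0)) (Sq (Mov 5 (Lit 1)) (Mov 6 (Lit 1)))"

definition progParams :: ram_program where
  "progParams = Seq (to_prog initA) (Seq (For 7 0 (to_prog bodyA)) (Seq (to_prog initB) (For 7 0 (to_prog bodyB))))"

definition kParams :: nat where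
  "kParams = com_coeff initA + (kfor 7 0 + com_coeff bodyA) + com_coeff initB + (kfor 7 0 + com_coeff bodyB)"

text \<open>Invariant of both searches. The cases \<open>h = 0\<close> and \<open>k = 0\<close> are
  their starting values; for small \<open>n\<close> even \<open>q^2 \<le> n\<close> fails.\<close>

definition adm :: "nat \<Rightarrow> nat \<Rightarrow> nat \<Rightarrow> bool" where
  "adm n h k \<longleftrightarrow> (h = 0 \<or> q ^ (2 * d ^ h) \<le> n) \<and> (k = 0 \<or> t ^ (k + h) < t * n)"

definition good :: "nat \<Rightarrow> nat \<Rightarrow> nat \<Rightarrow> bool" where
  "good n h k \<longleftrightarrow> adm n h k \<and> n < q ^ (2 * d ^ Suc h) \<and> n \<le> t ^ (k + h)"

text \<open>The quantities to be bounded are at most \<open>(t * q * r * n)^(r + 4)\<close>; this is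
  an upper bound for the bit length of that number, and a constant times
  \<open>nbits n\<close>.\<close>

definition bits :: "nat \<Rightarrow> nat" where
  "bits n = (r + 4) * (nbits (t * q * r) + 1) * nbits n"

lemma bits_pos: "1 \<le> bits n"
  using nbits_ge_1[of n] by (simp add: bits_def)

lemma d_pow: "d ^ m = t ^ m * t ^ m"
  by (simp add: d_def power_mult_distrib)

text \<open>For the bounds by \<open>2 ^ bits n\<close>, everything is compared with a power of
  \<open>X\<close> whose exponent is at most \<open>r + 4\<close>; the exponent 5 for the
  multiplication table is covered as \<open>r \<ge> 1\<close>.\<close>

lemma adm_bounds:
  assumes n: "1 \<le> n" and a: "adm n h k"
  shows "d ^ h \<le> n" "t ^ (k + h) \<le> t * n" "q ^ d ^ h * q ^ d ^ h \<le> q * q * n"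
    "d ^ k * d ^ h \<le> t * t * (n * n)"
    "d ^ k * d ^ h < 2 ^ bits n" "q * q ^ d ^ h * q ^ d ^ h < 2 ^ bits n"
    "q ^ d ^ h * q ^ d ^ h * (d ^ h * (d ^ h * d ^ h)) < 2 ^ bits n"
    "(k + 1) * r ^ k * r < 2 ^ bits n" "3 * (n * n) < 2 ^ bits n"
proof -
  define X where "X = t * q * r * n"
  have dn: "d ^ h \<le> n"
  proof (cases "h = 0")
    case False
    have "d ^ h \<le> 2 * d ^ h" by simp
    also have "\<dots> < 2 ^ (2 * d ^ h)" by simp
    also have "\<dots> \<le> q ^ (2 * d ^ h)" using q_ge by (intro power_mono) auto
    also have "\<dots> \<le> n" using a False by (simp add: adm_def)
    finally show ?thesis by simp
  qed (use n in simp)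
  then show "d ^ h \<le> n" .
  have th: "t ^ h \<le> d ^ h" using t by (intro power_mono) (auto simp: d_def)
  show tkh: "t ^ (k + h) \<le> t * n"
  proof (cases "k = 0")
    case True
    have "n \<le> t * n" using t by simp
    then have "t ^ h \<le> t * n" using th dn by linarith
    then show ?thesis using True by simp
  next
    case False
    then show ?thesis using a by (simp add: adm_def)
  qed
  show QQ: "q ^ d ^ h * q ^ d ^ h \<le> q * q * n"
  proof (cases "h = 0")
    case False
    have "q ^ d ^ h * q ^ d ^ h = q ^ (2 * d ^ h)" by (simp add: mult_2 power_add)
    also have "\<dots> \<le> n" using a False by (simp add: adm_def)
    also have "\<dots> \<le> q * q * n" using q_ge by simp
    finally show ?thesis .
  qed (use n in simp)
  show SH: "d ^ k * d ^ h \<le> t * t * (n * n)"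
  proof -
    have "d ^ k * d ^ h = t ^ (k + h) * t ^ (k + h)" by (simp add: d_pow power_add)
    also have "\<dots> \<le> (t * n) * (t * n)" using tkh by (intro mult_le_mono)
    finally show ?thesis by (simp add: mult_ac)
  qed
  have pos: "1 \<le> t" "1 \<le> q" "1 \<le> r" using t q_ge r by auto
  have tn: "t * n \<le> X" unfolding X_def using pos by simp
  have X2: "1 \<le> X" unfolding X_def using pos n by (simp add: Suc_le_eq)
  have Xb: "X ^ m < 2 ^ bits n" if "m \<le> r + 4" for m
  proof -
    have "X ^ m \<le> X ^ (r + 4)" using X2 that by (intro power_increasing)
    also have "\<dots> < (2 ^ nbits X) ^ (r + 4)" using less_two_power_nbits by (intro power_strict_mono) auto
    also have "\<dots> = 2 ^ ((r + 4) * nbits X)" by (simp add: power_mult[symmetric] mult.commute)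
    also have "\<dots> \<le> 2 ^ bits n"
    proof -
      have "nbits X \<le> nbits (t * q * r) + nbits n" unfolding X_def by (rule nbits_mult)
      also have "\<dots> \<le> nbits (t * q * r) * nbits n + nbits n" using nbits_ge_1[of n] by simp
      also have "\<dots> = (nbits (t * q * r) + 1) * nbits n" by simp
      finally have "(r + 4) * nbits X \<le> (r + 4) * ((nbits (t * q * r) + 1) * nbits n)"
        by (rule mult_le_mono2)
      then show ?thesis unfolding bits_def mult.assoc[of "r + 4"] by (intro power_increasing) auto
    qed
    finally show ?thesis .
  qed
  have "d ^ k * d ^ h \<le> X ^ 2"
  proof -
    have "t * t * (n * n) = (t * n) * (t * n)" by (simp add: mult_ac)
    also have "\<dots> \<le> X * X" using tn by (intro mult_le_mono)
    finally show ?thesis using SH by (simp add: power2_eq_square)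
  qed
  also have "\<dots> < 2 ^ bits n" by (rule Xb) simp
  finally show "d ^ k * d ^ h < 2 ^ bits n" .
  have qX: "q \<le> X" "n \<le> X" "r \<le> X" unfolding X_def using pos n by simp_all
  have dnX: "d ^ h \<le> X" using dn qX by simp
  have "q * q ^ d ^ h * q ^ d ^ h \<le> q * (q * q * n)" using QQ by (simp add: mult.assoc)
  also have "\<dots> \<le> X * (X * X * X)" using qX by (intro mult_le_mono)
  also have "\<dots> = X ^ 4" by (simp add: eval_nat_numeral)
  also have "\<dots> < 2 ^ bits n" by (rule Xb) simp
  finally show "q * q ^ d ^ h * q ^ d ^ h < 2 ^ bits n" .
  have q2: "q * q * n \<le> X * X"
  proof -
    have "2 * (q * n) \<le> X" 
    proof -
      have "2 * 1 * (q * n) \<le> t * r * (q * n)" using t r by (intro mult_le_mono) auto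
      then show ?thesis by (simp add: X_def mult_ac)
    qed
    then have "q * n \<le> X" by simp
    then have "q * (q * n) \<le> X * X" using qX by (intro mult_le_mono)
    then show ?thesis by (simp add: mult.assoc)
  qed
  have "q ^ d ^ h * q ^ d ^ h * (d ^ h * (d ^ h * d ^ h)) \<le> (X * X) * (X * (X * X))"
    using dnX by (intro mult_le_mono[OF order_trans[OF QQ q2]] mult_le_mono)
  also have "\<dots> = X ^ 5" by (simp add: eval_nat_numeral)
  also have "\<dots> < 2 ^ bits n" by (rule Xb) (use r in simp)
  finally show "q ^ d ^ h * q ^ d ^ h * (d ^ h * (d ^ h * d ^ h)) < 2 ^ bits n" .
  have tk: "t ^ k \<le> X"
  proof -
    have "t ^ k \<le> t ^ (k + h)" using t by (intro power_increasing) auto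
    then show ?thesis using tkh tn by linarith
  qed
  have "k < 2 ^ k" by simp
  also have "\<dots> \<le> t ^ k" using t by (intro power_mono) auto
  finally have k1: "k + 1 \<le> X" using tk by simp
  \<comment> \<open>As \<open>r < 2^r \<le> t^r\<close>, the number \<open>r^k\<close> is at most a
    power of \<open>t^k\<close> whose exponent depends on \<open>r\<close> only.\<close>
  have rk: "r ^ k \<le> X ^ r"
  proof -
    have "r < 2 ^ r" by simp
    also have "\<dots> \<le> t ^ r" using t by (intro power_mono) auto
    finally have "r ^ k \<le> (t ^ r) ^ k" by (intro power_mono) auto
    also have "\<dots> = (t ^ k) ^ r" by (simp flip: power_mult add: mult.commute)
    also have "\<dots> \<le> X ^ r" using tk by (intro power_mono) auto
    finally show ?thesis .
  qed
  have "(k + 1) * r ^ k * r \<le> X * X ^ r * X" using k1 rk qX by (intro mult_le_mono)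
  also have "\<dots> = X ^ (r + 2)" by simp
  also have "\<dots> < 2 ^ bits n" by (rule Xb) simp
  finally show "(k + 1) * r ^ k * r < 2 ^ bits n" .
  have "3 * (n * n) \<le> X ^ 2"
  proof -
    have "2 * 2 * 1 * n \<le> X" unfolding X_def using t q_ge r by (intro mult_le_mono) auto
    then have "4 * n * (4 * n) \<le> X * X" by (intro mult_le_mono) auto
    then show ?thesis by (simp add: power2_eq_square)
  qed
  also have "\<dots> < 2 ^ bits n" by (rule Xb) simp
  finally show "3 * (n * n) < 2 ^ bits n" .
qed

lemma adm_small:
  assumes n: "1 \<le> n" and a: "adm n h k"
  shows "d ^ h < 2 ^ bits n" "q ^ d ^ h < 2 ^ bits n" "t ^ (k + h) < 2 ^ bits n" "k < 2 ^ bits n"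
    "d ^ k < 2 ^ bits n" "r ^ k < 2 ^ bits n" "(1::nat) < 2 ^ bits n" "q < 2 ^ bits n"
proof -
  note b = adm_bounds[OF assms]
  have p: "1 \<le> d ^ h" "1 \<le> d ^ k" "1 \<le> r ^ k" "1 \<le> q ^ d ^ h" "1 \<le> r" "1 \<le> t ^ h" "1 \<le> t ^ k"
    using d_ge q_ge r t by (auto simp: Suc_le_eq)
  have "1 * d ^ h \<le> d ^ k * d ^ h" "d ^ k * 1 \<le> d ^ k * d ^ h" using p by (intro mult_le_mono; simp)+
  then show "d ^ h < 2 ^ bits n" "d ^ k < 2 ^ bits n" using b(5) by linarith+
  have "1 * 1 * q ^ d ^ h \<le> q * q ^ d ^ h * q ^ d ^ h" using p q_ge by (intro mult_le_mono) auto
  then show "q ^ d ^ h < 2 ^ bits n" using b(6) by linarith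
  have "q * 1 * 1 \<le> q * q ^ d ^ h * q ^ d ^ h" using p by (intro mult_le_mono) auto
  then show "q < 2 ^ bits n" using b(6) by linarith
  then show "(1::nat) < 2 ^ bits n" using q_ge by linarith
  have "d ^ k * d ^ h = t ^ (k + h) * t ^ (k + h)" by (simp add: d_pow power_add)
  moreover have "1 * t ^ (k + h) \<le> t ^ (k + h) * t ^ (k + h)" using t by (intro mult_le_mono1) simp
  ultimately show "t ^ (k + h) < 2 ^ bits n" using b(5) by linarith
  have "(k + 1) * 1 * 1 \<le> (k + 1) * r ^ k * r" using p by (intro mult_le_mono) auto
  then have "k \<le> (k + 1) * r ^ k * r" by simp
  then show "k < 2 ^ bits n" using b(8) by (rule le_less_trans)
  have "1 * r ^ k * 1 \<le> (k + 1) * r ^ k * r" using p by (intro mult_le_mono) auto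
  then show "r ^ k < 2 ^ bits n" using b(8) by linarith
qed

lemma triple_Params:
  assumes n: "1 \<le> n"
  shows "triple Off (bits n) (\<lambda>a. vr a 0 = n \<and> vr a 16 = 0 \<and> vr a 17 = 0 \<and> lo a = l0 \<and> ar a = A0) progParams
     (\<lambda>a. \<exists>h k. good n h k \<and> vr a 0 = n \<and> vr a 1 = d ^ h \<and> vr a 2 = q ^ d ^ h \<and> vr a 4 = k \<and> vr a 5 = d ^ k
        \<and> vr a 6 = r ^ k \<and> vr a 16 = 0 \<and> vr a 17 = 0 \<and> lo a = l0 \<and> ar a = A0)
     ((n + 1) * (kParams * (bits n * bits n)))"
proof -
  let ?L = "bits n"
  let ?W = "?L * ?L"
  let ?par = "\<lambda>h k a. vr a 0 = n \<and> vr a 1 = d ^ h \<and> vr a 2 = q ^ d ^ h \<and> vr a 4 = k \<and> vr a 5 = d ^ k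
        \<and> vr a 6 = r ^ k \<and> vr a 16 = 0 \<and> vr a 17 = 0 \<and> lo a = l0 \<and> ar a = A0"
  define F where "F a \<longleftrightarrow> vr a 0 = n \<and> vr a 16 = 0 \<and> vr a 17 = 0 \<and> lo a = l0 \<and> ar a = A0" for a :: ast
  define G where "G h a \<longleftrightarrow> F a \<and> vr a 1 = d ^ h \<and> vr a 2 = q ^ d ^ h" for h a
  \<comment> \<open>Either the threshold is passed or \<open>h\<close> has grown in each of the
    \<open>i\<close> rounds. After \<open>n\<close> rounds the second is impossible, since
    \<open>h < d^h \<le> n\<close>.\<close>
  define I where "I i a \<longleftrightarrow> (\<exists>h. adm n h 0 \<and> G h a \<and> vr a 3 = t ^ h \<and> (n < q ^ (2 * d ^ Suc h) \<or> i \<le> h))" for i a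
  define J where "J h i a \<longleftrightarrow> (\<exists>k. adm n h k \<and> n < q ^ (2 * d ^ Suc h) \<and> G h a \<and> vr a 3 = t ^ (k + h) \<and> vr a 4 = k
     \<and> vr a 5 = d ^ k \<and> vr a 6 = r ^ k \<and> (n \<le> t ^ (k + h) \<or> i \<le> k))" for h i a
  have L: "1 \<le> ?L" by (rule bits_pos)
  have adm0: "adm n 0 0" by (simp add: adm_def)
  have 1: "triple Off ?L F (to_prog initA) (I 0) (com_coeff initA * ?W)"
    using L adm_small[OF n adm0] adm0
    by (intro triple_com) (auto simp: initA_def I_def G_def F_def intro!: exI[of _ 0])
  have 2: "triple Off ?L (I 0) (For 7 0 (to_prog bodyA)) (\<lambda>a. \<exists>h. adm n h 0 \<and> n < q ^ (2 * d ^ Suc h) \<and> G h a \<and> vr a 3 = t ^ h)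
     ((n + 1) * ((kfor 7 0 + com_coeff bodyA) * ?W))"
  proof (rule triple_For_com[where I = I])
    fix i a assume i: "i < n" and "I i a" and v: "vr a 7 = i" "vr a 0 = n"
    then obtain h where h: "adm n h 0" "G h a" "vr a 3 = t ^ h" "n < q ^ (2 * d ^ Suc h) \<or> i \<le> h"
      by (auto simp: I_def)
    have e: "(q ^ d ^ h) ^ (2 * d) = q ^ (2 * d ^ Suc h)" "(q ^ d ^ h) ^ d = q ^ d ^ Suc h"
      by (simp_all flip: power_mult add: mult_ac)
    show "wp ?L Off bodyA (\<lambda>a. I (Suc i) a \<and> vr a 7 = i \<and> vr a 0 = n) a"
    proof (cases "n < q ^ (2 * d ^ Suc h)")
      case True
      then have "I (Suc i) a" using h unfolding I_def by blast
      then show ?thesis using h(2) v True unfolding bodyA_def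
        by (simp add: G_def aval_pw e del: power_Suc)
    next
      case False
      then have a': "adm n (Suc h) 0" "Suc i \<le> Suc h" using h by (auto simp: adm_def)
      note s = adm_small[OF n a'(1)]
      have e': "d ^ h * d = d ^ Suc h" "t ^ h * t = t ^ Suc h" by simp_all
      show ?thesis unfolding bodyA_def using h(2,3) v False s a'
        by (auto simp add: G_def F_def I_def aval_pw e e' simp del: power_Suc intro!: exI[of _ "Suc h"])
    qed
  next
    fix a assume "I n a"
    then obtain h where h: "adm n h 0" "G h a" "vr a 3 = t ^ h" "n < q ^ (2 * d ^ Suc h) \<or> n \<le> h"
      by (auto simp: I_def)
    have "\<not> n \<le> h"
    proof
      assume nh: "n \<le> h"
      then have "h \<noteq> 0" using n by simp
      have "h < 2 ^ h" by simp
      also have "\<dots> \<le> d ^ h" using d_ge by (intro power_mono) auto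
      also have "\<dots> \<le> n" by (rule adm_bounds(1)[OF n h(1)])
      finally show False using nh by simp
    qed
    then show "\<exists>h. adm n h 0 \<and> n < q ^ (2 * d ^ Suc h) \<and> G h a \<and> vr a 3 = t ^ h" using h by blast
  qed (use L in \<open>auto simp: I_def G_def F_def\<close>)
  have 3: "triple Off ?L (\<lambda>a. \<exists>h. adm n h 0 \<and> n < q ^ (2 * d ^ Suc h) \<and> G h a \<and> vr a 3 = t ^ h) (to_prog initB)
     (\<lambda>a. \<exists>h. J h 0 a) (com_coeff initB * ?W)"
  proof (rule triple_com)
    fix a assume "\<exists>h. adm n h 0 \<and> n < q ^ (2 * d ^ Suc h) \<and> G h a \<and> vr a 3 = t ^ h"
    then obtain h where "adm n h 0" "n < q ^ (2 * d ^ Suc h)" "G h a" "vr a 3 = t ^ h" by blast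
    then show "wp ?L Off initB (\<lambda>a. \<exists>h. J h 0 a) a"
      using adm_small[OF n adm0] unfolding initB_def
      by (auto simp: J_def G_def F_def intro!: exI[of _ h] simp del: power_Suc)
  qed (use L in auto)
  have 4: "triple Off ?L (\<lambda>a. \<exists>h. J h 0 a) (For 7 0 (to_prog bodyB)) (\<lambda>a. \<exists>h k. good n h k \<and> ?par h k a)
     ((n + 1) * ((kfor 7 0 + com_coeff bodyB) * ?W))"
  proof (rule triple_ex)
    fix h
    show "triple Off ?L (J h 0) (For 7 0 (to_prog bodyB)) (\<lambda>a. \<exists>h k. good n h k \<and> ?par h k a)
     ((n + 1) * ((kfor 7 0 + com_coeff bodyB) * ?W))"
    proof (rule triple_For_com[where I = "J h"])
      fix i a assume i: "i < n" and "J h i a" and v: "vr a 7 = i" "vr a 0 = n"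
      then obtain k where h: "adm n h k" "n < q ^ (2 * d ^ Suc h)" "G h a" "vr a 3 = t ^ (k + h)" "vr a 4 = k"
        "vr a 5 = d ^ k" "vr a 6 = r ^ k" "n \<le> t ^ (k + h) \<or> i \<le> k" by (auto simp: J_def)
      show "wp ?L Off bodyB (\<lambda>a. J h (Suc i) a \<and> vr a 7 = i \<and> vr a 0 = n) a"
      proof (cases "t ^ (k + h) < n")
        case False
        then have "J h (Suc i) a" using h unfolding J_def by (auto simp: not_less simp del: power_Suc)
        then show ?thesis using h(3,4) v False unfolding bodyB_def by (simp add: G_def)
      next
        case True
        then have a': "adm n h (Suc k)" "Suc i \<le> Suc k" using h t by (auto simp: adm_def)
        note s = adm_small[OF n a'(1)]
        show ?thesis unfolding bodyB_def using h(2-7) v True s a'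
          by (auto simp add: G_def F_def J_def mult.commute intro!: exI[of _ "Suc k"])
      qed
    next
      fix a assume "J h n a"
      then obtain k where h: "adm n h k" "n < q ^ (2 * d ^ Suc h)" "G h a" "vr a 3 = t ^ (k + h)" "vr a 4 = k"
        "vr a 5 = d ^ k" "vr a 6 = r ^ k" "n \<le> t ^ (k + h) \<or> n \<le> k" by (auto simp: J_def)
      have "n \<le> t ^ (k + h)"
      proof (cases "n \<le> k")
        case True
        have "k < 2 ^ k" by simp
        also have "\<dots> \<le> t ^ k" using t by (intro power_mono) auto
        also have "\<dots> \<le> t ^ (k + h)" using t by (intro power_increasing) auto
        finally show ?thesis using True by simp
      qed (use h in simp)
      then have "good n h k" using h by (simp add: good_def)
      then show "\<exists>h k. good n h k \<and> ?par h k a"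
        using h by (auto simp: G_def F_def)
    qed (use L in \<open>auto simp: J_def G_def F_def\<close>)
  qed
  have cost: "com_coeff initA * ?W + ((n + 1) * ((kfor 7 0 + com_coeff bodyA) * ?W) +
     (com_coeff initB * ?W + (n + 1) * ((kfor 7 0 + com_coeff bodyB) * ?W))) \<le> (n + 1) * (kParams * ?W)"
    unfolding kParams_def by (simp add: distrib_right distrib_left)
  show ?thesis unfolding progParams_def
    by (rule triple_conseq[OF triple_Seq[OF 1 triple_Seq[OF 2 triple_Seq[OF 3 4]]] _ _ cost]) (auto simp: F_def)
qed

end

context encoded_scheme
begin

section \<open>The complete program\<close>

lemma inst_of_good:
  assumes "1 \<le> n" "good n h k"
  shows "sized_scheme t r ca cb cg enc n h k (bits n)"
proof -
  have a: "adm n h k" "n \<le> t ^ (k + h)" using assms(2) by (simp_all add: good_def)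
  show ?thesis
    by unfold_locales (use assms(1) a(2) bits_pos adm_bounds[OF assms(1) a(1)] in simp_all)
qed

text \<open>\<open>n\<close> moves to register 1, which is variable 0, before register 0 is
  overwritten with the offset. The cells from \<open>3 * (n * n)\<close> on are still 0, so all
  arrays start empty.\<close>

definition prelude :: ram_program where
  "prelude = Seq (Assign 1 (Reg 0)) (Assign 0 (Op TIMES (Const 3) (Op TIMES (Reg 0) (Reg 0))))"

lemma exec_prelude:
  assumes n: "1 \<le> n" and s: "s = mm_input enc n MA MB"
    and a: "a = \<lparr>vr = (\<lambda>x. if x = 0 then n else 0), ar = (\<lambda>_ _. 0), lo = mem s\<rparr>"
  shows "\<exists>c s'. exec prelude s c s' \<and> c \<le> 20 * (bits n * bits n) \<and> rel (3 * (n * n)) a s' \<and>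
     bounded_state (bits n) (3 * (n * n)) a"
proof -
  let ?L = "bits n"
  let ?s1 = "s\<lparr>regs := (regs s)(1 := n)\<rparr>"
  let ?s2 = "?s1\<lparr>regs := (regs ?s1)(0 := 3 * (n * n))\<rparr>"
  have adm0: "adm n 0 0" by (simp add: adm_def)
  have b3: "3 * (n * n) < 2 ^ ?L" by (rule adm_bounds(9)[OF n adm0])
  have L: "1 \<le> ?L" by (rule bits_pos)
  have nL: "nbits n \<le> ?L" by (simp add: bits_def)
  have L2: "?L \<le> ?L * ?L" using L by simp
  have c3: "nbits (3 * (n * n)) \<le> ?L" by (rule nbits_leI[OF b3 L])
  have c2: "nbits (n * n) \<le> 2 * ?L" using nbits_mult[of n n] nL by linarith
  have c0: "nbits 0 \<le> 1" "nbits 1 \<le> 1" "nbits 3 \<le> 2" by (auto intro: nbits_leI)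
  have p1: "nbits n * nbits n \<le> ?L * ?L" using nL by (intro mult_le_mono)
  have p2: "nbits 3 * nbits (n * n) \<le> 2 * (2 * ?L)" using c0 c2 by (intro mult_le_mono)
  have r0: "regs s 0 = n" by (simp add: s mm_input_def)
  have e1: "exec (Assign 1 (Reg 0)) s (nbits 0 + nbits n + nbits 1 + nbits n) ?s1"
    using exec_Assign[of 1 "Reg 0" s] r0 by simp
  have e2: "exec (Assign 0 (Op TIMES (Const 3) (Op TIMES (Reg 0) (Reg 0)))) ?s1
     (nbits 3 + (nbits 0 + nbits n + (nbits 0 + nbits n) + nbits n * nbits n) + nbits 3 * nbits (n * n)
       + nbits 0 + nbits (3 * (n * n))) ?s2"
    using exec_Assign[of 0 "Op TIMES (Const 3) (Op TIMES (Reg 0) (Reg 0))" ?s1] r0 by simp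
  have "exec prelude s ((nbits 0 + nbits n + nbits 1 + nbits n) +
     (nbits 3 + (nbits 0 + nbits n + (nbits 0 + nbits n) + nbits n * nbits n) + nbits 3 * nbits (n * n)
       + nbits 0 + nbits (3 * (n * n)))) ?s2"
    unfolding prelude_def by (rule exec_Seq[OF e1 e2])
  moreover have "(nbits 0 + nbits n + nbits 1 + nbits n) +
     (nbits 3 + (nbits 0 + nbits n + (nbits 0 + nbits n) + nbits n * nbits n) + nbits 3 * nbits (n * n)
       + nbits 0 + nbits (3 * (n * n))) \<le> 20 * (?L * ?L)"
    using nL c0 c3 p1 p2 L L2 by linarith
  moreover have "rel (3 * (n * n)) a ?s2"
    by (auto simp: rel_def a s mm_input_def)
  moreover have "bounded_state ?L (3 * (n * n)) a"
  proof -
    have "n \<le> 3 * (n * n)" using n by simp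
    then have "n < 2 ^ ?L" using b3 by linarith
    moreover have "enc x < 2 ^ ?L" for x
      using enc_less[of x] adm_small(8)[OF n adm0] by linarith
    ultimately show ?thesis using b3 by (simp add: bounded_state_def a s mm_input_def)
  qed
  ultimately show ?thesis by blast
qed

text \<open>Outside their locale the program texts take the listed arguments only, none of which is
  \<open>n\<close>, \<open>h\<close>, \<open>k\<close> or \<open>L\<close>: this is the uniformity
  in \<open>n\<close>. The same holds for \<open>kMain\<close> in the cost constant.\<close>

definition prog :: ram_program where
  "prog = Seq prelude (Seq progParams (Seq (sized_scheme.progTabs t enc) (sized_scheme.progMain t r ca cb cg enc)))"

definition kProg :: nat where
  "kProg = 20 + 2 * kParams + sized_scheme.kMain t r ca cb cg enc"

text \<open>\<open>h\<close> and \<open>k\<close> are bound existentially because the program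
  computes them; \<open>good\<close> carries what the asymptotic analysis has to know about
  them.\<close>

lemma prog_correct:
  assumes n: "1 \<le> n" and MA: "MA \<in> carrier_mat n n" and MB: "MB \<in> carrier_mat n n"
  shows "\<exists>c s h k. exec prog (mm_input enc n MA MB) c s \<and> c \<le> kProg * (r ^ k * bits n + n * n * bits n ^ 5) \<and>
    mm_output enc n s (MA * MB) \<and> good n h k"
proof -
  let ?L = "bits n" and ?Off = "3 * (n * n)"
  define s0 where "s0 = mm_input enc n MA MB"
  define a0 where "a0 = \<lparr>vr = (\<lambda>x. if x = 0 then n else 0), ar = (\<lambda>_ _. 0), lo = mem s0\<rparr>"
  obtain c1 s1 where 1: "exec prelude s0 c1 s1" "c1 \<le> 20 * (?L * ?L)" "rel ?Off a0 s1" "bounded_state ?L ?Off a0"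
    using exec_prelude[OF n s0_def a0_def] by blast
  have "vr a0 0 = n \<and> vr a0 16 = 0 \<and> vr a0 17 = 0 \<and> lo a0 = mem s0 \<and> ar a0 = (\<lambda>_ _. 0)"
    by (simp add: a0_def)
  then obtain c2 a2 s2 h k where 2: "exec progParams s1 c2 s2" "c2 \<le> (n + 1) * (kParams * (?L * ?L))"
    "rel ?Off a2 s2" "bounded_state ?L ?Off a2" "good n h k" "vr a2 0 = n" "vr a2 1 = d ^ h" "vr a2 2 = q ^ d ^ h"
    "vr a2 4 = k" "vr a2 5 = d ^ k" "vr a2 6 = r ^ k" "vr a2 16 = 0" "vr a2 17 = 0" "lo a2 = mem s0"
    "ar a2 = (\<lambda>_ _. 0)"
    using triple_Params[OF n, of ?Off "mem s0" "\<lambda>_ _. 0"] 1(3,4) unfolding triple_def by blast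
  interpret sized_scheme t r ca cb cg enc n h k ?L
    by (rule inst_of_good[OF n 2(5)])
  have adm: "adm n h k" using 2(5) by (simp add: good_def)
  have Off: "Off = ?Off" by (simp add: Off_def)
  have cfg: "cfg 0 0 a2 \<and> lo a2 = mem s0 \<and> ar a2 = (\<lambda>_ _. 0)"
    using 2 by (simp add: cfg_def H_def Q_def S_def R_def)
  define P where "P i j = (if i < n \<and> j < n then MA $$ (i, j) else 0)" for i j
  define P' where "P' i j = (if i < n \<and> j < n then MB $$ (i, j) else 0)" for i j
  have inA: "mem s0 (i * n + j) = enc (P i j)" if "i < n" "j < n" for i j
    using append_less[OF that] div_append[OF that(2), of i] mod_append[OF that(2), of i] that
    by (simp add: s0_def mm_input_def P_def)
  have inB: "mem s0 (n * n + (i * n + j)) = enc (P' i j)" if "i < n" "j < n" for i j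
    using append_less[OF that] div_append[OF that(2), of i] mod_append[OF that(2), of i] that
    by (simp add: s0_def mm_input_def P'_def)
  have triple: "triple Off ?L (\<lambda>a. cfg 0 0 a \<and> lo a = mem s0 \<and> ar a = (\<lambda>_ _. 0)) (Seq progTabs progMain)
    (\<lambda>a. \<forall>i<n. \<forall>j<n. lo a (2 * (n * n) + (i * n + j)) = enc (\<Sum>w<n. P i w * P' w j)) (costTabs + costMain)"
    by (rule triple_Seq[OF triple_Tabs triple_Main]) (auto simp: inA inB, auto simp: P_def P'_def)
  obtain c3 a3 s3 where 3: "exec (Seq progTabs progMain) s2 c3 s3" "c3 \<le> costTabs + costMain" "rel Off a3 s3"
    "\<forall>i<n. \<forall>j<n. lo a3 (2 * (n * n) + (i * n + j)) = enc (\<Sum>w<n. P i w * P' w j)"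
    using triple 2(3,4) cfg unfolding triple_def Off by blast
  have to_expr: "exec prog s0 (c1 + (c2 + c3)) s3"
    unfolding prog_def by (rule exec_Seq[OF 1(1) exec_Seq[OF 2(1) 3(1)]])
  have HL: "H \<le> ?L"
  proof -
    have "(2::nat) ^ H \<le> q ^ H" using q_ge by (intro power_mono) auto
    also have "\<dots> < 2 ^ ?L" using adm_small(2)[OF n adm] by (simp add: H_def)
    finally show ?thesis by (simp add: less_imp_le)
  qed
  have c3: "c3 \<le> kMain * (R * ?L + n * n * ?L ^ 5)"
    using 3(2) cost_le[OF _ _ _ HL] adm_bounds(1,3,4)[OF n adm]
    by (simp add: H_def S_def Q_def)
  have "c1 + (c2 + c3) \<le> kProg * (r ^ k * ?L + n * n * ?L ^ 5)"
  proof -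
    let ?U = "n * n * ?L ^ 5"
    have L3: "1 \<le> ?L ^ 3" using L by simp
    have L5: "?L * ?L * ?L ^ 3 = ?L ^ 5" by (simp add: eval_nat_numeral)
    have "?L * ?L * 1 \<le> ?L * ?L * ?L ^ 3" using L3 by (rule mult_le_mono2)
    then have LL: "?L * ?L \<le> ?L ^ 5" unfolding L5 by simp
    have nn: "1 \<le> n * n" "n + 1 \<le> 2 * (n * n)"
    proof -
      have "n \<le> n * n" using n by simp
      then show "1 \<le> n * n" "n + 1 \<le> 2 * (n * n)" using n by linarith+
    qed
    have "1 * (?L * ?L) \<le> ?U" using nn(1) LL by (rule mult_le_mono)
    then have 11: "c1 \<le> 20 * ?U" using 1(2) by linarith
    have "(n + 1) * (kParams * (?L * ?L)) \<le> (2 * (n * n)) * (kParams * ?L ^ 5)"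
      using nn(2) LL by (intro mult_le_mono) auto
    also have "\<dots> = 2 * kParams * ?U" by simp
    finally have 22: "c2 \<le> 2 * kParams * ?U" using 2(2) by linarith
    have "c1 + (c2 + c3) \<le> 20 * ?U + (2 * kParams * ?U + kMain * (R * ?L + ?U))"
      using 11 22 c3 by (intro add_mono)
    also have "\<dots> \<le> (20 + 2 * kParams + kMain) * (R * ?L + ?U)"
      by (simp add: distrib_left distrib_right)
    finally show ?thesis by (simp add: kProg_def R_def)
  qed
  moreover have "mm_output enc n s3 (MA * MB)"
    unfolding mm_output_def
  proof (intro allI impI)
    fix i j assume ij: "i < n" "j < n"
    have "(MA * MB) $$ (i, j) = (\<Sum>w<n. P i w * P' w j)"
      using MA MB ij by (simp add: times_mat_def scalar_prod_def P_def P'_def atLeast0LessThan)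
    moreover have "2 * (n * n) + (i * n + j) < Off" using append_less[OF ij] by (simp add: Off_def)
    then have "mem s3 (2 * (n * n) + (i * n + j)) = lo a3 (2 * (n * n) + (i * n + j))"
      using 3(3) by (simp add: rel_def)
    ultimately show "mem s3 (2 * (n * n) + i * n + j) = enc ((MA * MB) $$ (i, j))"
      using 3(4) ij by (simp add: add.assoc)
  qed
  ultimately show ?thesis using to_expr 2(5) unfolding s0_def by blast
qed

section \<open>Asymptotics\<close>

text \<open>With \<open>n + 1\<close> the logarithm is at least 1 for every
  \<open>n \<ge> 1\<close>, so it absorbs the rounding and can serve as a divisor.\<close>

lemma nbits_le_log: "1 \<le> n \<Longrightarrow> real (nbits n) \<le> 2 * log 2 (real n + 1)"
proof -
  assume n: "1 \<le> n"
  have "nbits n = nat \<lfloor>log 2 (real n)\<rfloor> + 1"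
    using n by (simp add: nbits_def floorlog_def)
  moreover have "0 \<le> log 2 (real n)" using n by simp
  ultimately have "real (nbits n) \<le> log 2 (real n) + 1" by (simp add: of_nat_nat)
  also have "log 2 (real n) \<le> log 2 (real n + 1)" using n by simp
  also have "log 2 (real n + 1) + 1 \<le> 2 * log 2 (real n + 1)"
    using n by (simp add: le_log_iff)
  finally show ?thesis by simp
qed

text \<open>With \<open>l = log 2 (n + 1)\<close>, maximality of \<open>h\<close> gives
  \<open>l \<le> c * t^(2 h)\<close>, so \<open>t^h\<close> is at least of order
  \<open>sqrt l\<close>, while minimality of \<open>k\<close> gives
  \<open>t^(k + h) \<le> t * n\<close>. Division bounds \<open>t^k\<close>, whose power with
  exponent \<open>\<tau>\<close> is \<open>r^k\<close>.\<close>

lemma rank_power_bound: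
  assumes n: "1 \<le> n" and g: "good n h k" and \<tau>: "\<tau> = log (real t) (real r)"
  shows "real (r ^ k) \<le> (real t * sqrt (2 * real d * log 2 (real q))) powr \<tau> * (real n powr \<tau> / log 2 (real n + 1) powr (\<tau> / 2))"
proof -
  define l where "l = log 2 (real n + 1)"
  define c where "c = 2 * real d * log 2 (real q)"
  have l: "1 \<le> l" unfolding l_def using n by (simp add: le_log_iff)
  have lq: "1 \<le> log 2 (real q)" using q_ge by (simp add: le_log_iff)
  have c0: "0 < c" unfolding c_def using lq d_ge by simp
  have t1: "1 < real t" using t by simp
  have \<tau>0: "0 \<le> \<tau>" unfolding \<tau> using t1 r by simp
  have tr: "real t powr \<tau> = real r" unfolding \<tau> using t1 r by simp
  have "l \<le> c * (real t ^ h)\<^sup>2"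
  proof -
    have "n + 1 \<le> q ^ (2 * d ^ Suc h)" using g by (simp add: good_def)
    then have "real (n + 1) \<le> real (q ^ (2 * d ^ Suc h))" by (rule of_nat_mono)
    then have "l \<le> log 2 (real q ^ (2 * d ^ Suc h))"
      unfolding l_def by (intro log_mono) auto
    also have "\<dots> = real (2 * d ^ Suc h) * log 2 (real q)" using q_ge by (simp add: log_nat_power)
    also have "\<dots> = c * (real t ^ h)\<^sup>2"
      by (simp add: c_def d_def power_mult_distrib power2_eq_square)
    finally show ?thesis .
  qed
  then have "sqrt l \<le> sqrt (c * (real t ^ h)\<^sup>2)" by simp
  then have sl: "sqrt l \<le> sqrt c * real t ^ h" by (simp add: real_sqrt_mult)
  have "t ^ (k + h) \<le> t * n" using adm_bounds(2)[OF n] g by (simp add: good_def)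
  then have "real (t ^ (k + h)) \<le> real (t * n)" by (rule of_nat_mono)
  then have "real t ^ k * real t ^ h \<le> real t * real n" by (simp add: power_add)
  then have "real t ^ k * (sqrt c * real t ^ h) \<le> (real t * real n) * sqrt c"
    using c0 by (simp add: mult.assoc mult.left_commute mult_left_mono mult.commute)
  moreover have "real t ^ k * sqrt l \<le> real t ^ k * (sqrt c * real t ^ h)"
    using sl by (intro mult_left_mono) auto
  ultimately have "real t ^ k * sqrt l \<le> (real t * sqrt c) * real n" by (simp add: mult_ac)
  then have "real t ^ k \<le> (real t * sqrt c) * real n / sqrt l"
    using l by (simp add: pos_le_divide_eq)
  then have "(real t ^ k) powr \<tau> \<le> ((real t * sqrt c) * real n / sqrt l) powr \<tau>"
    using \<tau>0 by (intro powr_mono2) auto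
  also have "\<dots> = (real t * sqrt c) powr \<tau> * (real n powr \<tau> / sqrt l powr \<tau>)"
    using l c0 by (simp add: powr_mult powr_divide)
  also have "sqrt l powr \<tau> = l powr (\<tau> / 2)"
    using l by (simp add: powr_half_sqrt[symmetric] powr_powr)
  also have "(real t ^ k) powr \<tau> = real (r ^ k)"
  proof -
    have "(real t ^ k) powr \<tau> = (real t powr real k) powr \<tau>" using t1 by (simp add: powr_realpow)
    also have "\<dots> = (real t powr \<tau>) powr real k" by (simp add: powr_powr mult.commute)
    also have "\<dots> = real (r ^ k)" unfolding tr using r by (simp add: powr_realpow)
    finally show ?thesis .
  qed
  finally show ?thesis by (simp add: c_def l_def)
qed

text \<open>A bound in \<open>n\<close> alone, free of \<open>h\<close> and \<open>k\<close>.
  Rounding down is harmless because costs are integers.\<close>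

definition runtime :: "real \<Rightarrow> nat \<Rightarrow> nat" where
  "runtime \<tau> n = nat \<lfloor>real kProg * (((real t * sqrt (2 * real d * log 2 (real q))) powr \<tau> * (2 * bits 1)) *
       (real n powr \<tau> / log 2 (real n + 1) powr (\<tau> / 2 - 1)) + (2 * bits 1) ^ 5 * (real n ^ 2 * log 2 (real n + 1) ^ 5))\<rfloor>"

end

lemma main_term_bigo:
  fixes \<tau> :: real
  assumes "2 < \<tau>"
  shows "(\<lambda>n::nat. real n powr \<tau> / log 2 (real n + 1) powr (\<tau> / 2 - 1))
     \<in> O(\<lambda>n. real n powr \<tau> / (log 2 (real n)) powr (\<tau> / 2 - 1))"
  using assms by real_asymp

text \<open>The surplus \<open>n^(\<tau> - 2)\<close> outweighs every power of the
  logarithm.\<close>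

lemma rest_term_bigo:
  fixes \<tau> :: real
  assumes "2 < \<tau>"
  shows "(\<lambda>n::nat. real n ^ 2 * log 2 (real n + 1) ^ 5)
     \<in> O(\<lambda>n. real n powr \<tau> / (log 2 (real n)) powr (\<tau> / 2 - 1))"
  using assms by real_asymp

context encoded_scheme
begin

text \<open>Since \<open>nbits 1 = 1\<close>, the constant factor in \<open>bits\<close> can be
  written as \<open>bits 1\<close>.\<close>

lemma bits_eq: "bits n = bits 1 * nbits n"
proof -
  have "nbits 1 = 1" using nbits_ge_1[of 1] nbits_leI[of 1 1] by simp
  then show ?thesis unfolding bits_def by simp
qed

lemma cost_le_runtime:
  assumes n: "1 \<le> n" and g: "good n h k" and \<tau>: "\<tau> = log (real t) (real r)"
  shows "kProg * (r ^ k * bits n + n * n * bits n ^ 5) \<le> runtime \<tau> n"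
proof -
  define l where "l = log 2 (real n + 1)"
  define b where "b = real (2 * bits 1)"
  define c where "c = (real t * sqrt (2 * real d * log 2 (real q))) powr \<tau>"
  have l: "1 \<le> l" unfolding l_def using n by (simp add: le_log_iff)
  have bl: "real (bits n) \<le> b * l"
  proof -
    have "real (bits n) = real (bits 1) * real (nbits n)" by (subst bits_eq) simp
    also have "\<dots> \<le> real (bits 1) * (2 * l)"
      unfolding l_def using nbits_le_log[OF n] by (intro mult_left_mono) auto
    finally show ?thesis by (simp add: b_def)
  qed
  have "real (r ^ k) * real (bits n) \<le> (c * (real n powr \<tau> / l powr (\<tau> / 2))) * (b * l)"
    using rank_power_bound[OF n g \<tau>] bl by (intro mult_mono) (auto simp: c_def l_def)
  \<comment> \<open>The word length contributes one factor \<open>l\<close>, which lowers the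
    exponent of the denominator from \<open>\<tau> / 2\<close> to
    \<open>\<tau> / 2 - 1\<close>.\<close>
  also have "\<dots> = c * b * (real n powr \<tau> / l powr (\<tau> / 2 - 1))"
    using l by (simp add: powr_diff)
  finally have 1: "real (r ^ k) * real (bits n) \<le> c * b * (real n powr \<tau> / l powr (\<tau> / 2 - 1))" .
  have "real (bits n) ^ 5 \<le> (b * l) ^ 5" using bl by (intro power_mono) auto
  then have "real n ^ 2 * real (bits n) ^ 5 \<le> real n ^ 2 * (b * l) ^ 5" by (intro mult_left_mono) auto
  then have 2: "real n ^ 2 * real (bits n) ^ 5 \<le> b ^ 5 * (real n ^ 2 * l ^ 5)"
    by (simp add: power_mult_distrib mult_ac)
  have "real (kProg * (r ^ k * bits n + n * n * bits n ^ 5))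
      = real kProg * (real (r ^ k) * real (bits n) + real n ^ 2 * real (bits n) ^ 5)"
    by (simp add: power2_eq_square)
  also have "\<dots> \<le> real kProg * (c * b * (real n powr \<tau> / l powr (\<tau> / 2 - 1)) + b ^ 5 * (real n ^ 2 * l ^ 5))"
    using 1 2 by (intro mult_left_mono add_mono) auto
  finally show ?thesis
    unfolding runtime_def b_def[symmetric] c_def[symmetric] l_def[symmetric]
    by (simp add: le_nat_floor b_def c_def l_def)
qed

lemma runtime_bigo:
  assumes "2 < \<tau>"
  shows "(\<lambda>n. real (runtime \<tau> n)) \<in> O(\<lambda>n. real n powr \<tau> / (log 2 (real n)) powr (\<tau> / 2 - 1))"
proof -
  define b where "b = real (2 * bits 1)"
  define c where "c = (real t * sqrt (2 * real d * log 2 (real q))) powr \<tau>"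
  define f where "f n = real kProg * (c * b * (real n powr \<tau> / log 2 (real n + 1) powr (\<tau> / 2 - 1))
      + b ^ 5 * (real n ^ 2 * log 2 (real n + 1) ^ 5))" for n
  have f0: "0 \<le> f n" for n
  proof -
    have "0 \<le> log 2 (real n + 1)" by simp
    then show ?thesis unfolding f_def b_def c_def by (intro mult_nonneg_nonneg add_nonneg_nonneg) auto
  qed
  have "runtime \<tau> n = nat \<lfloor>f n\<rfloor>" for n
    by (simp add: runtime_def f_def b_def c_def)
  then have "real (runtime \<tau> n) \<le> f n" for n using f0[of n] by simp
  then have "(\<lambda>n. real (runtime \<tau> n)) \<in> O(f)"
    using f0 by (intro landau_o.bigI[of 1]) auto
  also have "f \<in> O(\<lambda>n. real n powr \<tau> / (log 2 (real n)) powr (\<tau> / 2 - 1))"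
  proof -
    have cm: "g \<in> O(g') \<Longrightarrow> (\<lambda>n. a * g n) \<in> O(g')" for a :: real and g g' :: "nat \<Rightarrow> real"
      by (cases "a = 0") auto
    show ?thesis unfolding f_def
      by (intro cm sum_in_bigo(1) main_term_bigo rest_term_bigo assms)
  qed
  finally show ?thesis .
qed

end

theorem theorem4p2:
  fixes t r :: nat
    and \<alpha> \<beta> \<gamma> :: "nat \<Rightarrow> nat \<Rightarrow> nat \<Rightarrow> 'a::{field,finite}"
    and enc :: "'a \<Rightarrow> nat"
    and \<tau> :: real
  assumes t: "t \<ge> 2" and r: "r \<ge> 1"
    and identity:
      "(\<Sum>i=1..t. \<Sum>j=1..t. \<Sum>k=1..t.
          mp_var (VarX i j) * mp_var (VarY j k) * mp_var (VarZ i k))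
       = (\<Sum>l=1..r.
           (\<Sum>i=1..t. \<Sum>j=1..t. mp_const (\<alpha> i j l) * mp_var (VarX i j)) *
           (\<Sum>j=1..t. \<Sum>k=1..t. mp_const (\<beta> j k l) * mp_var (VarY j k)) *
           (\<Sum>i=1..t. \<Sum>k=1..t. mp_const (\<gamma> i k l) * mp_var (VarZ i k)))"
    and \<tau>: "\<tau> = log (real t) (real r)"
    and enc: "bij_betw enc UNIV {..<card (UNIV :: 'a set)}"
  shows "\<exists>(P :: ram_program) (T :: nat \<Rightarrow> nat).
      (\<forall>n\<ge>1. \<forall>A\<in>carrier_mat n n. \<forall>B\<in>carrier_mat n n.
         \<exists>c s. exec P (mm_input enc n A B) c s \<and> c \<le> T n \<and> mm_output enc n s (A * B)) \<and>
      (\<lambda>n. real (T n)) \<in> O(\<lambda>n. real n powr \<tau> / (log 2 (real n)) powr (\<tau> / 2 - 1))"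
proof -
  \<comment> \<open>The identity counts from 1, the digits of Z-order from 0.\<close>
  define ca where "ca p l = \<alpha> (Suc (p div t)) (Suc (p mod t)) (Suc l)" for p l
  define cb where "cb p l = \<beta> (Suc (p div t)) (Suc (p mod t)) (Suc l)" for p l
  define cg where "cg p l = \<gamma> (Suc (p div t)) (Suc (p mod t)) (Suc l)" for p l
  have "(\<Sum>l<r. ca p1 l * cb p2 l * cg p3 l) =
      (if p1 div t = p3 div t \<and> p1 mod t = p2 div t \<and> p2 mod t = p3 mod t then 1 else 0)"
    if p: "p1 < t * t" "p2 < t * t" "p3 < t * t" for p1 p2 p3
  proof -
    have ran: "Suc (p div t) \<in> {1..t}" "Suc (p mod t) \<in> {1..t}" if "p < t * t" for p
      using that t by (auto simp: Suc_le_eq less_mult_imp_div_less)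
    have "(\<Sum>l<r. ca p1 l * cb p2 l * cg p3 l) = (\<Sum>l=1..r. \<alpha> (Suc (p1 div t)) (Suc (p1 mod t)) l *
        \<beta> (Suc (p2 div t)) (Suc (p2 mod t)) l * \<gamma> (Suc (p3 div t)) (Suc (p3 mod t)) l)"
      by (simp add: ca_def cb_def cg_def sum.atLeast1_atMost_eq)
    also have "\<dots> = (if Suc (p1 div t) = Suc (p3 div t) \<and> Suc (p1 mod t) = Suc (p2 div t) \<and>
        Suc (p2 mod t) = Suc (p3 mod t) then 1 else 0)"
      by (rule coeff_identity[OF identity ran(1)[OF p(1)] ran(2)[OF p(1)] ran(1)[OF p(2)] ran(2)[OF p(2)]
            ran(1)[OF p(3)] ran(2)[OF p(3)]])
    finally show ?thesis by simp
  qed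
  then interpret encoded_scheme t r ca cb cg enc
    using t r enc by unfold_locales
  \<comment> \<open>The strict inequality \<open>d < r\<close> is what pushes the exponent above
    2.\<close>
  have "real t ^ 2 < real r"
    using d_gt by (simp add: d_def power2_eq_square flip: of_nat_mult)
  then have "log t (real t ^ 2) < \<tau>"
    unfolding \<tau> using t by (subst log_less_cancel_iff) auto
  then have "2 < \<tau>" using t by (simp add: log_nat_power)
  have "\<exists>c s. exec prog (mm_input enc n A B) c s \<and> c \<le> runtime \<tau> n \<and> mm_output enc n s (A * B)"
    if nAB: "1 \<le> n" "A \<in> carrier_mat n n" "B \<in> carrier_mat n n" for n A B
  proof -
    obtain c s h k where run: "exec prog (mm_input enc n A B) c s"
      "c \<le> kProg * (r ^ k * bits n + n * n * bits n ^ 5)" "mm_output enc n s (A * B)" "good n h k"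
      using prog_correct[OF nAB] by blast
    then show ?thesis using cost_le_runtime[OF nAB(1) run(4) \<tau>] le_trans by blast
  qed
  then show ?thesis using runtime_bigo[OF \<open>2 < \<tau>\<close>] by blast
qed

end
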